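(* Let $r\ge1$ and consider a minimum-phase nonlinear system of the form $$\dot z=f(z,\xi_1),\qquad \dot\xi_i=\xi_{i+1}\ (1\le i\le r-1),\qquad \dot\xi_r=\bar q(z,\xi_1,\dots,\xi_r)+\bar b(z,\xi_1,\dots,\xi_r)u,$$ with $z\in\mathbb R^{n-r}$, $u\in\mathbb R$, and $\bar b\ge b_0>0$ everywhere for some constant $b_0$. For any $R>0$ and any $\varepsilon>0$ there exist a row vector $a\in\mathbb R^{1\times(r-1)}$ and, with $\xi=(\xi_1,\dots,\xi_{r-1})^T$ and $\zeta=a\xi+\xi_r$, a feedback law of each of the following three types: (i) a quantized feedback law $u=-\Psi(\bar k\zeta)$ (solutions being understood in the Krasowskii sense); (ii) a quantized feedback law with hysteresis $u=-\Psi_m(\bar k\zeta)$; (iii) a ternary switched feedback law with parameters $(\bar k,\eta)$ driven by $\zeta$; and for each such law a time $T>0$, such that any trajectory $\varphi$ of the corresponding closed-loop system which starts in the cube of $\mathbb R^n$ centered at the origin of side $2R$ lies in the cube centered at the origin of side $2\varepsilon$ for all $t\ge T$.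
   Context: The functions $f,\bar q,\bar b$ are smooth. The system is called minimum-phase if $z=0$ is a globally asymptotically stable equilibrium of $\dot z=f(z,0)$. For $r=1$, $\xi$ is empty and $\zeta=\xi_1$. All design parameters ($a$, $\bar k>0$, $u_0>0$, $j\in\mathbb N$, $\delta\in(0,1)$, $\eta>0$) may depend on $R$ and $\varepsilon$. Quantizers: for $u_0>0$, $j\in\mathbb N$, $\delta\in(0,1)$ put $\rho=\frac{1-\delta}{1+\delta}$, $u_i=\rho^iu_0$. The logarithmic quantizer is $\Psi(s)=u_i$ if $\frac{u_i}{1+\delta}<s\le\frac{u_i}{1-\delta}$ for some $0\le i\le j$; $\Psi(s)=0$ if $0\le s\le\frac{u_j}{1+\delta}$; $\Psi(s)=-\Psi(-s)$ if $s<0$ (defined only for $|s|\le\frac{u_0}{1-\delta}$; $u_0$ is to be chosen so that this bound is never exceeded along the trajectories considered). The hysteretic quantizer $\Psi_m$ takes values in $\{0\}\cup\{\pm u_i,\pm\frac{u_i}{1+\delta}:0\le i\le j\}$, and its current value along a signal $s(t)=\bar k\zeta(t)$ evolves as follows. Initially it equals $\Psi(s(0))$. It stays constant until $s(t)$ meets the guard of a transition leaving the current value, at which instant it jumps to the destination value (this also applies at $t=0$). The transitions are: - from $u_i$ to $\frac{u_i}{1+\delta}$ when $s=\frac{u_i}{1+\delta}$ ($0\le i\le j$); - from $\frac{u_i}{1+\delta}$ to $u_i$ when $s=\frac{u_i}{1-\delta^2}$ ($0\le i\le j$); - from $\frac{u_i}{1+\delta}$ to $u_{i+1}$ when $s=\frac{u_i}{(1+\delta)^2}$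 ($0\le i\le j-1$); - from $u_{i+1}$ to $\frac{u_i}{1+\delta}$ when $s=\frac{u_i}{1+\delta}$ ($0\le i\le j-1$); - from $\frac{u_j}{1+\delta}$ to $0$ when $s=\frac{u_j}{(1+\delta)^2}$; - from $0$ to $\frac{u_j}{1+\delta}$ when $s=\frac{u_j}{1+\delta}$; - the mirror images of all these under $(s,\text{value})\mapsto(-s,-\text{value})$. Krasowskii solution of $\dot y=H(t,y)$ (with $H$ possibly discontinuous): an absolutely continuous curve $\varphi:[0,+\infty)\to\mathbb R^n$ with $\dot\varphi(t)\in K(H(t,\varphi(t)))$ for almost every $t\ge0$, where $K(H(t,y))=\bigcap_{\epsilon>0}\overline{\mathrm{co}}\,H(t,B_\epsilon(y))$ ($B_\epsilon(y)$ the ball of radius $\epsilon$ about $y$, $\overline{\mathrm{co}}$ the closed convex hull). Ternary switched controller with parameters $\bar k>0$, $\eta>0$: $u(0)=-\bar k$ if $\zeta(0)\ge\eta$, $u(0)=0$ if $|\zeta(0)|<\eta$, $u(0)=\bar k$ if $\zeta(0)\le-\eta$. For $t\ge0$, the value $u(t^+)$ right after time $t$ is: - $-\bar k$ if ($u(t)=0$ and $\zeta(t)\ge\eta$) or ($u(t)=-\bar k$ and $\zeta(t)>\eta/2$); - $0$ if ($u(t)=-\bar k$ and $\zeta(t)\le\eta/2$) or ($u(t)=\bar k$ and $\zeta(t)\ge-\eta/2$) or ($u(t)=0$ and $|\zeta(t)|<\eta$); - $\bar k$ if ($u(t)=0$ and $\zeta(t)\le-\eta$) or ($u(t)=\bar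 k$ and $\zeta(t)<-\eta/2$). Cubes are taken in the coordinates $(z,\xi_1,\dots,\xi_r)\in\mathbb R^n$, with edges parallel to the axes. *)

theory Defs
  imports "HOL-Analysis.Analysis"
begin

section \<open>Smooth functions\<close>

primrec times_differentiable ::
    "nat \<Rightarrow> ('a::real_normed_vector \<Rightarrow> 'b::real_normed_vector) \<Rightarrow> bool" where
  "times_differentiable 0 g \<longleftrightarrow> continuous_on UNIV g"
| "times_differentiable (Suc k) g \<longleftrightarrow>
     (\<forall>x. g differentiable (at x)) \<and>
     (\<forall>v. times_differentiable k (\<lambda>x. frechet_derivative g (at x) v))"

definition smooth :: "('a::real_normed_vector \<Rightarrow> 'b::real_normed_vector) \<Rightarrow> bool" where
  "smooth g \<longleftrightarrow> (\<forall>k. times_differentiable k g)"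

section \<open>Global asymptotic stability\<close>

definition forward_solution :: "('a::real_normed_vector \<Rightarrow> 'a) \<Rightarrow> (real \<Rightarrow> 'a) \<Rightarrow> bool" where
  "forward_solution g x \<longleftrightarrow>
     (\<forall>t\<ge>0. (x has_vector_derivative g (x t)) (at t within {0..}))"

text \<open>Forward completeness (the third conjunct) is part of the notion: stability and attraction
  concern solutions issuing from every initial state, and must not hold merely because
  some of them escape in finite time.\<close>

definition globally_asymptotically_stable ::
    "('a::real_normed_vector \<Rightarrow> 'a) \<Rightarrow> 'a \<Rightarrow> bool" where
  "globally_asymptotically_stable g p \<longleftrightarrow>
     g p = 0 \<and>
     (\<forall>e>0. \<exists>d>0. \<forall>x. forward_solution g x \<and> dist (x 0) p < d \<longrightarrow> (\<forall>t\<ge>0. dist (x t) p < e)) \<and>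
     (\<forall>x0. \<exists>x. forward_solution g x \<and> x 0 = x0) \<and>
     (\<forall>x. forward_solution g x \<longrightarrow> (x \<longlongrightarrow> p) at_top)"

definition minimum_phase :: "('z::real_normed_vector \<times> real \<Rightarrow> 'z) \<Rightarrow> bool" where
  "minimum_phase f \<longleftrightarrow> globally_asymptotically_stable (\<lambda>z. f (z, 0)) 0"

section \<open>The controlled system\<close>

text \<open>The vector \<open>z\<close> lives in a finite-dimensional real inner product space \<open>'z\<close> with a fixed
  orthonormal basis \<open>E\<close>, so that \<open>card E = n - r\<close> and the Cartesian coordinates of \<open>z\<close> are the
  \<open>z \<bullet> e\<close> with \<open>e \<in> E\<close>. Unlike \<open>real ^ 'm\<close> this covers \<open>n = r\<close>, where \<open>z\<close> is empty
  (\<open>E = {}\<close>). The sort \<open>heine_borel\<close> is no restriction: it holds for each finite-dimensional space.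
  The remaining coordinates form a vector of \<open>real ^ 'r\<close>, \<open>r = CARD('r)\<close>, whose axes are numbered
  by a bijection \<open>ix\<close> from \<open>{1..r}\<close>: \<open>\<xi>\<^sub>i\<close> is \<open>x $ ix i\<close>.\<close>

definition orthonormal_basis :: "'z::real_inner set \<Rightarrow> bool" where
  "orthonormal_basis E \<longleftrightarrow>
     finite E \<and> pairwise orthogonal E \<and> (\<forall>e\<in>E. norm e = 1) \<and> span E = UNIV"

definition plant ::
    "(nat \<Rightarrow> 'r::finite) \<Rightarrow> ('z::real_normed_vector \<times> real \<Rightarrow> 'z) \<Rightarrow> ('z \<times> (real ^ 'r) \<Rightarrow> real) \<Rightarrow>
     ('z \<times> (real ^ 'r) \<Rightarrow> real) \<Rightarrow> real \<Rightarrow> 'z \<times> (real ^ 'r) \<Rightarrow> 'z \<times> (real ^ 'r)" where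
  "plant ix f q b u y =
     (f (fst y, snd y $ ix 1),
      (\<Sum>i\<in>{1..<CARD('r)}. (snd y $ ix (Suc i)) *\<^sub>R axis (ix i) 1) +
        (q y + b y * u) *\<^sub>R axis (ix CARD('r)) 1)"

text \<open>The row vector \<open>a\<close> is represented by its entries \<open>a 1, \<dots>, a (r - 1)\<close>.\<close>

definition zeta :: "(nat \<Rightarrow> 'r::finite) \<Rightarrow> (nat \<Rightarrow> real) \<Rightarrow> 'z \<times> (real ^ 'r) \<Rightarrow> real" where
  "zeta ix a y = (\<Sum>i\<in>{1..<CARD('r)}. a i * snd y $ ix i) + snd y $ ix CARD('r)"

text \<open>The cube centered at the origin of side \<open>2 * \<rho>\<close>.\<close>

definition cube :: "'z::real_inner set \<Rightarrow> real \<Rightarrow> ('z \<times> (real ^ 'r::finite)) set" where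
  "cube E \<rho> = {y. (\<forall>e\<in>E. \<bar>fst y \<bullet> e\<bar> \<le> \<rho>) \<and> (\<forall>k. \<bar>snd y $ k\<bar> \<le> \<rho>)}"

section \<open>Absolutely continuous solutions\<close>

definition abs_cont_on_interval :: "real \<Rightarrow> real \<Rightarrow> (real \<Rightarrow> 'a::real_normed_vector) \<Rightarrow> bool" where
  "abs_cont_on_interval c d x \<longleftrightarrow>
     (\<forall>e>0. \<exists>w>0. \<forall>(n::nat) l u.
        (\<forall>i<n. c \<le> l i \<and> l i \<le> u i \<and> u i \<le> d) \<and>
        disjoint_family_on (\<lambda>i. {l i<..<u i}) {..<n} \<and> (\<Sum>i<n. u i - l i) < w \<longrightarrow>
        (\<Sum>i<n. norm (x (u i) - x (l i))) < e)"

text \<open>As usual for curves on \<open>[0, +\<infinity>)\<close>, absolute continuity is required on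
  compact subintervals.\<close>

definition abs_cont_curve :: "(real \<Rightarrow> 'a::real_normed_vector) \<Rightarrow> bool" where
  "abs_cont_curve x \<longleftrightarrow> (\<forall>d\<ge>0. abs_cont_on_interval 0 d x)"

definition krasowskii_hull :: "('a::real_normed_vector \<Rightarrow> 'a) \<Rightarrow> 'a \<Rightarrow> 'a set" where
  "krasowskii_hull h y = (\<Inter>e\<in>{0<..}. closure (convex hull (h ` ball y e)))"

definition krasowskii_solution ::
    "(real \<Rightarrow> 'a::real_normed_vector \<Rightarrow> 'a) \<Rightarrow> (real \<Rightarrow> 'a) \<Rightarrow> bool" where
  "krasowskii_solution H x \<longleftrightarrow> abs_cont_curve x \<and>
     (AE t in lebesgue. 0 \<le> t \<longrightarrow>
        (\<exists>v. (x has_vector_derivative v) (at t) \<and> v \<in> krasowskii_hull (H t) (x t)))"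

definition caratheodory_solution ::
    "(real \<Rightarrow> 'a::real_normed_vector \<Rightarrow> 'a) \<Rightarrow> (real \<Rightarrow> 'a) \<Rightarrow> bool" where
  "caratheodory_solution H x \<longleftrightarrow> abs_cont_curve x \<and>
     (AE t in lebesgue. 0 \<le> t \<longrightarrow> (x has_vector_derivative H t (x t)) (at t))"

section \<open>Logarithmic quantizer\<close>

definition level :: "real \<Rightarrow> real \<Rightarrow> nat \<Rightarrow> real" where
  "level u0 \<delta> i = ((1 - \<delta>) / (1 + \<delta>)) ^ i * u0"

definition in_band :: "real \<Rightarrow> real \<Rightarrow> nat \<Rightarrow> real \<Rightarrow> bool" where
  "in_band u0 \<delta> i s \<longleftrightarrow> level u0 \<delta> i / (1 + \<delta>) < s \<and> s \<le> level u0 \<delta> i / (1 - \<delta>)"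

definition quantizer_nonneg :: "real \<Rightarrow> nat \<Rightarrow> real \<Rightarrow> real \<Rightarrow> real" where
  "quantizer_nonneg u0 j \<delta> s =
     (if \<exists>i\<le>j. in_band u0 \<delta> i s then level u0 \<delta> (THE i. i \<le> j \<and> in_band u0 \<delta> i s) else 0)"

text \<open>Outside its domain \<open>\<bar>s\<bar> \<le> u0 / (1 - \<delta>)\<close> the quantizer has the dummy value \<open>0\<close>;
  that trajectories respect this bound has to be ensured separately.\<close>

definition quantizer :: "real \<Rightarrow> nat \<Rightarrow> real \<Rightarrow> real \<Rightarrow> real" where
  "quantizer u0 j \<delta> s =
     (if 0 \<le> s then quantizer_nonneg u0 j \<delta> s else - quantizer_nonneg u0 j \<delta> (- s))"

definition quantized_trajectory where
  "quantized_trajectory ix f q b a kbar u0 j \<delta> x \<longleftrightarrow>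
     krasowskii_solution
       (\<lambda>t y. plant ix f q b (- quantizer u0 j \<delta> (kbar * zeta ix a y)) y) x"

section \<open>Quantizer with hysteresis\<close>

text \<open>\<open>half_transition u0 j \<delta> v s w\<close>: transition from the value \<open>v\<close> to the value \<open>w\<close> with
  guard \<open>s\<close>, up to the reflection \<open>(s, v) \<mapsto> (- s, - v)\<close>.\<close>

inductive half_transition :: "real \<Rightarrow> nat \<Rightarrow> real \<Rightarrow> real \<Rightarrow> real \<Rightarrow> real \<Rightarrow> bool"
  for u0 j \<delta> where
  "i \<le> j \<Longrightarrow> half_transition u0 j \<delta>
     (level u0 \<delta> i) (level u0 \<delta> i / (1 + \<delta>)) (level u0 \<delta> i / (1 + \<delta>))"
| "i \<le> j \<Longrightarrow> half_transition u0 j \<delta>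
     (level u0 \<delta> i / (1 + \<delta>)) (level u0 \<delta> i / (1 - \<delta>\<^sup>2)) (level u0 \<delta> i)"
| "i < j \<Longrightarrow> half_transition u0 j \<delta>
     (level u0 \<delta> i / (1 + \<delta>)) (level u0 \<delta> i / (1 + \<delta>)\<^sup>2) (level u0 \<delta> (Suc i))"
| "i < j \<Longrightarrow> half_transition u0 j \<delta>
     (level u0 \<delta> (Suc i)) (level u0 \<delta> i / (1 + \<delta>)) (level u0 \<delta> i / (1 + \<delta>))"
| "half_transition u0 j \<delta>
     (level u0 \<delta> j / (1 + \<delta>)) (level u0 \<delta> j / (1 + \<delta>)\<^sup>2) 0"
| "half_transition u0 j \<delta>
     0 (level u0 \<delta> j / (1 + \<delta>)) (level u0 \<delta> j / (1 + \<delta>))"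

definition transition :: "real \<Rightarrow> nat \<Rightarrow> real \<Rightarrow> real \<Rightarrow> real \<Rightarrow> real \<Rightarrow> bool" where
  "transition u0 j \<delta> v s w \<longleftrightarrow>
     half_transition u0 j \<delta> v s w \<or> half_transition u0 j \<delta> (- v) (- s) (- w)"

definition hysteresis_step :: "real \<Rightarrow> nat \<Rightarrow> real \<Rightarrow> real \<Rightarrow> real \<Rightarrow> real \<Rightarrow> bool" where
  "hysteresis_step u0 j \<delta> v s w \<longleftrightarrow>
     transition u0 j \<delta> v s w \<or> (w = v \<and> (\<nexists>w'. transition u0 j \<delta> v s w'))"

text \<open>\<open>m t\<close> is the value of the hysteretic quantizer at time \<open>t\<close> when driven by the signal \<open>s\<close>,
  at a switching instant already the destination value. The value just before time \<open>t > 0\<close> is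
  the locally constant left value \<open>v\<close>; before time \<open>0\<close> it is the initial value.\<close>

definition hysteretic_output ::
    "real \<Rightarrow> nat \<Rightarrow> real \<Rightarrow> (real \<Rightarrow> real) \<Rightarrow> (real \<Rightarrow> real) \<Rightarrow> bool" where
  "hysteretic_output u0 j \<delta> s m \<longleftrightarrow>
     hysteresis_step u0 j \<delta> (quantizer u0 j \<delta> (s 0)) (s 0) (m 0) \<and>
     (\<forall>t>0. \<exists>v. (\<forall>\<^sub>F \<tau> in at_left t. m \<tau> = v) \<and> hysteresis_step u0 j \<delta> v (s t) (m t)) \<and>
     (\<forall>t\<ge>0. \<forall>\<^sub>F \<tau> in at_right t. m \<tau> = m t)"

definition hysteretic_trajectory where
  "hysteretic_trajectory ix f q b a kbar u0 j \<delta> x \<longleftrightarrow>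
     (\<exists>m. hysteretic_output u0 j \<delta> (\<lambda>t. kbar * zeta ix a (x t)) m \<and>
          caratheodory_solution (\<lambda>t y. plant ix f q b (- m t) y) x)"

section \<open>Ternary switched controller\<close>

definition ternary_init :: "real \<Rightarrow> real \<Rightarrow> real \<Rightarrow> real" where
  "ternary_init kbar \<eta> s = (if s \<ge> \<eta> then - kbar else if s \<le> - \<eta> then kbar else 0)"

text \<open>For \<open>v \<in> {- kbar, 0, kbar}\<close>, the last branch collects exactly the cases in which the new
  value is \<open>0\<close>.\<close>

definition ternary_next :: "real \<Rightarrow> real \<Rightarrow> real \<Rightarrow> real \<Rightarrow> real" where
  "ternary_next kbar \<eta> v s =
     (if (v = 0 \<and> s \<ge> \<eta>) \<or> (v = - kbar \<and> s > \<eta> / 2) then - kbar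
      else if (v = 0 \<and> s \<le> - \<eta>) \<or> (v = kbar \<and> s < - \<eta> / 2) then kbar
      else 0)"

text \<open>The input is piecewise constant and left-continuous: the update computed from \<open>u t\<close> is the
  value \<open>u (t\<^sup>+)\<close>.\<close>

definition ternary_input ::
    "real \<Rightarrow> real \<Rightarrow> (real \<Rightarrow> real) \<Rightarrow> (real \<Rightarrow> real) \<Rightarrow> bool" where
  "ternary_input kbar \<eta> s u \<longleftrightarrow>
     u 0 = ternary_init kbar \<eta> (s 0) \<and>
     (\<forall>t>0. \<forall>\<^sub>F \<tau> in at_left t. u \<tau> = u t) \<and>
     (\<forall>t\<ge>0. \<forall>\<^sub>F \<tau> in at_right t. u \<tau> = ternary_next kbar \<eta> (u t) (s t))"

definition ternary_trajectory where
  "ternary_trajectory ix f q b a kbar \<eta> x \<longleftrightarrow>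
     (\<exists>u. ternary_input kbar \<eta> (\<lambda>t. zeta ix a (x t)) u \<and>
          caratheodory_solution (\<lambda>t y. plant ix f q b (u t) y) x)"

end

theory Submission
  imports Defs
begin

text \<open>The controllers only have to make the scalar \<open>\<zeta>\<close> small; the vector \<open>a\<close> then does the rest. With
\<open>n = r - 1\<close>, take \<open>a\<close> such that \<open>\<zeta> = (d/dt + g)\<^sup>n \<xi>\<^sub>1\<close>, the coefficients being those of \<open>(s + g)\<^sup>n\<close>
for a large gain \<open>g\<close>. The signals \<open>\<theta>\<^sub>k = (d/dt + g)\<^sup>k \<xi>\<^sub>1 / g\<^sup>k\<close> form a chain of filters
\<open>\<theta>\<^sub>k' = g (\<theta>\<^sub>k\<^sub>+\<^sub>1 - \<theta>\<^sub>k)\<close> which starts with \<open>\<theta>\<^sub>0 = \<xi>\<^sub>1\<close> and is driven by \<open>\<theta>\<^sub>n = \<zeta> / g\<^sup>n\<close>. On the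
initial cube all \<open>\<theta>\<^sub>k\<close> are bounded by \<open>2\<^sup>n R\<close>, independently of \<open>g\<close>, and each filter preserves such a
bound. Hence \<open>\<xi>\<^sub>1\<close>, the only coordinate that enters the \<open>z\<close> equation, does not peak, although
the higher \<open>\<xi>\<^sub>i\<close> may; and it becomes small within a time proportional to \<open>1/g\<close> once \<open>\<zeta>\<close> is small.

The \<open>z\<close> equation is therefore driven by an input that is bounded for a very short time, during
which \<open>z\<close> moves by at most \<open>1/2\<close>, and small afterwards. For the second phase, solutions of \<open>z' = f (z, 0)\<close> from a compact set are followed closely over a bounded
time by all solutions with a small input, and compactness makes time and input bound uniform; this
also applies to a small ball, in which solutions are then trapped by repetition
(\<open>practical_stability\<close>).

What is used of the controllers is common to all three and is isolated in the predicate
\<open>regulated\<close>: the input opposes \<open>\<zeta>\<close> with strength at least \<open>U\<close> as long as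
\<open>\<mu> < \<bar>\<zeta>\<bar> < W\<close>. This drives \<open>\<zeta>\<close> into the band \<open>\<bar>\<zeta>\<bar> \<le> \<mu>\<close> and keeps it there, whatever the input does
inside the band. Quantizers with the single level \<open>j = 0\<close> achieve this: the thresholds are
adjusted to \<open>\<mu>\<close> by \<open>kbar\<close>, the saturation bound to \<open>W\<close> by letting \<open>\<delta>\<close> be close to \<open>1\<close>, and the
output value to \<open>U\<close> by \<open>u0\<close>. The constants are chosen in the order \<open>g\<close>, \<open>\<mu>\<close> and \<open>W\<close>, \<open>U\<close>, and
\<open>practical_regulation\<close> combines the estimates: the bounds for \<open>z\<close>, \<open>\<xi>\<close> and \<open>\<zeta>\<close> depend on one another,
so they are proved together by continuation along the time axis.

Trajectories are only absolutely continuous, which is dealt with first: a real function of this kind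
grows at most as fast as the almost everywhere bound of its derivative allows
(\<open>abs_cont_increment_le\<close>). For \<open>\<zeta>\<close> this gives the decrease; the other coordinates,
whose equations have a continuous right-hand side, turn out to be continuously differentiable.\<close>

section \<open>Continuation along the time axis\<close>

lemma real_induction:
  fixes s t :: real
  assumes closed: "\<And>t. s \<le> t \<Longrightarrow> (\<And>\<tau>. s \<le> \<tau> \<Longrightarrow> \<tau> < t \<Longrightarrow> P \<tau>) \<Longrightarrow> P t"
    and progress: "\<And>t. s \<le> t \<Longrightarrow> P t \<Longrightarrow> \<forall>\<^sub>F \<tau> in at_right t. P \<tau>"
    and "s \<le> t"
  shows "P t"
proof (rule ccontr)
  define N where "N = {\<tau>. s \<le> \<tau> \<and> \<not> P \<tau>}"
  assume "\<not> P t"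
  then have ne: "N \<noteq> {}" and bdd: "bdd_below N"
    using \<open>s \<le> t\<close> by (auto simp: N_def intro: bdd_belowI)
  define i where "i = Inf N"
  have "s \<le> i" unfolding i_def using ne by (intro cInf_greatest) (auto simp: N_def)
  have before: "P \<tau>" if "s \<le> \<tau>" "\<tau> < i" for \<tau>
    using cInf_lower[OF _ bdd, of \<tau>] that by (fastforce simp: N_def i_def)
  have "P i" using closed[OF \<open>s \<le> i\<close>] before by blast
  from progress[OF \<open>s \<le> i\<close> this] obtain c where c: "c > i" "\<And>\<tau>. i < \<tau> \<Longrightarrow> \<tau> < c \<Longrightarrow> P \<tau>"
    by (auto simp: eventually_at_right_field)
  obtain \<tau> where "\<tau> \<in> N" "\<tau> < c"
    using cInf_lessD[OF ne, of c] c(1) by (auto simp: i_def)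
  moreover have "i \<le> \<tau>" using cInf_lower[OF \<open>\<tau> \<in> N\<close> bdd] by (simp add: i_def)
  ultimately show False
    using c(2)[of \<tau>] \<open>P i\<close> by (cases "\<tau> = i") (auto simp: N_def)
qed

text \<open>The form in which bootstrap arguments are used below: to keep \<open>x\<close> in \<open>G\<close> it is enough that having been in
\<open>G\<close> up to a time prevents \<open>x\<close> from being on the boundary of \<open>G\<close> at that time.\<close>

lemma stays_in_open:
  fixes x :: "real \<Rightarrow> 'a::t2_space"
  assumes cont: "continuous_on {s..d} x" and "open G" and "x s \<in> G"
    and step: "\<And>t. s < t \<Longrightarrow> t \<le> d \<Longrightarrow> (\<And>\<tau>. \<tau> \<in> {s..<t} \<Longrightarrow> x \<tau> \<in> G) \<Longrightarrow> x t \<in> closure G \<Longrightarrow> x t \<in> G"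
    and t: "t \<in> {s..d}"
  shows "x t \<in> G"
proof -
  have "t \<le> d \<longrightarrow> x t \<in> G"
  proof (rule real_induction[where s = s])
    fix t assume st: "s \<le> t" and IH: "\<And>\<tau>. s \<le> \<tau> \<Longrightarrow> \<tau> < t \<Longrightarrow> \<tau> \<le> d \<longrightarrow> x \<tau> \<in> G"
    show "t \<le> d \<longrightarrow> x t \<in> G"
    proof (cases "s < t \<and> t \<le> d")
      case True
      then have cl: "closure {s..<t} = {s..t}" by simp
      have "x ` closure {s..<t} \<subseteq> closure G"
      proof (rule image_closure_subset)
        show "continuous_on (closure {s..<t}) x"
          unfolding cl using True by (intro continuous_on_subset[OF cont]) auto
        show "x ` {s..<t} \<subseteq> closure G" using IH True closure_subset by fastforce
      qed simp
      then have "x t \<in> closure G" unfolding cl using True by auto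
      moreover have "x \<tau> \<in> G" if "\<tau> \<in> {s..<t}" for \<tau> using IH[of \<tau>] that True by auto
      ultimately show ?thesis using step True by blast
    qed (use st \<open>x s \<in> G\<close> in auto)
  next
    fix t assume st: "s \<le> t" and P: "t \<le> d \<longrightarrow> x t \<in> G"
    show "\<forall>\<^sub>F \<tau> in at_right t. \<tau> \<le> d \<longrightarrow> x \<tau> \<in> G"
    proof (cases "t < d")
      case True
      then have "\<forall>\<^sub>F \<tau> in at t within {s..d}. x \<tau> \<in> G"
        using P st cont \<open>open G\<close> by (auto simp: continuous_on_def intro: topological_tendstoD)
      then have "\<forall>\<^sub>F \<tau> in at t within {t<..d}. x \<tau> \<in> G"
        by (rule filter_leD[rotated]) (use st in \<open>auto intro: at_le\<close>)
      then show ?thesis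
        by (auto simp: eventually_at_filter elim: eventually_mono)
    next
      case False
      then show ?thesis
        by (auto simp: eventually_at_right_field intro!: exI[of _ "t + 1"])
    qed
  qed (use t in auto)
  then show ?thesis using t by auto
qed

section \<open>Absolutely continuous functions\<close>

lemma abs_cont_continuous_on:
  assumes "abs_cont_on_interval c d x"
  shows "continuous_on {c..d} x"
  unfolding continuous_on_iff
proof (intro ballI allI impI)
  fix s e :: real assume s: "s \<in> {c..d}" and "e > 0"
  then obtain w where w: "w > 0" "\<And>(n::nat) l u.
        (\<forall>i<n. c \<le> l i \<and> l i \<le> u i \<and> u i \<le> d) \<and>
        disjoint_family_on (\<lambda>i. {l i<..<u i}) {..<n} \<and> (\<Sum>i<n. u i - l i) < w \<Longrightarrow>
        (\<Sum>i<n. norm (x (u i) - x (l i))) < e"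
    using assms unfolding abs_cont_on_interval_def by blast
  have "dist (x t) (x s) < e" if t: "t \<in> {c..d}" "dist t s < w" for t
    using w(2)[of 1 "\<lambda>_. min s t" "\<lambda>_. max s t"] s t
    by (auto simp: disjoint_family_on_def dist_norm abs_real_def norm_minus_commute min_def max_def
        split: if_splits)
  then show "\<exists>w>0. \<forall>t\<in>{c..d}. dist t s < w \<longrightarrow> dist (x t) (x s) < e"
    using w(1) by blast
qed

lemma abs_cont_on_subinterval:
  assumes "abs_cont_on_interval c d x" "c \<le> c'" "d' \<le> d"
  shows "abs_cont_on_interval c' d' x"
  unfolding abs_cont_on_interval_def
proof (intro allI impI)
  fix e :: real assume "e > 0"
  then obtain w where w: "w > 0" "\<And>(n::nat) l u.
        (\<forall>i<n. c \<le> l i \<and> l i \<le> u i \<and> u i \<le> d) \<and>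
        disjoint_family_on (\<lambda>i. {l i<..<u i}) {..<n} \<and> (\<Sum>i<n. u i - l i) < w \<Longrightarrow>
        (\<Sum>i<n. norm (x (u i) - x (l i))) < e"
    using assms(1) unfolding abs_cont_on_interval_def by blast
  show "\<exists>w>0. \<forall>(n::nat) l u. (\<forall>i<n. c' \<le> l i \<and> l i \<le> u i \<and> u i \<le> d') \<and>
          disjoint_family_on (\<lambda>i. {l i<..<u i}) {..<n} \<and> (\<Sum>i<n. u i - l i) < w \<longrightarrow>
          (\<Sum>i<n. norm (x (u i) - x (l i))) < e"
    using assms(2,3) by (intro exI[of _ w] conjI allI impI w) force+
qed

lemma abs_cont_lipschitz_compose:
  assumes "abs_cont_on_interval c d x"
    and lip: "\<And>s t. s \<in> {c..d} \<Longrightarrow> t \<in> {c..d} \<Longrightarrow>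
       norm (y s - y t) \<le> M * (norm (x s - x t) + \<bar>s - t\<bar>)"
  shows "abs_cont_on_interval c d y"
  unfolding abs_cont_on_interval_def
proof (intro allI impI)
  fix e :: real assume "e > 0"
  define M' where "M' = \<bar>M\<bar> + 1"
  have M': "M' > 0" "M \<le> M'" by (auto simp: M'_def)
  define e' where "e' = e / (2 * M')"
  have "e' > 0" using \<open>e > 0\<close> M' by (simp add: e'_def)
  then obtain w where w: "w > 0" "\<And>(n::nat) l u.
        (\<forall>i<n. c \<le> l i \<and> l i \<le> u i \<and> u i \<le> d) \<and>
        disjoint_family_on (\<lambda>i. {l i<..<u i}) {..<n} \<and> (\<Sum>i<n. u i - l i) < w \<Longrightarrow>
        (\<Sum>i<n. norm (x (u i) - x (l i))) < e'"
    using assms(1) unfolding abs_cont_on_interval_def by blast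
  show "\<exists>w>0. \<forall>(n::nat) l u. (\<forall>i<n. c \<le> l i \<and> l i \<le> u i \<and> u i \<le> d) \<and>
          disjoint_family_on (\<lambda>i. {l i<..<u i}) {..<n} \<and> (\<Sum>i<n. u i - l i) < w \<longrightarrow>
          (\<Sum>i<n. norm (y (u i) - y (l i))) < e"
  proof (intro exI[of _ "min w e'"] conjI allI impI)
    fix n :: nat and l u :: "nat \<Rightarrow> real"
    assume lu: "(\<forall>i<n. c \<le> l i \<and> l i \<le> u i \<and> u i \<le> d) \<and>
       disjoint_family_on (\<lambda>i. {l i<..<u i}) {..<n} \<and> (\<Sum>i<n. u i - l i) < min w e'"
    have "(\<Sum>i<n. norm (y (u i) - y (l i))) \<le> (\<Sum>i<n. M' * (norm (x (u i) - x (l i)) + (u i - l i)))"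
    proof (rule sum_mono)
      fix i assume "i \<in> {..<n}"
      then have i: "c \<le> l i" "l i \<le> u i" "u i \<le> d" using lu by auto
      have "norm (y (u i) - y (l i)) \<le> M * (norm (x (u i) - x (l i)) + (u i - l i))"
        using lip[of "u i" "l i"] i by auto
      also have "\<dots> \<le> M' * (norm (x (u i) - x (l i)) + (u i - l i))"
        using M' i by (intro mult_right_mono) auto
      finally show "norm (y (u i) - y (l i)) \<le> M' * (norm (x (u i) - x (l i)) + (u i - l i))" .
    qed
    also have "\<dots> = M' * ((\<Sum>i<n. norm (x (u i) - x (l i))) + (\<Sum>i<n. u i - l i))"
      by (simp add: sum_distrib_left sum.distrib[symmetric])
    also have "\<dots> < M' * (e' + e')"
      using w(2)[of n l u] lu M' by (intro mult_strict_left_mono add_strict_mono) auto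
    also have "\<dots> = e" using M' by (simp add: e'_def)
    finally show "(\<Sum>i<n. norm (y (u i) - y (l i))) < e" .
  qed (use w \<open>e' > 0\<close> in auto)
qed

text \<open>The definition of absolute continuity, which speaks of sequences of intervals, in the form in which it
is applied to the intervals of a tagged division: their total length is controlled by the measure
of an open set that contains them.\<close>

lemma abs_cont_on_increments_small:
  fixes y :: "real \<Rightarrow> 'a::real_normed_vector"
  assumes ac: "abs_cont_on_interval s t y" and "e > 0"
  shows "\<exists>w>0. \<forall>p q G. p tagged_division_of {s..t} \<and> q \<subseteq> p \<and> open G \<and>
       emeasure lebesgue G < ennreal w \<and> (\<forall>(x, K)\<in>q. K \<subseteq> G) \<longrightarrow>
       (\<Sum>(x, K)\<in>q. norm (y (Sup K) - y (Inf K))) < e \<and> (\<Sum>(x, K)\<in>q. Sup K - Inf K) < e"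
proof -
  obtain w where w: "w > 0" "\<And>(n::nat) l u.
        (\<forall>i<n. s \<le> l i \<and> l i \<le> u i \<and> u i \<le> t) \<and>
        disjoint_family_on (\<lambda>i. {l i<..<u i}) {..<n} \<and> (\<Sum>i<n. u i - l i) < w \<Longrightarrow>
        (\<Sum>i<n. norm (y (u i) - y (l i))) < e"
    using assms unfolding abs_cont_on_interval_def by blast
  show ?thesis
  proof (intro exI[of _ "min w e"] conjI allI impI)
    show "min w e > 0" using w(1) \<open>e > 0\<close> by simp
  next
    fix p q G
    assume "p tagged_division_of {s..t} \<and> q \<subseteq> p \<and> open G \<and>
       emeasure lebesgue G < ennreal (min w e) \<and> (\<forall>(x, K)\<in>q. K \<subseteq> G)"
    then have p: "p tagged_division_of {s..t}" and q: "finite q" "q \<subseteq> p" and G: "open G"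
      "emeasure lebesgue G < ennreal (min w e)" "\<And>x K. (x, K) \<in> q \<Longrightarrow> K \<subseteq> G"
      by (auto intro: finite_subset)
    have "(\<Sum>(x, K)\<in>q. norm (y (Sup K) - y (Inf K))) < e \<and> (\<Sum>(x, K)\<in>q. Sup K - Inf K) < e"
    proof -
      obtain h where h: "bij_betw h {..<card q} q"
        using ex_bij_betw_nat_finite[OF q(1)] by (auto simp: atLeast0LessThan)
      define l where "l i = Inf (snd (h i))" for i
      define u where "u i = Sup (snd (h i))" for i
      have hq: "h i \<in> q" if "i < card q" for i using h that by (auto simp: bij_betw_def)
      have K: "l i \<le> u i \<and> snd (h i) = {l i..u i} \<and> s \<le> l i \<and> u i \<le> t" if "i < card q" for i
      proof -
        obtain x K where xK: "h i = (x, K)" by fastforce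
        then have "(x, K) \<in> p" using hq[OF that] q by auto
        then have "x \<in> K" "K \<subseteq> {s..t}" "\<exists>a b. K = cbox a b"
          using tagged_division_ofD[OF p] by blast+
        then show ?thesis by (auto simp: l_def u_def xK)
      qed
      have disj: "disjoint_family_on (\<lambda>i. {l i<..<u i}) {..<card q}"
        unfolding disjoint_family_on_def
      proof (intro ballI impI)
        fix i j assume ij: "i \<in> {..<card q}" "j \<in> {..<card q}" "i \<noteq> j"
        then have "h i \<noteq> h j" using h by (auto simp: bij_betw_def inj_on_def)
        obtain x K x' K' where xK: "h i = (x, K)" "h j = (x', K')" by fastforce
        then have "(x, K) \<in> p" "(x', K') \<in> p" "(x, K) \<noteq> (x', K')"
          using hq ij q \<open>h i \<noteq> h j\<close> by fastforce+
        then have "interior K \<inter> interior K' = {}" using tagged_division_ofD(5)[OF p] by blast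
        then show "{l i<..<u i} \<inter> {l j<..<u j} = {}" using K[of i] K[of j] ij xK by auto
      qed
      have "ennreal (\<Sum>i<card q. u i - l i) = (\<Sum>i<card q. emeasure lebesgue {l i<..<u i})"
        using K by (subst sum_ennreal[symmetric]) (auto intro!: sum.cong)
      also have "\<dots> = emeasure lebesgue (\<Union>i<card q. {l i<..<u i})"
        using disj by (intro sum_emeasure) auto
      also have "\<dots> \<le> emeasure lebesgue G"
      proof (rule emeasure_mono)
        show "(\<Union>i<card q. {l i<..<u i}) \<subseteq> G"
        proof (rule UN_least, rule subsetI)
          fix i \<tau> assume "i \<in> {..<card q}" "\<tau> \<in> {l i<..<u i}"
          then show "\<tau> \<in> G" using G(3)[of "fst (h i)" "snd (h i)"] hq[of i] K[of i]
              by (metis greaterThanLessThan_iff atLeastAtMost_iff lessThan_iff less_imp_le prod.collapse subsetD)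
        qed
      qed (use G in auto)
      also note G(2)
      finally have "ennreal (\<Sum>i<card q. u i - l i) < ennreal (min w e)" .
      moreover have "0 \<le> (\<Sum>i<card q. u i - l i)" using K by (intro sum_nonneg) auto
      ultimately have small: "(\<Sum>i<card q. u i - l i) < min w e"
        using ennreal_less_iff by blast
      have "(\<Sum>i<card q. norm (y (u i) - y (l i))) < e"
        using w(2)[of "card q" l u] K disj small by auto
      moreover have "(\<Sum>i<card q. g (h i)) = (\<Sum>z\<in>q. g z)" for g :: "real \<times> real set \<Rightarrow> real"
        by (rule sum.reindex_bij_betw[OF h])
      from this[of "\<lambda>z. norm (y (Sup (snd z)) - y (Inf (snd z)))"]
        this[of "\<lambda>z. Sup (snd z) - Inf (snd z)"]
      have "(\<Sum>i<card q. norm (y (u i) - y (l i))) = (\<Sum>(x, K)\<in>q. norm (y (Sup K) - y (Inf K)))"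
        "(\<Sum>i<card q. u i - l i) = (\<Sum>(x, K)\<in>q. Sup K - Inf K)"
        by (auto simp: l_def u_def case_prod_beta)
      ultimately show ?thesis
        using small by simp
    qed
    then show "(\<Sum>(x, K)\<in>q. norm (y (Sup K) - y (Inf K))) < e"
      "(\<Sum>(x, K)\<in>q. Sup K - Inf K) < e" by auto
  qed
qed

text \<open>Cover the null set of exceptional points by an open set \<open>G\<close> of small measure, and let a gauge confine
intervals tagged at an exceptional point to \<open>G\<close> and the other intervals to a neighbourhood in
which the difference quotient exceeds the derivative by little. In a tagged division that is fine for
this gauge, the former intervals contribute little by absolute continuity, the latter at
most \<open>B + e\<close> times their length.\<close>

lemma abs_cont_increment_le:
  fixes y :: "real \<Rightarrow> real"
  assumes "s \<le> t" and ac: "abs_cont_on_interval s t y"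
    and ae: "AE \<tau> in lebesgue. s < \<tau> \<and> \<tau> < t \<longrightarrow> (\<exists>D\<le>B. (y has_real_derivative D) (at \<tau>))"
  shows "y t - y s \<le> B * (t - s)"
proof (rule field_le_epsilon)
  fix e0 :: real assume "e0 > 0"
  define C where "C = (t - s) + 2 + \<bar>B\<bar>"
  have "C > 0" using \<open>s \<le> t\<close> by (simp add: C_def)
  define e where "e = min 1 (e0 / C)"
  have e: "e > 0" "e \<le> 1" "e * C \<le> e0" using \<open>e0 > 0\<close> \<open>C > 0\<close>
    by (auto simp: e_def min_def field_simps)
  obtain N where N: "N \<in> null_sets lebesgue"
    "\<And>\<tau>. \<tau> \<notin> N \<Longrightarrow> s < \<tau> \<and> \<tau> < t \<Longrightarrow> \<exists>D\<le>B. (y has_real_derivative D) (at \<tau>)"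
    using AE_E3[OF ae] by (metis DiffI UNIV_I lebesgue_on_UNIV_eq space_lebesgue_on)
  define N' where "N' = N \<union> {s, t}"
  have "{s, t} \<in> null_sets lebesgue" by (auto simp: negligible_iff_null_sets[symmetric])
  then have N': "N' \<in> null_sets lebesgue" using N(1) by (auto simp: N'_def)
  obtain w where w: "w > 0" "\<And>p q G. p tagged_division_of {s..t} \<and> q \<subseteq> p \<and> open G \<and>
       emeasure lebesgue G < ennreal w \<and> (\<forall>(x, K)\<in>q. K \<subseteq> G) \<Longrightarrow>
       (\<Sum>(x, K)\<in>q. norm (y (Sup K) - y (Inf K))) < e \<and> (\<Sum>(x, K)\<in>q. Sup K - Inf K) < e"
    using abs_cont_on_increments_small[OF ac e(1)] by blast
  obtain G where G: "open G" "N' \<subseteq> G" "emeasure lebesgue (G - N') < ennreal w"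
    using sets_lebesgue_outer_open[of N' w] N' w(1) by (metis null_setsD2)
  have "emeasure lebesgue G < ennreal w"
    using G N' emeasure_Diff_null_set[OF N', of G] by simp
  have "\<exists>r>0. \<exists>D\<le>B. \<forall>\<sigma>. \<bar>\<sigma> - \<tau>\<bar> < r \<longrightarrow> \<bar>y \<sigma> - y \<tau> - D * (\<sigma> - \<tau>)\<bar> \<le> e * \<bar>\<sigma> - \<tau>\<bar>"
    if "\<tau> \<in> {s..t} - N'" for \<tau>
  proof -
    have "\<tau> \<notin> N" "s < \<tau> \<and> \<tau> < t" using that by (auto simp: N'_def less_le)
    then obtain D where D: "D \<le> B" "(y has_real_derivative D) (at \<tau>)" using N(2) by blast
    then have "\<exists>r>0. \<forall>\<sigma>. \<bar>\<sigma> - \<tau>\<bar> < r \<longrightarrow> \<bar>y \<sigma> - y \<tau> - D * (\<sigma> - \<tau>)\<bar> \<le> e * \<bar>\<sigma> - \<tau>\<bar>"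
      using e(1) by (auto simp: has_field_derivative_def has_derivative_at_alt)
    then show ?thesis using D(1) by blast
  qed
  then obtain r where r: "\<And>\<tau>. \<tau> \<in> {s..t} - N' \<Longrightarrow> r \<tau> > 0 \<and> (\<exists>D\<le>B. \<forall>\<sigma>. \<bar>\<sigma> - \<tau>\<bar> < r \<tau> \<longrightarrow>
      \<bar>y \<sigma> - y \<tau> - D * (\<sigma> - \<tau>)\<bar> \<le> e * \<bar>\<sigma> - \<tau>\<bar>)"
    by metis
  define \<gamma> where "\<gamma> \<tau> = (if \<tau> \<in> N' then G else if \<tau> \<in> {s..t} then ball \<tau> (r \<tau>) else UNIV)" for \<tau>
  have "gauge \<gamma>" using G r by (auto simp: gauge_def \<gamma>_def)
  then obtain p where p: "p tagged_division_of {s..t}" "\<gamma> fine p"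
    using fine_division_exists_real by blast
  have K: "x \<in> K \<and> x \<in> {s..t} \<and> K = {Inf K..Sup K} \<and> K \<subseteq> \<gamma> x" if "(x, K) \<in> p" for x K
  proof -
    have "x \<in> K" "K \<subseteq> {s..t}" "\<exists>a b. K = cbox a b"
      using tagged_division_ofD(2-4)[OF p(1) that] by auto
    moreover have "K \<subseteq> \<gamma> x" using p(2) that by (auto simp: fine_def)
    ultimately show ?thesis by auto
  qed
  have fin: "finite p" using p(1) by blast
  define q where "q = {(x, K) \<in> p. x \<in> N'}"
  have "q \<subseteq> p" by (auto simp: q_def)
  then have q: "finite q" "q \<subseteq> p" using finite_subset fin by blast+
  have "K \<subseteq> G" if "(x, K) \<in> q" for x K
    using K[of x K] that by (simp add: q_def \<gamma>_def)
  then have inG: "\<forall>(x, K)\<in>q. K \<subseteq> G" by blast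
  have small: "(\<Sum>(x, K)\<in>q. norm (y (Sup K) - y (Inf K))) < e" "(\<Sum>(x, K)\<in>q. Sup K - Inf K) < e"
    using w(2)[of p q G] p(1) q(2) G(1) \<open>emeasure lebesgue G < ennreal w\<close> inG by blast+
  \<comment> \<open>The amount by which an increment exceeds its admissible value; nonpositive off \<open>q\<close>, the
    intervals with an exceptional tag.\<close>
  define excess where "excess = (\<lambda>(x :: real, K). y (Sup K) - y (Inf K) - (B + e) * (Sup K - Inf K))"
  have good: "excess z \<le> 0" if "z \<in> p - q" for z
  proof -
    obtain x K where z: "z = (x, K)" by fastforce
    then have xK: "(x, K) \<in> p" "x \<notin> N'" using that by (auto simp: q_def)
    define a where "a = Inf K"
    define b where "b = Sup K"
    have ab: "a \<le> x" "x \<le> b" "x \<in> {s..t}" using K[OF xK(1)] unfolding a_def b_def by (metis atLeastAtMost_iff)+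
    have "{a..b} \<subseteq> ball x (r x)"
      using K[OF xK(1)] xK(2) ab(3) unfolding a_def b_def by (auto simp: \<gamma>_def)
    moreover have "a \<in> {a..b}" "b \<in> {a..b}" using ab by auto
    ultimately have "a \<in> ball x (r x)" "b \<in> ball x (r x)" by blast+
    then have "\<bar>a - x\<bar> < r x" "\<bar>b - x\<bar> < r x" by (auto simp: dist_real_def)
    moreover obtain D where D: "D \<le> B" "\<And>\<sigma>. \<bar>\<sigma> - x\<bar> < r x \<Longrightarrow>
      \<bar>y \<sigma> - y x - D * (\<sigma> - x)\<bar> \<le> e * \<bar>\<sigma> - x\<bar>"
      using r[of x] xK(2) ab(3) by auto
    ultimately have "\<bar>y a - y x - D * (a - x)\<bar> \<le> e * (x - a)" "\<bar>y b - y x - D * (b - x)\<bar> \<le> e * (b - x)"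
      using ab D(2)[of a] D(2)[of b] by auto
    moreover have "D * (b - a) \<le> B * (b - a)" using D(1) ab by (intro mult_right_mono) auto
    ultimately show ?thesis
      by (simp add: z excess_def a_def[symmetric] b_def[symmetric] algebra_simps)
  qed
  have bad: "(\<Sum>z\<in>q. excess z) \<le> e + (\<bar>B\<bar> + 1) * e"
  proof -
    have "(\<Sum>z\<in>q. excess z) \<le> (\<Sum>(x, K)\<in>q. norm (y (Sup K) - y (Inf K)) + (\<bar>B\<bar> + 1) * (Sup K - Inf K))"
    proof (rule sum_mono)
      fix z assume "z \<in> q"
      then obtain x K where z: "z = (x, K)" "(x, K) \<in> p" using q by (cases z) auto
      have "Inf K \<le> Sup K" using K[OF z(2)] by (metis atLeastatMost_empty_iff2 empty_iff)
      then have "- ((B + e) * (Sup K - Inf K)) \<le> (\<bar>B\<bar> + 1) * (Sup K - Inf K)"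
        unfolding mult_minus_left[symmetric] using e by (intro mult_right_mono) auto
      then show "excess z \<le> (case z of (x, K) \<Rightarrow> norm (y (Sup K) - y (Inf K)) + (\<bar>B\<bar> + 1) * (Sup K - Inf K))"
        unfolding z excess_def prod.case real_norm_def
        using abs_ge_self[of "y (Sup K) - y (Inf K)"] by linarith
    qed
    also have "\<dots> = (\<Sum>(x, K)\<in>q. norm (y (Sup K) - y (Inf K))) + (\<bar>B\<bar> + 1) * (\<Sum>(x, K)\<in>q. Sup K - Inf K)"
      by (simp add: case_prod_beta sum.distrib sum_distrib_left)
    also have "\<dots> \<le> e + (\<bar>B\<bar> + 1) * e"
      using small by (intro add_mono mult_left_mono) auto
    finally show ?thesis .
  qed
  have "(\<Sum>z\<in>p. excess z) \<le> e + (\<bar>B\<bar> + 1) * e"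
    using sum.subset_diff[OF q(2) fin, of excess] sum_nonpos[of "p - q" excess] good bad by fastforce
  moreover have "(\<Sum>z\<in>p. excess z) = y t - y s - (B + e) * (t - s)"
    using additive_tagged_division_1[OF \<open>s \<le> t\<close> p(1), of y] additive_tagged_division_1[OF \<open>s \<le> t\<close> p(1), of "\<lambda>x. x"]
    by (simp add: excess_def case_prod_beta sum_subtractf sum_distrib_left[symmetric])
  ultimately have "y t - y s \<le> B * (t - s) + e * C"
    by (simp add: C_def algebra_simps)
  then show "y t - y s \<le> B * (t - s) + e0" using e(3) by linarith
qed

text \<open>Reduced to the real case by testing with the vector \<open>x t - x s\<close>.\<close>

lemma abs_cont_norm_increment_le:
  fixes x :: "real \<Rightarrow> 'a::real_inner"
  assumes "s \<le> t" and ac: "abs_cont_on_interval s t x" and "0 \<le> B"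
    and ae: "AE \<tau> in lebesgue. s < \<tau> \<and> \<tau> < t \<longrightarrow> (\<exists>D. norm D \<le> B \<and> (x has_vector_derivative D) (at \<tau>))"
  shows "norm (x t - x s) \<le> B * (t - s)"
proof -
  define v where "v = x t - x s"
  have "v \<bullet> x t - v \<bullet> x s \<le> (norm v * B) * (t - s)"
  proof (rule abs_cont_increment_le[OF \<open>s \<le> t\<close>])
    show "abs_cont_on_interval s t (\<lambda>\<tau>. v \<bullet> x \<tau>)"
    proof (rule abs_cont_lipschitz_compose[OF ac, where M = "norm v"])
      fix \<sigma> \<tau>
      have "norm (v \<bullet> x \<sigma> - v \<bullet> x \<tau>) \<le> norm v * norm (x \<sigma> - x \<tau>)"
        by (simp add: inner_diff_right[symmetric] Cauchy_Schwarz_ineq2)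
      also have "\<dots> \<le> norm v * (norm (x \<sigma> - x \<tau>) + \<bar>\<sigma> - \<tau>\<bar>)"
        by (intro mult_left_mono) auto
      finally show "norm (v \<bullet> x \<sigma> - v \<bullet> x \<tau>) \<le> norm v * (norm (x \<sigma> - x \<tau>) + \<bar>\<sigma> - \<tau>\<bar>)" .
    qed
    show "AE \<tau> in lebesgue. s < \<tau> \<and> \<tau> < t \<longrightarrow>
        (\<exists>D\<le>norm v * B. ((\<lambda>\<tau>. v \<bullet> x \<tau>) has_real_derivative D) (at \<tau>))"
      using ae
    proof (rule eventually_mono, safe)
      fix \<tau> D assume D: "norm D \<le> B" "(x has_vector_derivative D) (at \<tau>)"
      have "((\<lambda>\<tau>. v \<bullet> x \<tau>) has_vector_derivative v \<bullet> D) (at \<tau>)"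
        by (rule bounded_linear.has_vector_derivative[OF bounded_linear_inner_right D(2)])
      moreover have "v \<bullet> D \<le> norm v * B"
        using norm_cauchy_schwarz[of v D] D(1) by (meson mult_left_mono norm_ge_zero order_trans)
      ultimately show "\<exists>D\<le>norm v * B. ((\<lambda>\<tau>. v \<bullet> x \<tau>) has_real_derivative D) (at \<tau>)"
        by (auto simp: has_real_derivative_iff_has_vector_derivative)
    qed
  qed
  then have "norm v * norm v \<le> norm v * (B * (t - s))"
    by (simp add: v_def inner_diff_right[symmetric] power2_norm_eq_inner[symmetric] power2_eq_square mult.assoc)
  then show ?thesis
    using \<open>0 \<le> B\<close> \<open>s \<le> t\<close> by (cases "v = 0") (auto simp: v_def[symmetric])
qed

text \<open>Near \<open>t\<close> the function \<open>\<tau> \<mapsto> x \<tau> - \<tau> g(t)\<close> has a small derivative almost everywhere, hence small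
increments.\<close>

lemma abs_cont_imp_has_vector_derivative:
  fixes x :: "real \<Rightarrow> 'a::real_inner"
  assumes ac: "abs_cont_on_interval c d x" and cont: "continuous_on {c..d} g"
    and ae: "AE \<tau> in lebesgue. c < \<tau> \<and> \<tau> < d \<longrightarrow> (x has_vector_derivative g \<tau>) (at \<tau>)"
    and t: "t \<in> {c..d}"
  shows "(x has_vector_derivative g t) (at t within {c..d})"
  unfolding has_vector_derivative_def has_derivative_within_alt
proof (intro conjI allI impI)
  show "bounded_linear (\<lambda>h. h *\<^sub>R g t)" by (rule bounded_linear_scaleR_left)
  fix e :: real assume "e > 0"
  then obtain r where r: "r > 0" "\<And>\<sigma>. \<sigma> \<in> {c..d} \<Longrightarrow> dist \<sigma> t < r \<Longrightarrow> dist (g \<sigma>) (g t) < e"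
    using cont t unfolding continuous_on_iff by metis
  have incr: "norm (x v - x u - (v - u) *\<^sub>R g t) \<le> e * (v - u)"
    if uv: "u \<le> v" "c \<le> u" "v \<le> d" "\<bar>u - t\<bar> < r" "\<bar>v - t\<bar> < r" for u v
  proof -
    have "norm ((x v - v *\<^sub>R g t) - (x u - u *\<^sub>R g t)) \<le> e * (v - u)"
    proof (rule abs_cont_norm_increment_le[OF uv(1)])
      show "abs_cont_on_interval u v (\<lambda>\<tau>. x \<tau> - \<tau> *\<^sub>R g t)"
      proof (rule abs_cont_lipschitz_compose[where M = "1 + norm (g t)"])
        show "abs_cont_on_interval u v x" using abs_cont_on_subinterval[OF ac uv(2,3)] .
        fix \<sigma> \<tau>
        have "norm (x \<sigma> - \<sigma> *\<^sub>R g t - (x \<tau> - \<tau> *\<^sub>R g t)) = norm ((x \<sigma> - x \<tau>) - (\<sigma> - \<tau>) *\<^sub>R g t)"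
          by (simp add: algebra_simps)
        also have "\<dots> \<le> norm (x \<sigma> - x \<tau>) + \<bar>\<sigma> - \<tau>\<bar> * norm (g t)"
          by (metis norm_scaleR norm_triangle_ineq4)
        also have "\<dots> \<le> (1 + norm (g t)) * (norm (x \<sigma> - x \<tau>) + \<bar>\<sigma> - \<tau>\<bar>)"
          by (simp add: algebra_simps)
        finally show "norm (x \<sigma> - \<sigma> *\<^sub>R g t - (x \<tau> - \<tau> *\<^sub>R g t))
            \<le> (1 + norm (g t)) * (norm (x \<sigma> - x \<tau>) + \<bar>\<sigma> - \<tau>\<bar>)" .
      qed
      show "AE \<tau> in lebesgue. u < \<tau> \<and> \<tau> < v \<longrightarrow>
          (\<exists>D. norm D \<le> e \<and> ((\<lambda>\<tau>. x \<tau> - \<tau> *\<^sub>R g t) has_vector_derivative D) (at \<tau>))"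
        using ae
      proof (rule eventually_mono, intro impI)
        fix \<tau> assume *: "c < \<tau> \<and> \<tau> < d \<longrightarrow> (x has_vector_derivative g \<tau>) (at \<tau>)" "u < \<tau> \<and> \<tau> < v"
        then have "((\<lambda>\<tau>. x \<tau> - \<tau> *\<^sub>R g t) has_vector_derivative g \<tau> - 1 *\<^sub>R g t) (at \<tau>)"
          using uv by (auto intro!: derivative_eq_intros simp: has_vector_derivative_scaleR)
        moreover have "norm (g \<tau> - 1 *\<^sub>R g t) \<le> e"
        proof -
          have "dist \<tau> t < r" using *(2) uv by (auto simp: dist_real_def)
          then show ?thesis using r(2)[of \<tau>] * uv by (auto simp: dist_norm)
        qed
        ultimately show "\<exists>D. norm D \<le> e \<and> ((\<lambda>\<tau>. x \<tau> - \<tau> *\<^sub>R g t) has_vector_derivative D) (at \<tau>)"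
          by blast
      qed
    qed (use \<open>e > 0\<close> in auto)
    then show ?thesis by (simp add: algebra_simps)
  qed
  show "\<exists>r>0. \<forall>\<tau>\<in>{c..d}. norm (\<tau> - t) < r \<longrightarrow> norm (x \<tau> - x t - (\<tau> - t) *\<^sub>R g t) \<le> e * norm (\<tau> - t)"
  proof (intro exI[of _ r] conjI ballI impI r(1))
    fix \<tau> assume \<tau>: "\<tau> \<in> {c..d}" "norm (\<tau> - t) < r"
    show "norm (x \<tau> - x t - (\<tau> - t) *\<^sub>R g t) \<le> e * norm (\<tau> - t)"
    proof (cases "t \<le> \<tau>")
      case True
      then show ?thesis using incr[of t \<tau>] \<tau> t r(1) by auto
    next
      case False
      have "norm (x \<tau> - x t - (\<tau> - t) *\<^sub>R g t) = norm (x t - x \<tau> - (t - \<tau>) *\<^sub>R g t)"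
        by (metis (no_types, lifting) minus_diff_eq norm_minus_cancel scaleR_left.minus minus_diff_minus)
      then show ?thesis using incr[of \<tau> t] False \<tau> t r(1) by auto
    qed
  qed
qed

lemma has_real_derivative_abs:
  fixes y :: "real \<Rightarrow> real"
  assumes y: "(y has_real_derivative D) (at t)" and "y t \<noteq> 0"
  shows "((\<lambda>\<tau>. \<bar>y \<tau>\<bar>) has_real_derivative D * sgn (y t)) (at t)"
proof -
  have "isCont y t" using y by (rule DERIV_isCont)
  have "\<forall>\<^sub>F \<tau> in nhds t. \<bar>y \<tau>\<bar> = sgn (y t) * y \<tau>"
  proof (cases "y t > 0")
    case True
    then have "\<forall>\<^sub>F \<tau> in nhds t. 0 < y \<tau>"
      using \<open>isCont y t\<close> by (intro order_tendstoD(1)[of y "y t"]) (auto simp: isCont_def tendsto_at_iff_tendsto_nhds)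
    then show ?thesis by (rule eventually_mono) (use True in auto)
  next
    case False
    then have "\<forall>\<^sub>F \<tau> in nhds t. y \<tau> < 0"
      using \<open>isCont y t\<close> assms(2) by (intro order_tendstoD(2)[of y "y t"]) (auto simp: isCont_def tendsto_at_iff_tendsto_nhds)
    then show ?thesis by (rule eventually_mono) (use False assms(2) in auto)
  qed
  moreover have "((\<lambda>\<tau>. sgn (y t) * y \<tau>) has_real_derivative D * sgn (y t)) (at t)"
    using y by (auto intro!: derivative_eq_intros)
  ultimately show ?thesis by (subst DERIV_cong_ev[OF refl _ refl])
qed

text \<open>After the last time at which \<open>\<bar>y\<bar> \<le> \<mu>\<close> the function \<open>\<bar>y\<bar>\<close> does not grow, so it is still at most \<open>\<mu>\<close>; if
there is no such time, \<open>\<bar>y\<bar>\<close> has decreased at rate \<open>c\<close> throughout.\<close>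

lemma abs_decrease_to_level:
  fixes y :: "real \<Rightarrow> real"
  assumes "s \<le> t" and ac: "abs_cont_on_interval s t y" and "0 \<le> \<mu>" "0 \<le> c"
    and ae: "AE \<tau> in lebesgue. s < \<tau> \<and> \<tau> < t \<and> \<mu> < \<bar>y \<tau>\<bar> \<longrightarrow>
      (\<exists>D. (y has_real_derivative D) (at \<tau>) \<and> D * sgn (y \<tau>) \<le> - c)"
  shows "\<bar>y t\<bar> \<le> max \<mu> (\<bar>y s\<bar> - c * (t - s))"
proof -
  have cont: "continuous_on {s..t} y" by (rule abs_cont_continuous_on[OF ac])
  have decr: "\<bar>y t\<bar> - \<bar>y u\<bar> \<le> - c * (t - u)"
    if u: "s \<le> u" "u \<le> t" "\<And>\<tau>. u < \<tau> \<Longrightarrow> \<tau> < t \<Longrightarrow> \<mu> < \<bar>y \<tau>\<bar>" for u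
  proof (rule abs_cont_increment_le[OF u(2)])
    show "abs_cont_on_interval u t (\<lambda>\<tau>. \<bar>y \<tau>\<bar>)"
      by (rule abs_cont_lipschitz_compose[OF abs_cont_on_subinterval[OF ac u(1) order_refl], where M = 1]) auto
    show "AE \<tau> in lebesgue. u < \<tau> \<and> \<tau> < t \<longrightarrow> (\<exists>D\<le>-c. ((\<lambda>\<tau>. \<bar>y \<tau>\<bar>) has_real_derivative D) (at \<tau>))"
      using ae
    proof (rule eventually_mono, intro impI)
      fix \<tau> assume *: "s < \<tau> \<and> \<tau> < t \<and> \<mu> < \<bar>y \<tau>\<bar> \<longrightarrow>
          (\<exists>D. (y has_real_derivative D) (at \<tau>) \<and> D * sgn (y \<tau>) \<le> - c)" "u < \<tau> \<and> \<tau> < t"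
      then obtain D where D: "(y has_real_derivative D) (at \<tau>)" "D * sgn (y \<tau>) \<le> - c"
        using u by auto
      have "y \<tau> \<noteq> 0" using u(3)[of \<tau>] *(2) \<open>0 \<le> \<mu>\<close> by auto
      then have "((\<lambda>\<tau>. \<bar>y \<tau>\<bar>) has_real_derivative D * sgn (y \<tau>)) (at \<tau>)"
        using has_real_derivative_abs[OF D(1)] by simp
      then show "\<exists>D\<le>-c. ((\<lambda>\<tau>. \<bar>y \<tau>\<bar>) has_real_derivative D) (at \<tau>)" using D(2) by blast
    qed
  qed
  show ?thesis
  proof (cases "\<forall>\<tau>\<in>{s..t}. \<mu> < \<bar>y \<tau>\<bar>")
    case True
    then show ?thesis using decr[of s] \<open>s \<le> t\<close> by auto
  next
    case False
    define N where "N = {\<tau> \<in> {s..t}. \<bar>y \<tau>\<bar> \<le> \<mu>}"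
    have "closed N"
      unfolding N_def by (intro continuous_on_closed_Collect_le continuous_intros cont)
    moreover have "N \<noteq> {}" "bdd_above N" using False by (auto simp: N_def intro!: bdd_aboveI[of _ t])
    ultimately have "Sup N \<in> N" by (intro closed_contains_Sup)
    moreover have "\<mu> < \<bar>y \<tau>\<bar>" if "Sup N < \<tau>" "\<tau> < t" for \<tau>
      proof -
      have "\<tau> \<notin> N" using that(1) cSup_upper[OF _ \<open>bdd_above N\<close>, of \<tau>] by auto
      moreover have "s \<le> Sup N" using \<open>Sup N \<in> N\<close> by (simp add: N_def)
      ultimately show ?thesis using that by (simp add: N_def not_le)
    qed
    ultimately have "\<bar>y t\<bar> - \<bar>y (Sup N)\<bar> \<le> - c * (t - Sup N)" "\<bar>y (Sup N)\<bar> \<le> \<mu>" "Sup N \<le> t"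
      using decr[of "Sup N"] by (auto simp: N_def)
    moreover have "0 \<le> c * (t - Sup N)" using \<open>0 \<le> c\<close> \<open>Sup N \<le> t\<close> by simp
    ultimately show ?thesis by auto
  qed
qed

section \<open>Differential inequalities\<close>

text \<open>The constant \<open>K\<close> may have either sign: it is nonnegative in the Gronwall estimate for the distance of two
solutions and nonpositive for the decay of a filter.\<close>

lemma exp_growth_bound:
  fixes u :: "real \<Rightarrow> real"
  assumes "s \<le> t" and der: "\<And>\<tau>. \<tau> \<in> {s..t} \<Longrightarrow> (u has_real_derivative u' \<tau>) (at \<tau> within {s..t})"
    and le: "\<And>\<tau>. \<tau> \<in> {s..t} \<Longrightarrow> u' \<tau> \<le> K * u \<tau>"
  shows "u t \<le> u s * exp (K * (t - s))"
proof (cases "s = t")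
  case False
  define h where "h \<tau> = exp (- K * (\<tau> - s)) * u \<tau>" for \<tau>
  have "\<exists>\<tau>\<in>{s<..<t}. h t - h s = (exp (- K * (\<tau> - s)) * (u' \<tau> - K * u \<tau>)) * (t - s)"
  proof (rule mvt_simple)
    fix \<tau> assume "s \<le> \<tau>" "\<tau> \<le> t"
    then have "(h has_real_derivative exp (- K * (\<tau> - s)) * (u' \<tau> - K * u \<tau>)) (at \<tau> within {s..t})"
      unfolding h_def using der[of \<tau>] by (auto intro!: derivative_eq_intros simp: algebra_simps)
    then show "(h has_derivative (\<lambda>x. exp (- K * (\<tau> - s)) * (u' \<tau> - K * u \<tau>) * x)) (at \<tau> within {s..t})"
      by (simp add: has_field_derivative_def)
  qed (use False \<open>s \<le> t\<close> in auto)
  then obtain \<tau> where \<tau>: "\<tau> \<in> {s<..<t}" "h t - h s = (exp (- K * (\<tau> - s)) * (u' \<tau> - K * u \<tau>)) * (t - s)"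
    by blast
  have "(exp (- K * (\<tau> - s)) * (u' \<tau> - K * u \<tau>)) * (t - s) \<le> 0"
    using le[of \<tau>] \<tau>(1) by (intro mult_nonpos_nonneg mult_nonneg_nonpos) auto
  with \<tau>(2) have "exp (- K * (t - s)) * u t \<le> u s" by (simp add: h_def)
  then have "exp (K * (t - s)) * (exp (- K * (t - s)) * u t) \<le> exp (K * (t - s)) * u s"
    by (intro mult_left_mono) auto
  moreover have "exp (K * (t - s)) * exp (- K * (t - s)) = 1"
    by (simp only: exp_add[symmetric]) simp
  ultimately show ?thesis by (metis mult.assoc mult.commute mult_1)
qed simp

lemma filter_bound:
  fixes y v :: "real \<Rightarrow> real"
  assumes "s \<le> t" "g \<ge> 0"
    and der: "\<And>\<tau>. \<tau> \<in> {s..t} \<Longrightarrow> (y has_real_derivative g * (v \<tau> - y \<tau>)) (at \<tau> within {s..t})"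
    and v: "\<And>\<tau>. \<tau> \<in> {s..t} \<Longrightarrow> \<bar>v \<tau>\<bar> \<le> B"
  shows "\<bar>y t\<bar> \<le> B + (\<bar>y s\<bar> - B) * exp (- g * (t - s))"
proof -
  have "c * y t - B \<le> (c * y s - B) * exp (- g * (t - s))" if "c = 1 \<or> c = -1" for c
  proof (rule exp_growth_bound[where u = "\<lambda>\<tau>. c * y \<tau> - B" and u' = "\<lambda>\<tau>. c * (g * (v \<tau> - y \<tau>))"])
    fix \<tau> assume \<tau>: "\<tau> \<in> {s..t}"
    show "((\<lambda>\<tau>. c * y \<tau> - B) has_real_derivative c * (g * (v \<tau> - y \<tau>))) (at \<tau> within {s..t})"
      using der[OF \<tau>] by (auto intro!: derivative_eq_intros)
    have "g * (c * v \<tau>) \<le> g * B"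
      using v[OF \<tau>] that \<open>g \<ge> 0\<close> by (intro mult_left_mono) auto
    then show "c * (g * (v \<tau> - y \<tau>)) \<le> - g * (c * y \<tau> - B)" by (simp add: algebra_simps)
  qed (use \<open>s \<le> t\<close> in auto)
  from this[of 1] this[of "-1"]
  have "y t - B \<le> (y s - B) * exp (- g * (t - s))" "- y t - B \<le> (- y s - B) * exp (- g * (t - s))" by auto
  moreover have "(y s - B) * exp (- g * (t - s)) \<le> (\<bar>y s\<bar> - B) * exp (- g * (t - s))"
    "(- y s - B) * exp (- g * (t - s)) \<le> (\<bar>y s\<bar> - B) * exp (- g * (t - s))"
    by (intro mult_right_mono; simp)+
  ultimately show ?thesis by linarith
qed

section \<open>Local Lipschitz continuity of smooth functions\<close>

lemma orthonormal_basis_representation: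
  fixes E :: "'z::real_inner set" and z :: 'z
  assumes "orthonormal_basis E"
  shows "(\<Sum>e\<in>E. (z \<bullet> e) *\<^sub>R e) = z"
proof -
  have E: "finite E" "pairwise orthogonal E" "\<And>e. e \<in> E \<Longrightarrow> norm e = 1" "span E = UNIV"
    using assms by (auto simp: orthonormal_basis_def)
  define d where "d = z - (\<Sum>e\<in>E. (z \<bullet> e) *\<^sub>R e)"
  have "d \<bullet> e = 0" if "e \<in> E" for e
  proof -
    have "(\<Sum>e'\<in>E. (z \<bullet> e') *\<^sub>R e') \<bullet> e = (\<Sum>e'\<in>E. if e' = e then z \<bullet> e else 0)"
      unfolding inner_sum_left
    proof (rule sum.cong[OF refl])
      fix e' assume "e' \<in> E"
      then show "((z \<bullet> e') *\<^sub>R e') \<bullet> e = (if e' = e then z \<bullet> e else 0)"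
        using E(2) E(3)[OF that] that
        by (auto simp: pairwise_def orthogonal_def power2_norm_eq_inner[symmetric])
    qed
    then show ?thesis using E(1) that by (simp add: d_def inner_diff_left)
  qed
  then have "orthogonal d d"
    unfolding orthogonal_def[symmetric]
    by (rule orthogonal_to_span[where S = E, rotated]) (simp_all add: E(4))
  then have "d = 0" by (simp add: orthogonal_self)
  then show ?thesis by (simp add: d_def)
qed

lemma norm_le_sum_coordinates:
  fixes E :: "'z::real_inner set" and z :: 'z
  assumes "orthonormal_basis E"
  shows "norm z \<le> (\<Sum>e\<in>E. \<bar>z \<bullet> e\<bar>)"
proof -
  have "norm z \<le> (\<Sum>e\<in>E. norm ((z \<bullet> e) *\<^sub>R e))"
    using norm_sum[of "\<lambda>e. (z \<bullet> e) *\<^sub>R e" E] by (simp only: orthonormal_basis_representation[OF assms])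
  also have "\<dots> = (\<Sum>e\<in>E. \<bar>z \<bullet> e\<bar>)"
    using assms by (intro sum.cong) (auto simp: orthonormal_basis_def)
  finally show ?thesis .
qed

lemma smooth_continuous_on: "smooth g \<Longrightarrow> continuous_on S g"
  unfolding smooth_def by (metis times_differentiable.simps(1) continuous_on_subset subset_UNIV)

text \<open>The directional derivatives along a basis are continuous, hence bounded on a ball, and together they bound
the operator norm of the derivative.\<close>

lemma smooth_lipschitz_on_ball:
  fixes E :: "'z::{real_inner, heine_borel} set" and f :: "'z \<times> real \<Rightarrow> 'b::real_normed_vector"
  assumes E: "orthonormal_basis E" and f: "smooth f"
  obtains L where "L \<ge> 0" "\<And>x y. norm x \<le> B \<Longrightarrow> norm y \<le> B \<Longrightarrow> norm (f x - f y) \<le> L * norm (x - y)"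
proof -
  have diff: "f differentiable (at x)" and cont: "continuous_on UNIV (\<lambda>x. frechet_derivative f (at x) v)" for x v
    using f unfolding smooth_def by (metis times_differentiable.simps)+
  define D where "D x = frechet_derivative f (at x)" for x
  have D: "(f has_derivative D x) (at x)" for x
    using diff[of x] frechet_derivative_works by (auto simp: D_def)
  have "\<exists>C. \<forall>x\<in>cball 0 B. norm (D x v) \<le> C" for v
  proof -
    have "compact ((\<lambda>x. D x v) ` cball 0 B)"
      unfolding D_def by (intro compact_continuous_image compact_cball continuous_on_subset[OF cont]) auto
    then show ?thesis using compact_imp_bounded bounded_iff by (metis imageI)
  qed
  then obtain C where C: "\<And>x v. x \<in> cball 0 B \<Longrightarrow> norm (D x v) \<le> C v" by metis
  define L where "L = (\<Sum>e\<in>E. \<bar>C (e, 0)\<bar>) + \<bar>C (0, 1)\<bar>"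
  have "L \<ge> 0" by (simp add: L_def sum_nonneg)
  moreover have "norm (f x - f y) \<le> L * norm (x - y)" if "norm x \<le> B" "norm y \<le> B" for x y
  proof (rule differentiable_bound[where S = "cball 0 B"])
    fix x :: "'z \<times> real" assume x: "x \<in> cball 0 B"
    show "(f has_derivative D x) (at x within cball 0 B)"
      using D has_derivative_at_withinI by blast
    show "onorm (D x) \<le> L"
    proof (rule onorm_bound[OF \<open>L \<ge> 0\<close>])
      fix v :: "'z \<times> real"
      interpret bounded_linear "D x" by (rule has_derivative_bounded_linear[OF D])
      have "v = (\<Sum>e\<in>E. (fst v \<bullet> e) *\<^sub>R (e, 0)) + snd v *\<^sub>R (0, 1)"
        by (simp add: prod_eq_iff fst_sum snd_sum orthonormal_basis_representation[OF E])
      then have "D x v = D x ((\<Sum>e\<in>E. (fst v \<bullet> e) *\<^sub>R (e, 0)) + snd v *\<^sub>R (0, 1))"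
        by (rule arg_cong)
      also have "\<dots> = (\<Sum>e\<in>E. (fst v \<bullet> e) *\<^sub>R D x (e, 0)) + snd v *\<^sub>R D x (0, 1)"
        by (simp only: add sum scaleR)
      also have "norm \<dots> \<le> (\<Sum>e\<in>E. norm ((fst v \<bullet> e) *\<^sub>R D x (e, 0))) + norm (snd v *\<^sub>R D x (0, 1))"
        by (intro order_trans[OF norm_triangle_ineq] add_mono norm_sum order_refl)
      also have "\<dots> \<le> (\<Sum>e\<in>E. \<bar>C (e, 0)\<bar> * norm v) + \<bar>C (0, 1)\<bar> * norm v"
      proof (intro add_mono sum_mono)
        fix e assume "e \<in> E"
        then have "\<bar>fst v \<bullet> e\<bar> \<le> norm (fst v)"
          using Cauchy_Schwarz_ineq2[of "fst v" e] E by (simp add: orthonormal_basis_def)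
        then have "\<bar>fst v \<bullet> e\<bar> \<le> norm v" using norm_fst_le[of "fst v" "snd v"] by simp
        moreover have "norm (D x (e, 0)) \<le> \<bar>C (e, 0)\<bar>" using C[OF x, of "(e, 0)"] by linarith
        ultimately show "norm ((fst v \<bullet> e) *\<^sub>R D x (e, 0)) \<le> \<bar>C (e, 0)\<bar> * norm v"
          by (simp add: mult.commute mult_mono)
      next
        have "\<bar>snd v\<bar> \<le> norm v" using norm_snd_le[of "snd v" "fst v"] by simp
        moreover have "norm (D x (0, 1)) \<le> \<bar>C (0, 1)\<bar>" using C[OF x, of "(0, 1)"] by linarith
        ultimately show "norm (snd v *\<^sub>R D x (0, 1)) \<le> \<bar>C (0, 1)\<bar> * norm v"
          by (simp add: mult.commute mult_mono)
      qed
      also have "\<dots> = L * norm v" by (simp add: L_def distrib_right sum_distrib_right)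
      finally show "norm (D x v) \<le> L * norm v" .
    qed
  qed (use that in auto)
  ultimately show thesis by (rule that)
qed

section \<open>Practical stability of the zero dynamics under small inputs\<close>

definition driven_solution ::
    "('z::real_normed_vector \<times> real \<Rightarrow> 'z) \<Rightarrow> (real \<Rightarrow> real) \<Rightarrow> (real \<Rightarrow> 'z) \<Rightarrow> real \<Rightarrow> real \<Rightarrow> bool" where
  "driven_solution f w z s d \<longleftrightarrow>
     (\<forall>t\<in>{s..d}. (z has_vector_derivative f (z t, w t)) (at t within {s..d}))"

lemma driven_solution_subinterval:
  assumes "driven_solution f w z s d" "s \<le> s'" "d' \<le> d"
  shows "driven_solution f w z s' d'"
  unfolding driven_solution_def
proof
  fix t assume "t \<in> {s'..d'}"
  then have "(z has_vector_derivative f (z t, w t)) (at t within {s..d})"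
    using assms by (auto simp: driven_solution_def)
  then show "(z has_vector_derivative f (z t, w t)) (at t within {s'..d'})"
    by (rule has_vector_derivative_within_subset) (use assms in auto)
qed

lemma forward_solution_shift:
  assumes "forward_solution h zbar" "t \<in> {s..d}"
  shows "((\<lambda>\<tau>. zbar (\<tau> - s)) has_vector_derivative h (zbar (t - s))) (at t within {s..d})"
proof -
  have "((\<lambda>\<tau>. \<tau> - s) has_vector_derivative 1) (at t within {s..d})"
    by (auto intro!: derivative_eq_intros)
  moreover have "(zbar has_vector_derivative h (zbar (t - s))) (at (t - s) within (\<lambda>\<tau>. \<tau> - s) ` {s..d})"
    by (rule has_vector_derivative_within_subset[where S = "{0..}"])
      (use assms in \<open>auto simp: forward_solution_def\<close>)
  ultimately show ?thesis
    using vector_diff_chain_within[of "\<lambda>\<tau>. \<tau> - s" 1 t "{s..d}" zbar] by (simp add: o_def)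
qed

lemma forward_solution_continuous_on:
  assumes "forward_solution h zbar"
  shows "continuous_on {0..} zbar"
  unfolding continuous_on_eq_continuous_within
proof
  fix t :: real assume "t \<in> {0..}"
  then have "(zbar has_vector_derivative h (zbar t)) (at t within {0..})"
    using assms by (simp add: forward_solution_def)
  then show "continuous (at t within {0..}) zbar" by (rule has_vector_derivative_continuous)
qed

lemma convergent_forward_solution_bounded:
  assumes zbar: "forward_solution h zbar" and lim: "(zbar \<longlongrightarrow> p) at_top"
  obtains C where "\<And>t. 0 \<le> t \<Longrightarrow> norm (zbar t) \<le> C"
proof -
  have "\<forall>\<^sub>F t in at_top. dist (zbar t) p < 1" by (rule tendstoD[OF lim]) simp
  then obtain T where T: "\<And>t. T \<le> t \<Longrightarrow> dist (zbar t) p < 1"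
    by (auto simp: eventually_at_top_linorder)
  have "compact (zbar ` {0..T})"
    by (intro compact_continuous_image continuous_on_subset[OF forward_solution_continuous_on[OF zbar]]) auto
  then obtain C where C: "\<And>t. t \<in> {0..T} \<Longrightarrow> norm (zbar t) \<le> C"
    using compact_imp_bounded bounded_iff by (metis imageI)
  show thesis
  proof (rule that)
    fix t :: real assume "0 \<le> t"
    show "norm (zbar t) \<le> max C (norm p + 1)"
    proof (cases "t \<le> T")
      case True
      then show ?thesis using C[of t] \<open>0 \<le> t\<close> by auto
    next
      case False
      then have "norm (zbar t - p) < 1" using T[of t] by (simp add: dist_norm)
      then show ?thesis using norm_triangle_sub[of "zbar t" p] by linarith
    qed
  qed
qed

text \<open>The distance \<open>\<delta>\<close> to the reference solution satisfies \<open>(\<delta>\<^sup>2)' \<le> 3 L (\<delta>\<^sup>2 + \<rho>\<^sup>2)\<close> as long as \<open>\<delta> \<le> tol\<close>,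
where \<open>L\<close> is a Lipschitz constant of \<open>f\<close> on a ball containing all points concerned. For a small \<open>\<rho>\<close> this
keeps \<open>\<delta>\<close> strictly below \<open>tol\<close> up to time \<open>T\<close>.\<close>

lemma tracking:
  fixes E :: "'z::{real_inner, heine_borel} set" and f :: "'z \<times> real \<Rightarrow> 'z"
  assumes E: "orthonormal_basis E" and f: "smooth f"
    and zbar: "forward_solution (\<lambda>z. f (z, 0)) zbar" and "0 \<le> T" "0 < tol"
  obtains \<rho> where "\<rho> > 0" "\<And>z w s d t. driven_solution f w z s d \<Longrightarrow> d \<le> s + T \<Longrightarrow>
     (\<And>\<tau>. \<tau> \<in> {s..d} \<Longrightarrow> \<bar>w \<tau>\<bar> \<le> \<rho>) \<Longrightarrow> norm (z s - zbar 0) < \<rho> \<Longrightarrow> t \<in> {s..d} \<Longrightarrow>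
     norm (z t - zbar (t - s)) < tol"
proof -
  have "compact (zbar ` {0..T})"
    by (intro compact_continuous_image continuous_on_subset[OF forward_solution_continuous_on[OF zbar]]) auto
  then obtain C where C: "\<And>t. t \<in> {0..T} \<Longrightarrow> norm (zbar t) \<le> C"
    using compact_imp_bounded bounded_iff by (metis imageI)
  obtain L where L: "L \<ge> 0"
    "\<And>x y. norm x \<le> C + tol + 1 \<Longrightarrow> norm y \<le> C + tol + 1 \<Longrightarrow> norm (f x - f y) \<le> L * norm (x - y)"
    using smooth_lipschitz_on_ball[OF E f] by blast
  define \<rho> where "\<rho> = min 1 (tol * exp (- (3 * L * T) / 2) / 2)"
  have \<rho>: "0 < \<rho>" "\<rho> \<le> 1" using \<open>0 < tol\<close> by (auto simp: \<rho>_def)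
  have "\<rho> \<le> tol * 1 / 2"
    unfolding \<rho>_def using \<open>0 < tol\<close> \<open>0 \<le> T\<close> L(1)
    by (intro min.coboundedI2 divide_right_mono mult_left_mono) auto
  then have "\<rho> < tol" using \<open>0 < tol\<close> by simp
  have small: "2 * \<rho>\<^sup>2 * exp (3 * L * T) < tol\<^sup>2"
  proof -
    have "\<rho>\<^sup>2 \<le> (tol * exp (- (3 * L * T) / 2) / 2)\<^sup>2"
      using \<rho> by (intro power_mono) (auto simp: \<rho>_def)
    also have "\<dots> = tol\<^sup>2 * exp (- (3 * L * T)) / 4"
      by (simp add: power_mult_distrib power_divide exp_double[symmetric])
    finally have "\<rho>\<^sup>2 * exp (3 * L * T) \<le> tol\<^sup>2 * exp (- (3 * L * T)) / 4 * exp (3 * L * T)"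
      by (intro mult_right_mono) auto
    also have "\<dots> = tol\<^sup>2 / 4" by (simp add: exp_minus)
    finally have "2 * \<rho>\<^sup>2 * exp (3 * L * T) \<le> tol\<^sup>2 / 2" by linarith
    moreover have "tol\<^sup>2 > 0" using \<open>0 < tol\<close> by simp
    ultimately show ?thesis by linarith
  qed
  show thesis
  proof (rule that[OF \<rho>(1)])
    fix z w s d t
    assume z: "driven_solution f w z s d" and d: "d \<le> s + T" and w: "\<And>\<tau>. \<tau> \<in> {s..d} \<Longrightarrow> \<bar>w \<tau>\<bar> \<le> \<rho>"
      and init: "norm (z s - zbar 0) < \<rho>" and t: "t \<in> {s..d}"
    define D where "D \<tau> = z \<tau> - zbar (\<tau> - s)" for \<tau>
    have derD: "(D has_vector_derivative f (z \<tau>, w \<tau>) - f (zbar (\<tau> - s), 0)) (at \<tau> within {s..d})"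
      if "\<tau> \<in> {s..d}" for \<tau>
      unfolding D_def using z that forward_solution_shift[OF zbar that]
      by (auto simp: driven_solution_def intro!: has_vector_derivative_diff)
    have "D t \<in> ball 0 tol"
    proof (rule stays_in_open[OF _ open_ball _ _ t])
      show "continuous_on {s..d} D"
        unfolding continuous_on_eq_continuous_within
        using derD has_vector_derivative_continuous by blast
      show "D s \<in> ball 0 tol" using init \<open>\<rho> < tol\<close> by (simp add: D_def)
    next
      fix t assume t: "s < t" "t \<le> d" and "\<And>\<tau>. \<tau> \<in> {s..<t} \<Longrightarrow> D \<tau> \<in> ball 0 tol" "D t \<in> closure (ball 0 tol)"
      then have bd: "norm (D \<tau>) \<le> tol" if "\<tau> \<in> {s..t}" for \<tau>
        using that \<open>0 < tol\<close> by (cases "\<tau> = t") (auto simp: less_imp_le)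
      have "(norm (D t))\<^sup>2 + \<rho>\<^sup>2 \<le> ((norm (D s))\<^sup>2 + \<rho>\<^sup>2) * exp ((3 * L) * (t - s))"
      proof (rule exp_growth_bound[where
            u' = "\<lambda>\<tau>. 2 * (D \<tau> \<bullet> (f (z \<tau>, w \<tau>) - f (zbar (\<tau> - s), 0)))"])
        fix \<tau> assume \<tau>: "\<tau> \<in> {s..t}"
        have "(D has_vector_derivative f (z \<tau>, w \<tau>) - f (zbar (\<tau> - s), 0)) (at \<tau> within {s..t})"
          by (rule has_vector_derivative_within_subset[OF derD[of \<tau>]]) (use \<tau> t in auto)
        then show "((\<lambda>\<tau>. (norm (D \<tau>))\<^sup>2 + \<rho>\<^sup>2) has_real_derivative
            2 * (D \<tau> \<bullet> (f (z \<tau>, w \<tau>) - f (zbar (\<tau> - s), 0)))) (at \<tau> within {s..t})"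
          unfolding power2_norm_eq_inner has_vector_derivative_def has_field_derivative_def
          by (auto intro!: derivative_eq_intros simp: inner_commute)
        have ball: "norm (zbar (\<tau> - s)) \<le> C" using C[of "\<tau> - s"] \<tau> t d by auto
        then have "norm (z \<tau>) \<le> C + tol"
          using bd[OF \<tau>] norm_triangle_sub[of "z \<tau>" "zbar (\<tau> - s)"] by (simp add: D_def)
        moreover have w\<tau>: "\<bar>w \<tau>\<bar> \<le> \<rho>" using w[of \<tau>] \<tau> t by auto
        ultimately have "norm (z \<tau>, w \<tau>) \<le> C + tol + 1"
          using norm_Pair_le[of "z \<tau>" "w \<tau>"] \<rho>(2) by simp
        moreover have "norm (zbar (\<tau> - s), 0::real) \<le> C + tol + 1"
          using ball \<open>0 < tol\<close> by (simp add: norm_Pair)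
        ultimately have "norm (f (z \<tau>, w \<tau>) - f (zbar (\<tau> - s), 0))
            \<le> L * norm ((z \<tau>, w \<tau>) - (zbar (\<tau> - s), 0))" by (rule L(2))
        also have "\<dots> \<le> L * (norm (D \<tau>) + \<rho>)"
          using L(1) w\<tau> norm_Pair_le[of "D \<tau>" "w \<tau>"] by (intro mult_left_mono) (auto simp: D_def)
        finally have "D \<tau> \<bullet> (f (z \<tau>, w \<tau>) - f (zbar (\<tau> - s), 0)) \<le> norm (D \<tau>) * (L * (norm (D \<tau>) + \<rho>))"
          by (intro order_trans[OF norm_cauchy_schwarz] mult_left_mono) auto
        moreover have "norm (D \<tau>) * (L * (norm (D \<tau>) + \<rho>)) = L * ((norm (D \<tau>))\<^sup>2 + norm (D \<tau>) * \<rho>)"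
          by (simp add: power2_eq_square algebra_simps)
        moreover have "L * (2 * (norm (D \<tau>) * \<rho>)) \<le> L * ((norm (D \<tau>))\<^sup>2 + \<rho>\<^sup>2)"
          using L(1) sum_squares_bound[of "norm (D \<tau>)" \<rho>] by (intro mult_left_mono) (auto simp: mult.assoc)
        moreover have "0 \<le> L * \<rho>\<^sup>2" using L(1) by simp
        ultimately show "2 * (D \<tau> \<bullet> (f (z \<tau>, w \<tau>) - f (zbar (\<tau> - s), 0)))
            \<le> (3 * L) * ((norm (D \<tau>))\<^sup>2 + \<rho>\<^sup>2)"
          unfolding distrib_left mult.assoc by linarith
      qed (use t in auto)
      also have "\<dots> \<le> (\<rho>\<^sup>2 + \<rho>\<^sup>2) * exp (3 * L * T)"
      proof (intro mult_mono add_mono)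
        show "(norm (D s))\<^sup>2 \<le> \<rho>\<^sup>2" using init by (intro power_mono) (auto simp: D_def)
        show "exp (3 * L * (t - s)) \<le> exp (3 * L * T)"
          using t d L(1) by (auto intro!: mult_left_mono)
      qed auto
      also have "\<dots> < tol\<^sup>2" using small by simp
      finally have "(norm (D t))\<^sup>2 < tol\<^sup>2" using zero_le_power2[of \<rho>] by linarith
      then show "D t \<in> ball 0 tol" using \<open>0 < tol\<close> by (simp add: power2_less_imp_less)
    qed
    then show "norm (z t - zbar (t - s)) < tol" by (simp add: D_def)
  qed
qed

text \<open>One number \<open>c\<close> bounds both the input (by \<open>c\<close>) and the reaching time (by \<open>1 / c\<close>), so that the property
gets weaker as \<open>c\<close> decreases and one compactness argument makes everything uniform. The lower bound
\<open>1\<close> for the reaching time ensures that finitely many repetitions cover any bounded interval.\<close>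

definition reaches ::
    "('z::real_normed_vector \<times> real \<Rightarrow> 'z) \<Rightarrow> real \<Rightarrow> real \<Rightarrow> real \<Rightarrow> 'z \<Rightarrow> bool" where
  "reaches f r B c y \<longleftrightarrow> (\<forall>z w s d. driven_solution f w z s d \<and> z s = y \<and> (\<forall>t\<in>{s..d}. \<bar>w t\<bar> \<le> c) \<longrightarrow>
     (\<exists>T\<in>{1..1 / c}. (\<forall>t\<in>{s..d}. t \<le> s + T \<longrightarrow> norm (z t) \<le> B) \<and>
        (s + T \<le> d \<longrightarrow> norm (z (s + T)) \<le> r)))"

lemma reaches_mono:
  assumes "reaches f r B c y" "0 < c'" "c' \<le> c" "B \<le> B'"
  shows "reaches f r B' c' y"
  unfolding reaches_def
proof (intro allI impI)
  fix z w s d assume *: "driven_solution f w z s d \<and> z s = y \<and> (\<forall>t\<in>{s..d}. \<bar>w t\<bar> \<le> c')"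
  then have "driven_solution f w z s d \<and> z s = y \<and> (\<forall>t\<in>{s..d}. \<bar>w t\<bar> \<le> c)"
    using assms(3) by (meson order_trans)
  then obtain T where T: "T \<in> {1..1 / c}" "\<forall>t\<in>{s..d}. t \<le> s + T \<longrightarrow> norm (z t) \<le> B"
     "s + T \<le> d \<longrightarrow> norm (z (s + T)) \<le> r"
    using assms(1) unfolding reaches_def by blast
  have "1 / c \<le> 1 / c'" using assms by (intro divide_left_mono) auto
  then have "T \<in> {1..1 / c'}" using T(1) by auto
  then show "\<exists>T\<in>{1..1 / c'}. (\<forall>t\<in>{s..d}. t \<le> s + T \<longrightarrow> norm (z t) \<le> B') \<and>
        (s + T \<le> d \<longrightarrow> norm (z (s + T)) \<le> r)"
    using T assms(4) by (meson order_trans)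
qed

lemma reaches_near_convergent_solution:
  fixes E :: "'z::{real_inner, heine_borel} set" and f :: "'z \<times> real \<Rightarrow> 'z"
  assumes E: "orthonormal_basis E" and f: "smooth f"
    and zbar: "forward_solution (\<lambda>z. f (z, 0)) zbar" and lim: "(zbar \<longlongrightarrow> 0) at_top"
    and "0 < r" and bd: "\<And>t. 0 \<le> t \<Longrightarrow> norm (zbar t) \<le> C" and "C < B"
  shows "\<exists>\<rho>>0. \<exists>c>0. \<forall>y\<in>ball (zbar 0) \<rho>. reaches f r B c y"
proof -
  have "\<forall>\<^sub>F t in at_top. dist (zbar t) 0 < r / 2" by (rule tendstoD[OF lim]) (use \<open>0 < r\<close> in simp)
  then obtain T0 where T0: "\<And>t. T0 \<le> t \<Longrightarrow> norm (zbar t) < r / 2"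
    by (auto simp: eventually_at_top_linorder)
  define T where "T = max 1 T0"
  have T: "1 \<le> T" "T0 \<le> T" by (auto simp: T_def)
  obtain \<rho> where \<rho>: "\<rho> > 0" "\<And>z w s d t. driven_solution f w z s d \<Longrightarrow> d \<le> s + T \<Longrightarrow>
     (\<And>\<tau>. \<tau> \<in> {s..d} \<Longrightarrow> \<bar>w \<tau>\<bar> \<le> \<rho>) \<Longrightarrow> norm (z s - zbar 0) < \<rho> \<Longrightarrow> t \<in> {s..d} \<Longrightarrow>
     norm (z t - zbar (t - s)) < min (r / 2) (B - C)"
    using tracking[OF E f zbar, of T "min (r / 2) (B - C)"] T \<open>0 < r\<close> \<open>C < B\<close> by auto
  define c where "c = min \<rho> (1 / T)"
  have c: "0 < c" "c \<le> \<rho>" "T \<le> 1 / c" using \<rho>(1) T by (auto simp: c_def min_def field_simps)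
  have "reaches f r B c y" if y: "y \<in> ball (zbar 0) \<rho>" for y
    unfolding reaches_def
  proof (intro allI impI bexI[of _ T] conjI ballI)
    fix z w s d assume *: "driven_solution f w z s d \<and> z s = y \<and> (\<forall>t\<in>{s..d}. \<bar>w t\<bar> \<le> c)"
    have near: "norm (z t - zbar (t - s)) < min (r / 2) (B - C)" if t: "t \<in> {s..d}" "t \<le> s + T" for t
    proof (rule \<rho>(2))
      show "driven_solution f w z s t"
        using * t by (auto intro: driven_solution_subinterval)
      show "\<bar>w \<tau>\<bar> \<le> \<rho>" if "\<tau> \<in> {s..t}" for \<tau> using * that t c(2) by force
      show "norm (z s - zbar 0) < \<rho>" using * y by (auto simp: dist_norm norm_minus_commute)
    qed (use t in auto)
    { fix t assume t: "t \<in> {s..d}" "t \<le> s + T"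
      show "norm (z t) \<le> B"
        using near[OF t] bd[of "t - s"] t norm_triangle_sub[of "z t" "zbar (t - s)"] by auto }
    { assume "s + T \<le> d"
      then show "norm (z (s + T)) \<le> r"
        using near[of "s + T"] T T0[of T] norm_triangle_sub[of "z (s + T)" "zbar T"] by auto }
  qed (use T c in auto)
  then show ?thesis using \<rho>(1) c(1) by blast
qed

lemma uniform_constant_on_compact:
  fixes K :: "'a::metric_space set"
  assumes "compact K"
    and local: "\<And>x. x \<in> K \<Longrightarrow> \<exists>\<rho>>0. \<exists>c>0. \<forall>y\<in>ball x \<rho>. P y c"
    and mono: "\<And>y c c'. P y c \<Longrightarrow> 0 < c' \<Longrightarrow> c' \<le> c \<Longrightarrow> P y c'"
  shows "\<exists>c>0::real. \<forall>y\<in>K. P y c"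
proof -
  obtain \<rho> c where \<rho>: "\<And>x. x \<in> K \<Longrightarrow> 0 < \<rho> x" and c: "\<And>x. x \<in> K \<Longrightarrow> 0 < c x"
    and P: "\<And>x y. x \<in> K \<Longrightarrow> y \<in> ball x (\<rho> x) \<Longrightarrow> P y (c x)"
    using local by metis
  have "K \<subseteq> (\<Union>x\<in>K. ball x (\<rho> x))" using \<rho> by force
  then obtain F where F: "F \<subseteq> K" "finite F" "K \<subseteq> (\<Union>x\<in>F. ball x (\<rho> x))"
    using compactE_image[OF \<open>compact K\<close>, of K "\<lambda>x. ball x (\<rho> x)"] by auto
  define m where "m = Min (insert 1 (c ` F))"
  have m: "0 < m" unfolding m_def using F c by (subst Min_gr_iff) auto
  have "P y m" if y: "y \<in> K" for y
  proof -
    obtain x where x: "x \<in> F" "y \<in> ball x (\<rho> x)" using F(3) y by blast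
    moreover have "m \<le> c x" unfolding m_def using F(2) x(1) by (intro Min_le) auto
    ultimately show ?thesis using mono[OF P m] F(1) by blast
  qed
  then show ?thesis using m by blast
qed

text \<open>Choose \<open>r\<close> such that unforced solutions from the ball of radius \<open>r\<close> stay below \<open>e / 2\<close>. Uniformly in the
initial point, forced solutions from this ball stay below \<open>e\<close> until they are found in it again, at least one
time unit later; repetition traps them. From the ball of radius \<open>R\<close> the small ball is reached
within a uniform time, and \<open>B\<close> bounds the solutions until then.\<close>

lemma practical_stability:
  fixes E :: "'z::{real_inner, heine_borel} set" and f :: "'z \<times> real \<Rightarrow> 'z"
  assumes E: "orthonormal_basis E" and f: "smooth f" and mp: "minimum_phase f" and "0 < e"
  shows "\<exists>\<nu>>0. \<exists>B. \<exists>T>0. \<forall>z w s d. driven_solution f w z s d \<and> norm (z s) \<le> R \<and>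
     (\<forall>\<tau>\<in>{s..d}. \<bar>w \<tau>\<bar> \<le> \<nu>) \<longrightarrow>
     (\<forall>t\<in>{s..d}. norm (z t) \<le> B \<and> (s + T \<le> t \<longrightarrow> norm (z t) \<le> e))"
proof -
  have "e / 2 > 0" using \<open>0 < e\<close> by simp
  then have stable: "\<exists>d>0. \<forall>x. forward_solution (\<lambda>z. f (z, 0)) x \<and> dist (x 0) 0 < d \<longrightarrow> (\<forall>t\<ge>0. dist (x t) 0 < e / 2)"
    and complete: "\<And>x0. \<exists>x. forward_solution (\<lambda>z. f (z, 0)) x \<and> x 0 = x0"
    and attr: "\<And>x. forward_solution (\<lambda>z. f (z, 0)) x \<Longrightarrow> (x \<longlongrightarrow> 0) at_top"
    using mp unfolding minimum_phase_def globally_asymptotically_stable_def by blast+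
  obtain d1 where d1: "d1 > 0" "\<And>x t. forward_solution (\<lambda>z. f (z, 0)) x \<Longrightarrow> norm (x 0) < d1 \<Longrightarrow> 0 \<le> t \<Longrightarrow> norm (x t) < e / 2"
    using stable unfolding dist_0_norm dist_commute[of _ 0] by blast
  define r where "r = d1 / 2"
  have r: "0 < r" "r < d1" using d1 by (auto simp: r_def)
  have "\<exists>c>0. \<forall>y\<in>cball 0 r. reaches f r e c y"
  proof (rule uniform_constant_on_compact)
    fix y0 :: 'z assume y0: "y0 \<in> cball 0 r"
    obtain zbar where zbar: "forward_solution (\<lambda>z. f (z, 0)) zbar" "zbar 0 = y0" using complete by blast
    have "norm (zbar t) \<le> e / 2" if "0 \<le> t" for t
      using d1(2)[OF zbar(1) _ that] y0 r(2) zbar(2) by force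
    then show "\<exists>\<rho>>0. \<exists>c>0. \<forall>y\<in>ball y0 \<rho>. reaches f r e c y"
      using reaches_near_convergent_solution[OF E f zbar(1) attr[OF zbar(1)] r(1), of "e / 2" e] \<open>0 < e\<close> zbar(2) by auto
  qed (auto intro: reaches_mono)
  then obtain c1 where c1: "c1 > 0" "\<And>y. norm y \<le> r \<Longrightarrow> reaches f r e c1 y" by auto
  have "\<exists>c>0. \<forall>y\<in>cball 0 R. reaches f r (1 / c) c y"
  proof (rule uniform_constant_on_compact)
    fix y0 :: 'z
    obtain zbar where zbar: "forward_solution (\<lambda>z. f (z, 0)) zbar" "zbar 0 = y0" using complete by blast
    obtain C where C: "\<And>t. 0 \<le> t \<Longrightarrow> norm (zbar t) \<le> C"
      using convergent_forward_solution_bounded[OF zbar(1) attr[OF zbar(1)]] by blast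
    then have "0 \<le> C" using norm_ge_zero[of "zbar 0"] by (meson order_trans order_refl)
    obtain \<rho> c where \<rho>: "\<rho> > 0" "c > 0" "\<And>y. y \<in> ball y0 \<rho> \<Longrightarrow> reaches f r (C + 1) c y"
      using reaches_near_convergent_solution[OF E f zbar(1) attr[OF zbar(1)] r(1) C, of "C + 1"] zbar(2) by auto
    define c' where "c' = min c (1 / (C + 1))"
    have c': "0 < c'" "c' \<le> c" "C + 1 \<le> 1 / c'"
      using \<rho>(2) \<open>0 \<le> C\<close> by (auto simp: c'_def min_def field_simps)
    then show "\<exists>\<rho>>0. \<exists>c>0. \<forall>y\<in>ball y0 \<rho>. reaches f r (1 / c) c y"
      using \<rho> reaches_mono by metis
  next
    fix y :: 'z and c c' :: real
    assume *: "reaches f r (1 / c) c y" "0 < c'" "c' \<le> c"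
    then have "1 / c \<le> 1 / c'" by (intro divide_left_mono) auto
    then show "reaches f r (1 / c') c' y" by (rule reaches_mono[OF *])
  qed auto
  then obtain c2 where c2: "c2 > 0" "\<And>y. norm y \<le> R \<Longrightarrow> reaches f r (1 / c2) c2 y" by auto
  have trapped: "\<forall>t\<in>{s..d}. norm (z t) \<le> e"
    if "driven_solution f w z s d" "norm (z s) \<le> r" "\<forall>\<tau>\<in>{s..d}. \<bar>w \<tau>\<bar> \<le> c1" "d - s \<le> real n" for z w s d n
    using that
  proof (induction n arbitrary: s)
    case 0
    have "reaches f r e c1 (z s)" using c1(2)[OF 0(2)] .
    then obtain T where "T \<in> {1..1 / c1}" "\<forall>t\<in>{s..d}. t \<le> s + T \<longrightarrow> norm (z t) \<le> e"
      using 0 unfolding reaches_def by blast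
    then show ?case using 0(4) by auto
  next
    case (Suc n)
    have "reaches f r e c1 (z s)" using c1(2)[OF Suc(3)] .
    then obtain T where T: "T \<in> {1..1 / c1}" "\<forall>t\<in>{s..d}. t \<le> s + T \<longrightarrow> norm (z t) \<le> e"
        "s + T \<le> d \<longrightarrow> norm (z (s + T)) \<le> r"
      using Suc unfolding reaches_def by blast
    show ?case
    proof (cases "s + T \<le> d")
      case True
      have "\<forall>t\<in>{s + T..d}. norm (z t) \<le> e"
        using Suc.prems T True by (intro Suc.IH driven_solution_subinterval[OF Suc.prems(1)]) auto
      then show ?thesis using T(2) by (metis atLeastAtMost_iff linear)
    qed (use T in auto)
  qed
  have "norm (z t) \<le> max (1 / c2) e \<and> (s + 1 / c2 \<le> t \<longrightarrow> norm (z t) \<le> e)"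
    if z: "driven_solution f w z s d" "norm (z s) \<le> R" and w: "\<forall>\<tau>\<in>{s..d}. \<bar>w \<tau>\<bar> \<le> min c1 c2"
      and t: "t \<in> {s..d}" for z w s d t
  proof -
    have w12: "\<forall>\<tau>\<in>{s..d}. \<bar>w \<tau>\<bar> \<le> c1" "\<forall>\<tau>\<in>{s..d}. \<bar>w \<tau>\<bar> \<le> c2" using w by auto
    obtain T where T: "T \<in> {1..1 / c2}" "\<forall>t\<in>{s..d}. t \<le> s + T \<longrightarrow> norm (z t) \<le> 1 / c2"
        "s + T \<le> d \<longrightarrow> norm (z (s + T)) \<le> r"
      using c2(2)[OF z(2)] z(1) w12(2) unfolding reaches_def by blast
    have "norm (z t) \<le> e" if "s + T \<le> t"
    proof -
      obtain n where "d - (s + T) \<le> real n" using real_arch_simple by blast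
      then have "\<forall>t\<in>{s + T..d}. norm (z t) \<le> e"
        using T w12 that t by (intro trapped[where w = w] driven_solution_subinterval[OF z(1)]) auto
      then show ?thesis using that t by auto
    qed
    moreover have "norm (z t) \<le> 1 / c2" if "t \<le> s + T" using T(2) t that by auto
    ultimately show ?thesis
      using T(1) by (cases "s + T \<le> t") auto
  qed
  then have "\<forall>z w s d. driven_solution f w z s d \<and> norm (z s) \<le> R \<and> (\<forall>\<tau>\<in>{s..d}. \<bar>w \<tau>\<bar> \<le> min c1 c2) \<longrightarrow>
     (\<forall>t\<in>{s..d}. norm (z t) \<le> max (1 / c2) e \<and> (s + 1 / c2 \<le> t \<longrightarrow> norm (z t) \<le> e))"
    by blast
  moreover have "0 < min c1 c2" "0 < 1 / c2" using c1(1) c2(1) by auto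
  ultimately show ?thesis by blast
qed

section \<open>Chains of identical first-order filters\<close>

text \<open>If \<open>X i\<close> is the value of the \<open>i\<close>-th derivative of a signal, then \<open>filt g k X i\<close> is that of the \<open>i\<close>-th derivative
of \<open>(d/dt + g)\<^sup>k\<close> applied to the signal. On the coefficient level this is the polynomial
\<open>s\<^sup>i (s + g)\<^sup>k\<close>; the recursion avoids binomial sums.\<close>

primrec filt :: "real \<Rightarrow> nat \<Rightarrow> (nat \<Rightarrow> real) \<Rightarrow> nat \<Rightarrow> real" where
  "filt g 0 X i = X i"
| "filt g (Suc k) X i = filt g k X (Suc i) + g * filt g k X i"

text \<open>The leading coefficient \<open>1\<close> makes \<open>filt g n X 0\<close> a combination of the admissible form
\<open>a \<xi> + \<xi>\<^sub>r\<close>.\<close>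

lemma filt_coefficients:
  "\<exists>c. \<forall>X i. filt g k X i = (\<Sum>l<k. c l * X (i + l)) + X (i + k)"
proof (induction k)
  case (Suc k)
  then obtain c where c: "\<And>X i. filt g k X i = (\<Sum>l<k. c l * X (i + l)) + X (i + k)" by blast
  define c' where "c' l = (case l of 0 \<Rightarrow> 0 | Suc m \<Rightarrow> c m) + g * (if l = k then 1 else c l)" for l
  have "filt g (Suc k) X i = (\<Sum>l<Suc k. c' l * X (i + l)) + X (i + Suc k)" for X i
  proof -
    have "(\<Sum>l<Suc k. c' l * X (i + l)) =
        (\<Sum>l<Suc k. (case l of 0 \<Rightarrow> 0 | Suc m \<Rightarrow> c m) * X (i + l)) +
        (\<Sum>l<Suc k. g * ((if l = k then 1 else c l) * X (i + l)))"
      by (simp add: c'_def distrib_right sum.distrib mult.assoc del: sum.lessThan_Suc)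
    also have "(\<Sum>l<Suc k. (case l of 0 \<Rightarrow> 0 | Suc m \<Rightarrow> c m) * X (i + l)) = (\<Sum>l<k. c l * X (Suc i + l))"
      by (subst sum.lessThan_Suc_shift) simp
    also have "(\<Sum>l<Suc k. g * ((if l = k then 1 else c l) * X (i + l))) =
        g * ((\<Sum>l<k. c l * X (i + l)) + X (i + k))"
      by (simp add: sum_distrib_left distrib_left)
    finally show ?thesis by (simp add: c)
  qed
  then show ?case by blast
qed simp

lemma filt_bound:
  assumes "0 \<le> g" "\<And>i. i \<le> n \<Longrightarrow> \<bar>X i\<bar> \<le> R" "i + k \<le> n"
  shows "\<bar>filt g k X i\<bar> \<le> (1 + g) ^ k * R"
  using assms(3)
proof (induction k arbitrary: i)
  case (Suc k)
  have "\<bar>filt g (Suc k) X i\<bar> \<le> \<bar>filt g k X (Suc i)\<bar> + g * \<bar>filt g k X i\<bar>"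
    using assms(1) abs_triangle_ineq[of "filt g k X (Suc i)" "g * filt g k X i"] by (simp add: abs_mult)
  also have "\<dots> \<le> (1 + g) ^ k * R + g * ((1 + g) ^ k * R)"
    using Suc assms(1) by (intro add_mono mult_left_mono) auto
  finally show ?case by (simp add: algebra_simps)
qed (use assms(2) in auto)

text \<open>The recursion is solved for the highest derivative: all states of the integrator chain are recovered from
the outputs of the filters.\<close>

lemma filt_inverse_bound:
  assumes "0 \<le> g" "\<And>k. k \<le> n \<Longrightarrow> \<bar>filt g k X 0\<bar> \<le> C" "i + k \<le> n"
  shows "\<bar>filt g k X i\<bar> \<le> (1 + g) ^ i * C"
  using assms(3)
proof (induction i arbitrary: k)
  case (Suc i)
  have "filt g k X (Suc i) = filt g (Suc k) X i - g * filt g k X i" by simp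
  then have "\<bar>filt g k X (Suc i)\<bar> \<le> \<bar>filt g (Suc k) X i\<bar> + g * \<bar>filt g k X i\<bar>"
    using assms(1) abs_triangle_ineq4[of "filt g (Suc k) X i" "g * filt g k X i"] by (simp add: abs_mult)
  also have "\<dots> \<le> (1 + g) ^ i * C + g * ((1 + g) ^ i * C)"
    using Suc.IH[of "Suc k"] Suc.IH[of k] Suc.prems assms(1) by (intro add_mono mult_left_mono) auto
  finally show ?case by (simp add: algebra_simps)
qed (use assms(2) in auto)

lemma filt_has_derivative:
  assumes "\<And>i. i < n \<Longrightarrow> (X i has_real_derivative X (Suc i) t) (at t within S)" "i + k < n"
  shows "((\<lambda>\<tau>. filt g k (\<lambda>i. X i \<tau>) i) has_real_derivative filt g k (\<lambda>i. X i t) (Suc i)) (at t within S)"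
  using assms(2)
proof (induction k arbitrary: i)
  case (Suc k)
  have "((\<lambda>\<tau>. filt g k (\<lambda>i. X i \<tau>) (Suc i)) has_real_derivative filt g k (\<lambda>i. X i t) (Suc (Suc i))) (at t within S)"
    "((\<lambda>\<tau>. filt g k (\<lambda>i. X i \<tau>) i) has_real_derivative filt g k (\<lambda>i. X i t) (Suc i)) (at t within S)"
    using Suc.IH[of "Suc i"] Suc.IH[of i] Suc.prems by auto
  from DERIV_add[OF this(1) DERIV_cmult[OF this(2), of g]] show ?case by simp
qed (use assms(1) in auto)

definition filter_chain :: "real \<Rightarrow> nat \<Rightarrow> (nat \<Rightarrow> real \<Rightarrow> real) \<Rightarrow> real \<Rightarrow> real \<Rightarrow> bool" where
  "filter_chain g n \<theta> s d \<longleftrightarrow> (\<forall>k<n. \<forall>t\<in>{s..d}.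
     (\<theta> k has_real_derivative g * (\<theta> (Suc k) t - \<theta> k t)) (at t within {s..d}))"

lemma filter_chain_subinterval:
  assumes "filter_chain g n \<theta> s d" "s \<le> s'" "d' \<le> d"
  shows "filter_chain g n \<theta> s' d'"
  unfolding filter_chain_def
proof (intro allI impI ballI)
  fix k t assume "k < n" "t \<in> {s'..d'}"
  then have "(\<theta> k has_real_derivative g * (\<theta> (Suc k) t - \<theta> k t)) (at t within {s..d})"
    using assms by (auto simp: filter_chain_def)
  then show "(\<theta> k has_real_derivative g * (\<theta> (Suc k) t - \<theta> k t)) (at t within {s'..d'})"
    by (rule DERIV_subset) (use assms in auto)
qed

lemma filter_chain_step:
  assumes "filter_chain g n \<theta> s d" "0 \<le> g" "k < n" "t \<in> {s..d}"
    and "\<And>\<tau>. \<tau> \<in> {s..d} \<Longrightarrow> \<bar>\<theta> (Suc k) \<tau>\<bar> \<le> B"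
  shows "\<bar>\<theta> k t\<bar> \<le> B + (\<bar>\<theta> k s\<bar> - B) * exp (- g * (t - s))"
proof (rule filter_bound)
  fix \<tau> assume \<tau>: "\<tau> \<in> {s..t}"
  show "(\<theta> k has_real_derivative g * (\<theta> (Suc k) \<tau> - \<theta> k \<tau>)) (at \<tau> within {s..t})"
    using filter_chain_subinterval[OF assms(1), of s t] assms(3,4) \<tau> by (auto simp: filter_chain_def)
qed (use assms in auto)

lemma filter_chain_invariant:
  assumes chain: "filter_chain g n \<theta> s d" and "0 \<le> g"
    and init: "\<And>k. k \<le> n \<Longrightarrow> \<bar>\<theta> k s\<bar> \<le> Q"
    and top: "\<And>t. t \<in> {s..d} \<Longrightarrow> \<bar>\<theta> n t\<bar> \<le> Q"
    and "k \<le> n" "t \<in> {s..d}"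
  shows "\<bar>\<theta> k t\<bar> \<le> Q"
  using \<open>k \<le> n\<close> \<open>t \<in> {s..d}\<close>
proof (induction k arbitrary: t rule: inc_induct)
  case (step k)
  have "\<bar>\<theta> k t\<bar> \<le> Q + (\<bar>\<theta> k s\<bar> - Q) * exp (- g * (t - s))"
    by (rule filter_chain_step[OF chain \<open>0 \<le> g\<close>]) (use step in auto)
  moreover have "(\<bar>\<theta> k s\<bar> - Q) * exp (- g * (t - s)) \<le> 0"
    using init[of k] step by (intro mult_nonpos_nonneg) auto
  ultimately show ?case by linarith
qed (use top in auto)

text \<open>Along the chain, from the driving end to the other, the size doubles at each step, which is what the factor
\<open>2 ^ n\<close> pays for; each step takes the time \<open>l / g\<close> needed for \<open>Q\<close> to decay below the tolerance. Quantified
this way, \<open>L\<close> does not depend on \<open>g\<close>, so that a large gain makes the transient arbitrarily short.\<close>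

lemma filter_chain_decay:
  assumes "0 < Q" "0 < \<nu>"
  shows "\<exists>L\<ge>0. \<forall>g>0. \<forall>\<theta> s d. filter_chain g n \<theta> s d \<and> (\<forall>k\<le>n. \<forall>t\<in>{s..d}. \<bar>\<theta> k t\<bar> \<le> Q) \<and>
     (\<forall>t\<in>{s..d}. \<bar>\<theta> n t\<bar> \<le> \<nu> / 2 ^ n) \<longrightarrow>
     (\<forall>k\<le>n. \<forall>t\<in>{s..d}. s + L / g \<le> t \<longrightarrow> \<bar>\<theta> k t\<bar> \<le> \<nu>)"
proof (induction n)
  case 0
  show ?case by (rule exI[of _ 0]) auto
next
  case (Suc n)
  then obtain L where L: "L \<ge> 0" "\<forall>g>0. \<forall>\<theta> s d. filter_chain g n \<theta> s d \<and>
     (\<forall>k\<le>n. \<forall>t\<in>{s..d}. \<bar>\<theta> k t\<bar> \<le> Q) \<and> (\<forall>t\<in>{s..d}. \<bar>\<theta> n t\<bar> \<le> \<nu> / 2 ^ n) \<longrightarrow>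
     (\<forall>k\<le>n. \<forall>t\<in>{s..d}. s + L / g \<le> t \<longrightarrow> \<bar>\<theta> k t\<bar> \<le> \<nu>)"
    by blast
  define \<beta> where "\<beta> = \<nu> / 2 ^ Suc n"
  have "\<nu> / 2 ^ Suc n \<le> \<nu> / 1"
    using \<open>0 < \<nu>\<close> by (intro divide_left_mono one_le_power) auto
  then have \<beta>: "0 < \<beta>" "2 * \<beta> = \<nu> / 2 ^ n" "\<beta> \<le> \<nu>"
    using \<open>0 < \<nu>\<close> by (auto simp: \<beta>_def)
  define l where "l = max 0 (ln (Q / \<beta>))"
  have "Q / \<beta> = exp (ln (Q / \<beta>))" using \<open>0 < Q\<close> \<beta>(1) by simp
  also have "\<dots> \<le> exp l" by (simp add: l_def)
  finally have "Q / \<beta> \<le> exp l" .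
  then have l: "0 \<le> l" "Q * exp (- l) \<le> \<beta>"
    using \<beta>(1) by (auto simp: l_def exp_minus field_simps)
  show ?case
  proof (intro exI[of _ "l + L"] conjI allI impI ballI)
    fix g \<theta> s d k t
    assume "0 < g" and *: "filter_chain g (Suc n) \<theta> s d \<and> (\<forall>k\<le>Suc n. \<forall>t\<in>{s..d}. \<bar>\<theta> k t\<bar> \<le> Q) \<and>
     (\<forall>t\<in>{s..d}. \<bar>\<theta> (Suc n) t\<bar> \<le> \<nu> / 2 ^ Suc n)"
      and k: "k \<le> Suc n" and t: "t \<in> {s..d}" "s + (l + L) / g \<le> t"
    define s1 where "s1 = s + l / g"
    have s1: "s \<le> s1" using l \<open>0 < g\<close> by (simp add: s1_def)
    have mid: "\<bar>\<theta> n \<tau>\<bar> \<le> \<nu> / 2 ^ n" if \<tau>: "\<tau> \<in> {s1..d}" for \<tau>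
    proof -
      have "\<bar>\<theta> n \<tau>\<bar> \<le> \<beta> + (\<bar>\<theta> n s\<bar> - \<beta>) * exp (- g * (\<tau> - s))"
        by (rule filter_chain_step[where n = "Suc n" and d = d]) (use * \<tau> s1 \<open>0 < g\<close> in \<open>auto simp: \<beta>_def\<close>)
      also have "(\<bar>\<theta> n s\<bar> - \<beta>) * exp (- g * (\<tau> - s)) \<le> Q * exp (- l)"
      proof (rule mult_mono)
        have "\<bar>\<theta> n s\<bar> \<le> Q" using * t by auto
        then show "\<bar>\<theta> n s\<bar> - \<beta> \<le> Q" using \<beta>(1) by linarith
        have "l \<le> g * (\<tau> - s)" using \<tau> \<open>0 < g\<close> by (simp add: s1_def field_simps)
        then show "exp (- g * (\<tau> - s)) \<le> exp (- l)" by simp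
      qed (use \<open>0 < Q\<close> in auto)
      finally show ?thesis using l(2) \<beta>(2) by linarith
    qed
    have "filter_chain g n \<theta> s1 d"
      using filter_chain_subinterval[of g "Suc n" \<theta> s d s1 d] * s1 by (auto simp: filter_chain_def)
    moreover have "\<forall>k\<le>n. \<forall>t\<in>{s1..d}. \<bar>\<theta> k t\<bar> \<le> Q" using * s1 by auto
    ultimately have "\<forall>k\<le>n. \<forall>t\<in>{s1..d}. s1 + L / g \<le> t \<longrightarrow> \<bar>\<theta> k t\<bar> \<le> \<nu>"
      using L(2) \<open>0 < g\<close> mid by blast
    moreover have "s1 + L / g \<le> t" "s1 \<le> t"
      using t(2) L(1) \<open>0 < g\<close> by (auto simp: s1_def add_divide_distrib intro: order_trans[rotated])
    ultimately have "\<bar>\<theta> k t\<bar> \<le> \<nu>" if "k \<le> n" using that t(1) by auto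
    moreover have "\<bar>\<theta> (Suc n) t\<bar> \<le> \<nu>" using * t(1) \<beta>(3) unfolding \<beta>_def by (meson order_trans)
    ultimately show "\<bar>\<theta> k t\<bar> \<le> \<nu>" using k by (cases "k = Suc n") auto
  qed (use l L in auto)
qed

section \<open>Regulated trajectories\<close>

text \<open>The common core of the three closed loops. The input is an arbitrary function of time, constrained only by
opposing \<open>\<zeta>\<close> between the two levels \<open>\<mu>\<close> and \<open>W\<close>.\<close>

definition regulated where
  "regulated ix f q b a \<mu> U W x \<longleftrightarrow> abs_cont_curve x \<and>
     (AE t in lebesgue. 0 \<le> t \<longrightarrow>
        (\<exists>u. (x has_vector_derivative plant ix f q b u (x t)) (at t) \<and>
           (\<mu> < \<bar>zeta ix a (x t)\<bar> \<and> \<bar>zeta ix a (x t)\<bar> < W \<longrightarrow> u * sgn (zeta ix a (x t)) \<le> - U)))"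

lemma plant_coordinate:
  fixes ix :: "nat \<Rightarrow> 'r::finite" and y :: "'z::real_normed_vector \<times> (real ^ 'r)"
  assumes "bij_betw ix {1..CARD('r)} UNIV" "i < CARD('r)"
  shows "snd (plant ix f q b u y) $ ix (Suc i) =
    (if Suc i < CARD('r) then snd y $ ix (Suc (Suc i)) else q y + b y * u)"
proof -
  have ix: "ix j = ix (Suc i) \<longleftrightarrow> j = Suc i" if "j \<in> {1..CARD('r)}" for j
    using inj_on_eq_iff[OF bij_betw_imp_inj_on[OF assms(1)] that, of "Suc i"] assms(2) by simp
  have "(\<Sum>j\<in>{1..<CARD('r)}. (snd y $ ix (Suc j)) *\<^sub>R axis (ix j) (1::real)) $ ix (Suc i) =
      (\<Sum>j\<in>{1..<CARD('r)}. if j = Suc i then snd y $ ix (Suc (Suc i)) else 0)"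
    unfolding sum_component
  proof (rule sum.cong[OF refl])
    fix j assume "j \<in> {1..<CARD('r)}"
    then have "ix (Suc i) = ix j \<longleftrightarrow> j = Suc i" using ix[of j] by (metis atLeastAtMost_iff atLeastLessThan_iff less_imp_le)
    then show "((snd y $ ix (Suc j)) *\<^sub>R axis (ix j) (1::real)) $ ix (Suc i) =
        (if j = Suc i then snd y $ ix (Suc (Suc i)) else 0)"
      by (simp add: axis_def)
  qed
  also have "\<dots> = (if Suc i < CARD('r) then snd y $ ix (Suc (Suc i)) else 0)"
    by (auto simp: sum.delta)
  finally show ?thesis
    using ix[of "CARD('r)"] assms(2) by (simp add: plant_def axis_def eq_commute[of "ix (Suc i)"])
qed

lemma fst_plant: "fst (plant ix f q b u y) = f (fst y, snd y $ ix 1)"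
  by (simp add: plant_def)

lemma bounded_linear_coordinate: "bounded_linear (\<lambda>y. snd y $ k)"
  by (rule bounded_linear_compose[OF bounded_linear_vec_nth bounded_linear_snd])

lemma continuous_coordinates: "continuous_on S (\<lambda>y. (fst y, snd y $ k))"
  by (intro continuous_intros)

lemma bounded_linear_zeta: "bounded_linear (zeta ix a)"
  unfolding zeta_def[abs_def]
  by (intro bounded_linear_add bounded_linear_sum bounded_linear_const_mult bounded_linear_coordinate)

text \<open>The part of \<open>\<zeta>'\<close> that the input cannot influence.\<close>

definition zeta_drift where
  "zeta_drift ix a q y = (\<Sum>i\<in>{1..<CARD('r)}. a i * snd y $ ix (Suc i)) + q y"
  for ix :: "nat \<Rightarrow> 'r::finite"

lemma zeta_plant:
  fixes ix :: "nat \<Rightarrow> 'r::finite" and y :: "'z::real_normed_vector \<times> (real ^ 'r)"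
  assumes "bij_betw ix {1..CARD('r)} UNIV"
  shows "zeta ix a (plant ix f q b u y) = zeta_drift ix a q y + b y * u"
proof -
  have "snd (plant ix f q b u y) $ ix i = snd y $ ix (Suc i)" if "i \<in> {1..<CARD('r)}" for i
    using plant_coordinate[OF assms, of "i - 1" f q b u y] that by auto
  moreover have "snd (plant ix f q b u y) $ ix CARD('r) = q y + b y * u"
    using plant_coordinate[OF assms, of "CARD('r) - 1" f q b u y] by simp
  ultimately show ?thesis by (simp add: zeta_def zeta_drift_def)
qed

lemma abs_cont_on_bounded_linear:
  assumes "bounded_linear h" "abs_cont_on_interval c d x"
  shows "abs_cont_on_interval c d (\<lambda>t. h (x t))"
proof -
  interpret bounded_linear h by (rule assms(1))
  obtain M where M: "\<And>y. norm (h y) \<le> norm y * M" "0 < M" using pos_bounded by blast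
  show ?thesis
  proof (rule abs_cont_lipschitz_compose[OF assms(2), where M = M])
    fix s t
    have "norm (h (x s) - h (x t)) \<le> M * norm (x s - x t)"
      using M(1)[of "x s - x t"] by (simp add: diff mult.commute)
    also have "\<dots> \<le> M * (norm (x s - x t) + \<bar>s - t\<bar>)" using M(2) by simp
    finally show "norm (h (x s) - h (x t)) \<le> M * (norm (x s - x t) + \<bar>s - t\<bar>)" .
  qed
qed

lemma regulated_continuous_on:
  assumes "regulated ix f q b a \<mu> U W x"
  shows "continuous_on {0..t} x"
proof (cases "0 \<le> t")
  case True
  then show ?thesis using assms abs_cont_continuous_on by (auto simp: regulated_def abs_cont_curve_def)
qed simp

text \<open>Coordinates whose equation does not contain the input are differentiable everywhere, not
just almost everywhere.\<close>

lemma regulated_component_derivative: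
  fixes h :: "'z::real_normed_vector \<times> (real ^ 'r::finite) \<Rightarrow> 'c::real_inner"
  assumes reg: "regulated ix f q b a \<mu> U W x" and h: "bounded_linear h"
    and eq: "\<And>u y. h (plant ix f q b u y) = g y" and g: "continuous_on UNIV g"
    and "0 \<le> t" "\<tau> \<in> {0..t}"
  shows "((\<lambda>\<tau>. h (x \<tau>)) has_vector_derivative g (x \<tau>)) (at \<tau> within {0..t})"
proof (rule abs_cont_imp_has_vector_derivative[where g = "\<lambda>\<tau>. g (x \<tau>)"])
  show "abs_cont_on_interval 0 t (\<lambda>\<tau>. h (x \<tau>))"
    using reg \<open>0 \<le> t\<close> by (intro abs_cont_on_bounded_linear[OF h]) (auto simp: regulated_def abs_cont_curve_def)
  show "continuous_on {0..t} (\<lambda>\<tau>. g (x \<tau>))"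
    by (rule continuous_on_compose2[OF g regulated_continuous_on[OF reg]]) auto
  have "AE t in lebesgue. 0 \<le> t \<longrightarrow> (\<exists>u. (x has_vector_derivative plant ix f q b u (x t)) (at t))"
    using reg unfolding regulated_def by (auto elim: eventually_mono)
  then show "AE \<tau> in lebesgue. 0 < \<tau> \<and> \<tau> < t \<longrightarrow> ((\<lambda>\<tau>. h (x \<tau>)) has_vector_derivative g (x \<tau>)) (at \<tau>)"
  proof (rule eventually_mono, intro impI)
    fix \<tau> assume "0 \<le> \<tau> \<longrightarrow> (\<exists>u. (x has_vector_derivative plant ix f q b u (x \<tau>)) (at \<tau>))" "0 < \<tau> \<and> \<tau> < t"
    then obtain u where "(x has_vector_derivative plant ix f q b u (x \<tau>)) (at \<tau>)" by auto
    from bounded_linear.has_vector_derivative[OF h this]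
    show "((\<lambda>\<tau>. h (x \<tau>)) has_vector_derivative g (x \<tau>)) (at \<tau>)" by (simp add: eq)
  qed
qed fact

lemma regulated_zeta_bound:
  fixes ix :: "nat \<Rightarrow> 'r::finite" and x :: "real \<Rightarrow> 'z::real_normed_vector \<times> (real ^ 'r)"
  assumes ix: "bij_betw ix {1..CARD('r)} UNIV"
    and reg: "regulated ix f q b a \<mu> U W x" and b: "\<And>y. b0 \<le> b y" and "0 < b0" "0 \<le> \<mu>" "0 \<le> c" "0 \<le> U"
    and U: "P + c \<le> b0 * U" and "0 \<le> t"
    and inside: "\<And>\<tau>. 0 < \<tau> \<Longrightarrow> \<tau> < t \<Longrightarrow> \<bar>zeta ix a (x \<tau>)\<bar> < W \<and> \<bar>zeta_drift ix a q (x \<tau>)\<bar> \<le> P"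
  shows "\<bar>zeta ix a (x t)\<bar> \<le> max \<mu> (\<bar>zeta ix a (x 0)\<bar> - c * t)"
proof -
  have "\<bar>zeta ix a (x t)\<bar> \<le> max \<mu> (\<bar>zeta ix a (x 0)\<bar> - c * (t - 0))"
  proof (rule abs_decrease_to_level[OF \<open>0 \<le> t\<close> _ \<open>0 \<le> \<mu>\<close> \<open>0 \<le> c\<close>])
    show "abs_cont_on_interval 0 t (\<lambda>\<tau>. zeta ix a (x \<tau>))"
      using reg \<open>0 \<le> t\<close>
      by (intro abs_cont_on_bounded_linear[OF bounded_linear_zeta]) (auto simp: regulated_def abs_cont_curve_def)
    have "AE t in lebesgue. 0 \<le> t \<longrightarrow>
        (\<exists>u. (x has_vector_derivative plant ix f q b u (x t)) (at t) \<and>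
           (\<mu> < \<bar>zeta ix a (x t)\<bar> \<and> \<bar>zeta ix a (x t)\<bar> < W \<longrightarrow> u * sgn (zeta ix a (x t)) \<le> - U))"
      using reg by (simp add: regulated_def)
    then show "AE \<tau> in lebesgue. 0 < \<tau> \<and> \<tau> < t \<and> \<mu> < \<bar>zeta ix a (x \<tau>)\<bar> \<longrightarrow>
        (\<exists>D. ((\<lambda>\<tau>. zeta ix a (x \<tau>)) has_real_derivative D) (at \<tau>) \<and> D * sgn (zeta ix a (x \<tau>)) \<le> - c)"
    proof (rule eventually_mono, intro impI)
      fix \<tau> assume *: "0 \<le> \<tau> \<longrightarrow> (\<exists>u. (x has_vector_derivative plant ix f q b u (x \<tau>)) (at \<tau>) \<and>
           (\<mu> < \<bar>zeta ix a (x \<tau>)\<bar> \<and> \<bar>zeta ix a (x \<tau>)\<bar> < W \<longrightarrow> u * sgn (zeta ix a (x \<tau>)) \<le> - U))"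
        "0 < \<tau> \<and> \<tau> < t \<and> \<mu> < \<bar>zeta ix a (x \<tau>)\<bar>"
      then obtain u where u: "(x has_vector_derivative plant ix f q b u (x \<tau>)) (at \<tau>)"
        "u * sgn (zeta ix a (x \<tau>)) \<le> - U"
        using inside[of \<tau>] by auto
      define D where "D = zeta_drift ix a q (x \<tau>) + b (x \<tau>) * u"
      have "((\<lambda>\<tau>. zeta ix a (x \<tau>)) has_real_derivative D) (at \<tau>)"
        using bounded_linear.has_vector_derivative[OF bounded_linear_zeta u(1), of ix a]
        by (simp add: D_def zeta_plant[OF ix] has_real_derivative_iff_has_vector_derivative)
      moreover have "D * sgn (zeta ix a (x \<tau>)) \<le> - c"
      proof -
        have "zeta_drift ix a q (x \<tau>) * sgn (zeta ix a (x \<tau>)) \<le> P"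
          using inside[of \<tau>] *(2) by (auto simp: sgn_real_def)
        moreover have "b (x \<tau>) * (u * sgn (zeta ix a (x \<tau>))) \<le> b (x \<tau>) * (- U)"
          using b[of "x \<tau>"] \<open>0 < b0\<close> u(2) by (intro mult_left_mono) auto
        moreover have "b0 * U \<le> b (x \<tau>) * U"
          using b \<open>0 \<le> U\<close> by (intro mult_right_mono) auto
        ultimately show ?thesis using U by (simp add: D_def algebra_simps)
      qed
      ultimately show "\<exists>D. ((\<lambda>\<tau>. zeta ix a (x \<tau>)) has_real_derivative D) (at \<tau>) \<and>
          D * sgn (zeta ix a (x \<tau>)) \<le> - c" by blast
    qed
  qed
  then show ?thesis by simp
qed

section \<open>Semi-global practical regulation\<close>

lemma continuous_bounded_on_ball:
  fixes h :: "'a::{real_normed_vector, heine_borel} \<Rightarrow> 'b::real_normed_vector"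
  assumes "continuous_on UNIV h"
  shows "\<exists>M>0. \<forall>y. norm y \<le> r \<longrightarrow> norm (h y) \<le> M"
proof -
  have "compact (h ` cball 0 r)"
    by (intro compact_continuous_image compact_cball continuous_on_subset[OF assms]) auto
  then obtain M where "M > 0" "\<forall>v\<in>h ` cball 0 r. norm v \<le> M"
    using compact_imp_bounded bounded_pos by metis
  then show ?thesis by auto
qed

lemma norm_fst_cube_le:
  fixes E :: "'z::real_inner set" and y :: "'z \<times> (real ^ 'r::finite)"
  assumes "orthonormal_basis E" "y \<in> cube E R"
  shows "norm (fst y) \<le> real (card E) * R"
proof -
  have "norm (fst y) \<le> (\<Sum>e\<in>E. \<bar>fst y \<bullet> e\<bar>)" by (rule norm_le_sum_coordinates[OF assms(1)])
  also have "\<dots> \<le> real (card E) * R" using assms(2) by (intro sum_bounded_above) (simp add: cube_def)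
  finally show ?thesis .
qed

text \<open>The gain \<open>g\<close> comes first, since it determines \<open>a\<close>: it makes the transient of the filters take at most half of
the time \<open>\<tau>0\<close> during which \<open>z\<close> moves by at most \<open>1/2\<close>. The tolerance \<open>\<mu>\<close> is then small enough for the final
accuracy in spite of the factor \<open>G\<close> lost in passing from the filters back to \<open>\<xi>\<close>. The
compact region in which everything happens is known at this point, whence a bound \<open>P\<close> of the drift of
\<open>\<zeta>\<close>, and \<open>U\<close> overcomes \<open>P\<close> so strongly that \<open>\<zeta>\<close> reaches the band \<open>\<bar>\<zeta>\<bar> \<le> \<mu>\<close> in the other half of \<open>\<tau>0\<close>.\<close>

lemma practical_regulation:
  fixes E :: "'z::{real_inner, heine_borel} set" and ix :: "nat \<Rightarrow> 'r::finite"
    and f :: "'z \<times> real \<Rightarrow> 'z" and q b :: "'z \<times> (real ^ 'r) \<Rightarrow> real" and b0 R \<epsilon> :: real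
  assumes E: "orthonormal_basis E" and ix: "bij_betw ix {1..CARD('r)} UNIV"
    and f: "smooth f" and q: "continuous_on UNIV q" and mp: "minimum_phase f"
    and "0 < b0" and b: "\<And>y. b0 \<le> b y" and "0 < R" "0 < \<epsilon>"
  shows "\<exists>a \<mu> U W T. 0 < \<mu> \<and> \<mu> < W \<and> 0 < U \<and> 0 < T \<and> (\<forall>y\<in>cube E R. \<bar>zeta ix a y\<bar> < W) \<and>
     (\<forall>x. regulated ix f q b a \<mu> U W x \<and> x 0 \<in> cube E R \<longrightarrow>
       (\<forall>t\<ge>0. \<bar>zeta ix a (x t)\<bar> < W) \<and> (\<forall>t\<ge>T. x t \<in> cube E \<epsilon>))"
proof -
  define n where "n = CARD('r) - 1"
  have N: "CARD('r) = Suc n" by (simp add: n_def)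
  define X where "X y i = snd y $ ix (Suc i)" for y :: "'z \<times> (real ^ 'r)" and i
  have index: "\<exists>i\<le>n. k = ix (Suc i)" for k
  proof -
    have "k \<in> ix ` {1..CARD('r)}" using ix by (simp add: bij_betw_def)
    then obtain j where "j \<in> {1..CARD('r)}" "k = ix j" by auto
    then show ?thesis using N by (intro exI[of _ "j - 1"]) auto
  qed
  define Q where "Q = 2 ^ n * R"
  have Q: "0 < Q" using \<open>0 < R\<close> by (simp add: Q_def)
  define R1 where "R1 = real (card E) * R"
  obtain \<nu> B Tz where \<nu>: "0 < \<nu>" and Tz: "0 < Tz" and zstable:
    "\<forall>z w s d. driven_solution f w z s d \<and> norm (z s) \<le> R1 + 1 \<and> (\<forall>\<tau>\<in>{s..d}. \<bar>w \<tau>\<bar> \<le> \<nu>) \<longrightarrow>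
       (\<forall>t\<in>{s..d}. norm (z t) \<le> B \<and> (s + Tz \<le> t \<longrightarrow> norm (z t) \<le> \<epsilon>))"
    using practical_stability[OF E f mp \<open>0 < \<epsilon>\<close>, of "R1 + 1"] by blast
  \<comment> \<open>The bounds for \<open>z\<close> and \<open>\<xi>\<^sub>1\<close>, hence \<open>F\<close> and \<open>\<tau>0\<close>, do not depend on the gain.\<close>
  define Bz where "Bz = max B (R1 + 1) + 1"
  obtain F where F: "0 < F" "\<forall>y. norm y \<le> Bz + Q \<longrightarrow> norm (f y) \<le> F"
    using continuous_bounded_on_ball[OF smooth_continuous_on[OF f]] by blast
  define \<tau>0 where "\<tau>0 = 1 / (2 * F)"
  have \<tau>0: "0 < \<tau>0" "F * \<tau>0 = 1 / 2" using F(1) by (auto simp: \<tau>0_def)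
  obtain L where L: "0 \<le> L" "\<forall>g>0. \<forall>\<theta> s d. filter_chain g n \<theta> s d \<and> (\<forall>k\<le>n. \<forall>t\<in>{s..d}. \<bar>\<theta> k t\<bar> \<le> Q) \<and>
     (\<forall>t\<in>{s..d}. \<bar>\<theta> n t\<bar> \<le> \<nu> / 2 ^ n) \<longrightarrow>
     (\<forall>k\<le>n. \<forall>t\<in>{s..d}. s + L / g \<le> t \<longrightarrow> \<bar>\<theta> k t\<bar> \<le> \<nu>)"
    using filter_chain_decay[OF Q \<nu>, of n] by blast
  define g where "g = max 1 (2 * L / \<tau>0)"
  have g: "1 \<le> g" "0 < g" by (auto simp: g_def)
  have "2 * L / \<tau>0 \<le> g" by (simp add: g_def)
  then have Lg: "L / g \<le> \<tau>0 / 2" using \<tau>0(1) g(2) by (simp add: field_simps)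
  \<comment> \<open>The loss in passing from the \<open>\<theta>\<^sub>k\<close> to the coordinates of \<open>\<xi>\<close>.\<close>
  define G where "G = (1 + g) ^ n * g ^ n"
  have G: "1 \<le> G" using g mult_mono[of 1 "(1 + g) ^ n" 1 "g ^ n"] by (simp add: G_def one_le_power)
  define \<nu>1 where "\<nu>1 = \<epsilon> / G"
  have \<nu>1: "0 < \<nu>1" "G * \<nu>1 = \<epsilon>" using G \<open>0 < \<epsilon>\<close> by (auto simp: \<nu>1_def)
  obtain L1 where L1: "0 \<le> L1" "\<forall>g>0. \<forall>\<theta> s d. filter_chain g n \<theta> s d \<and> (\<forall>k\<le>n. \<forall>t\<in>{s..d}. \<bar>\<theta> k t\<bar> \<le> Q) \<and>
     (\<forall>t\<in>{s..d}. \<bar>\<theta> n t\<bar> \<le> \<nu>1 / 2 ^ n) \<longrightarrow>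
     (\<forall>k\<le>n. \<forall>t\<in>{s..d}. s + L1 / g \<le> t \<longrightarrow> \<bar>\<theta> k t\<bar> \<le> \<nu>1)"
    using filter_chain_decay[OF Q \<nu>1(1), of n] by blast
  define \<mu>0 where "\<mu>0 = min Q (min (\<nu> / 2 ^ n) (\<nu>1 / 2 ^ n))"
  define \<mu> where "\<mu> = g ^ n * \<mu>0"
  define W where "W = g ^ n * Q + 1"
  have \<mu>0: "0 < \<mu>0" "\<mu>0 \<le> Q" "\<mu>0 \<le> \<nu> / 2 ^ n" "\<mu>0 \<le> \<nu>1 / 2 ^ n" using Q \<nu> \<nu>1 by (auto simp: \<mu>0_def)
  have \<mu>: "0 < \<mu>" "\<mu> \<le> g ^ n * Q" using g \<mu>0 by (auto simp: \<mu>_def)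
  \<comment> \<open>The rate that brings \<open>\<bar>\<zeta>\<bar>\<close> from its largest initial value to \<open>0\<close> within \<open>\<tau>0 / 2\<close>.\<close>
  define c where "c = 2 * (g ^ n * Q) / \<tau>0"
  have c: "0 < c" "c * (\<tau>0 / 2) = g ^ n * Q" using \<tau>0 g Q by (auto simp: c_def)
  obtain cf where cf: "\<And>Y i. filt g n Y i = (\<Sum>l<n. cf l * Y (i + l)) + Y (i + n)"
    using filt_coefficients[of g n] by blast
  define a where "a i = cf (i - 1)" for i
  have zeta: "zeta ix a y = filt g n (X y) 0" for y
  proof -
    have "(\<Sum>i\<in>{1..<CARD('r)}. a i * snd y $ ix i) = (\<Sum>l\<in>{0..<n}. cf l * X y l)"
      unfolding N One_nat_def by (subst sum.atLeast_Suc_lessThan_Suc_shift) (simp add: a_def X_def)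
    then show ?thesis by (simp add: zeta_def cf N X_def atLeast0LessThan)
  qed
  define r where "r = Bz + CARD('r) * (G * Q + 1)"
  have "continuous_on UNIV (zeta_drift ix a q)"
    unfolding zeta_drift_def[abs_def]
    by (intro continuous_intros q linear_continuous_on bounded_linear_coordinate)
  then obtain P where P: "0 < P" "\<forall>y. norm y \<le> r \<longrightarrow> norm (zeta_drift ix a q y) \<le> P"
    using continuous_bounded_on_ball by blast
  define U where "U = (P + c) / b0"
  have U: "0 < U" "P + c \<le> b0 * U" using P(1) c(1) \<open>0 < b0\<close> by (auto simp: U_def)
  \<comment> \<open>The region that is shown to be invariant; all its bounds exceed the estimates proved below.\<close>
  define \<Omega> where "\<Omega> = {y :: 'z \<times> (real ^ 'r). norm (fst y) < Bz \<and> (\<forall>k. \<bar>snd y $ k\<bar> < G * Q + 1) \<and> \<bar>zeta ix a y\<bar> < W}"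
  have "open \<Omega>"
  proof -
    have \<Omega>_eq: "\<Omega> = {y. norm (fst y) < Bz} \<inter> (\<Inter>k. {y. \<bar>snd y $ k\<bar> < G * Q + 1}) \<inter> {y. \<bar>zeta ix a y\<bar> < W}"
      by (auto simp: \<Omega>_def)
    show ?thesis unfolding \<Omega>_eq
      by (intro open_Int open_INT ballI open_Collect_less continuous_intros
          linear_continuous_on bounded_linear_coordinate bounded_linear_zeta) auto
  qed
  have drift: "\<bar>zeta_drift ix a q y\<bar> \<le> P" if "y \<in> \<Omega>" for y
  proof -
    have "norm (snd y) \<le> (\<Sum>k\<in>UNIV. \<bar>snd y $ k\<bar>)" by (rule norm_le_l1_cart)
    also have "\<dots> \<le> CARD('r) * (G * Q + 1)"
      using that by (intro sum_bounded_above) (auto simp: \<Omega>_def less_imp_le)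
    finally have "norm y \<le> r"
      using norm_Pair_le[of "fst y" "snd y"] that by (simp add: \<Omega>_def r_def)
    then show ?thesis using P(2)[rule_format, of y] by simp
  qed
  have filt_init: "\<bar>filt g k (X y) 0\<bar> \<le> g ^ k * Q" if "y \<in> cube E R" "k \<le> n" for y k
  proof -
    have "\<bar>filt g k (X y) 0\<bar> \<le> (1 + g) ^ k * R"
      using that g by (intro filt_bound[where n = n]) (auto simp: cube_def X_def)
    also have "\<dots> \<le> (2 * g) ^ k * R"
      using g \<open>0 < R\<close> by (intro mult_right_mono power_mono) auto
    also have "\<dots> = g ^ k * (2 ^ k * R)" by (simp add: power_mult_distrib)
    also have "\<dots> \<le> g ^ k * Q"
      unfolding Q_def using g \<open>0 < R\<close> that(2)
      by (intro mult_left_mono mult_right_mono power_increasing) auto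
    finally show ?thesis .
  qed
  have zeta_init: "\<bar>zeta ix a y\<bar> \<le> g ^ n * Q" if "y \<in> cube E R" for y
    using filt_init[OF that, of n] by (simp add: zeta)
  have "R \<le> G * Q"
  proof -
    have "1 * R \<le> 2 ^ n * R" using \<open>0 < R\<close> by (intro mult_right_mono) auto
    also have "\<dots> \<le> G * Q" using G Q by (simp add: Q_def[symmetric])
    finally show ?thesis by simp
  qed
  then have init_\<Omega>: "y \<in> \<Omega>" if "y \<in> cube E R" for y
    using zeta_init[OF that] norm_fst_cube_le[OF E that] that
    by (auto simp: \<Omega>_def W_def Bz_def R1_def cube_def intro: le_less_trans)
  define T where "T = \<tau>0 + Tz + L1 / g"
  have T: "0 < T" "\<tau>0 + Tz \<le> T" "\<tau>0 / 2 + L1 / g \<le> T" "0 \<le> L1 / g"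
    using \<tau>0 Tz L1(1) g by (auto simp: T_def intro: add_pos_nonneg)
  have main: "x t \<in> \<Omega> \<and> (T \<le> t \<longrightarrow> x t \<in> cube E \<epsilon>)"
    if reg: "regulated ix f q b a \<mu> U W x" and x0: "x 0 \<in> cube E R" and t: "0 \<le> t"
      and inside: "\<And>\<tau>. \<tau> \<in> {0..<t} \<Longrightarrow> x \<tau> \<in> \<Omega>" for x t
  proof -
    define \<theta> where "\<theta> k \<tau> = filt g k (X (x \<tau>)) 0 / g ^ k" for k \<tau>
    have zeta_bound: "\<bar>zeta ix a (x \<tau>)\<bar> \<le> max \<mu> (\<bar>zeta ix a (x 0)\<bar> - c * \<tau>)" if \<tau>: "\<tau> \<in> {0..t}" for \<tau>
    proof (rule regulated_zeta_bound[OF ix reg b \<open>0 < b0\<close>])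
      fix \<sigma> assume "0 < \<sigma>" "\<sigma> < \<tau>"
      then have "x \<sigma> \<in> \<Omega>" using inside \<tau> by auto
      then show "\<bar>zeta ix a (x \<sigma>)\<bar> < W \<and> \<bar>zeta_drift ix a q (x \<sigma>)\<bar> \<le> P"
        using drift by (auto simp: \<Omega>_def)
    qed (use \<mu> c U \<tau> in auto)
    have zeta_le: "\<bar>zeta ix a (x \<tau>)\<bar> \<le> g ^ n * Q" if \<tau>: "\<tau> \<in> {0..t}" for \<tau>
    proof -
      have "0 \<le> c * \<tau>" using c(1) \<tau> by simp
      then show ?thesis using zeta_bound[OF \<tau>] zeta_init[OF x0] \<mu>(2) by linarith
    qed
    have zeta_small: "\<bar>zeta ix a (x \<tau>)\<bar> \<le> \<mu>" if \<tau>: "\<tau> \<in> {\<tau>0 / 2..t}" for \<tau>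
    proof -
      have "c * (\<tau>0 / 2) \<le> c * \<tau>" using c(1) \<tau> by (intro mult_left_mono) auto
      then have "\<bar>zeta ix a (x 0)\<bar> - c * \<tau> \<le> 0" using zeta_init[OF x0] c(2) by linarith
      then show ?thesis using zeta_bound[of \<tau>] \<tau> \<tau>0(1) \<mu>(1) by auto
    qed
    have coordinate: "((\<lambda>\<tau>. X (x \<tau>) i) has_real_derivative X (x \<tau>) (Suc i)) (at \<tau> within {0..t})"
      if "i < n" "\<tau> \<in> {0..t}" for i \<tau>
      unfolding has_real_derivative_iff_has_vector_derivative X_def
    proof (rule regulated_component_derivative[OF reg bounded_linear_coordinate _ _ t that(2)])
      show "snd (plant ix f q b u y) $ ix (Suc i) = snd y $ ix (Suc (Suc i))" for u y
        using plant_coordinate[OF ix, of i f q b u y] that(1) N by simp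
    qed (intro linear_continuous_on bounded_linear_coordinate)
    have chain: "filter_chain g n \<theta> 0 t"
      unfolding filter_chain_def
    proof (intro allI impI ballI)
      fix k \<tau> assume k: "k < n" and \<tau>: "\<tau> \<in> {0..t}"
      have "((\<lambda>\<tau>. filt g k (X (x \<tau>)) 0) has_real_derivative filt g k (X (x \<tau>)) (Suc 0)) (at \<tau> within {0..t})"
        using filt_has_derivative[where X = "\<lambda>i \<tau>. X (x \<tau>) i" and n = n and i = 0 and k = k, OF coordinate] k \<tau> by simp
      then have "((\<lambda>\<tau>. filt g k (X (x \<tau>)) 0 / g ^ k) has_real_derivative
          filt g k (X (x \<tau>)) (Suc 0) / g ^ k) (at \<tau> within {0..t})" by (rule DERIV_cdivide)
      moreover have "filt g k (X (x \<tau>)) (Suc 0) / g ^ k = g * (\<theta> (Suc k) \<tau> - \<theta> k \<tau>)"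
        using g(2) by (simp add: \<theta>_def field_simps)
      ultimately show "(\<theta> k has_real_derivative g * (\<theta> (Suc k) \<tau> - \<theta> k \<tau>)) (at \<tau> within {0..t})"
        unfolding \<theta>_def by simp
    qed
    have \<theta>n: "\<bar>\<theta> n \<tau>\<bar> = \<bar>zeta ix a (x \<tau>)\<bar> / g ^ n" for \<tau>
      using g by (simp add: \<theta>_def zeta abs_divide)
    have \<theta>Q: "\<bar>\<theta> k \<tau>\<bar> \<le> Q" if "k \<le> n" "\<tau> \<in> {0..t}" for k \<tau>
    proof (rule filter_chain_invariant[OF chain _ _ _ that])
      show "\<bar>\<theta> k 0\<bar> \<le> Q" if "k \<le> n" for k
        using filt_init[OF x0 that] g by (simp add: \<theta>_def abs_divide field_simps)
      show "\<bar>\<theta> n \<tau>\<bar> \<le> Q" if "\<tau> \<in> {0..t}" for \<tau>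
        using zeta_le[OF that] g by (simp add: \<theta>n field_simps)
    qed (use g in auto)
    have late: "\<bar>\<theta> n \<tau>\<bar> \<le> \<mu>0" if "\<tau> \<in> {\<tau>0 / 2..t}" for \<tau>
      using zeta_small[OF that] g by (simp add: \<theta>n \<mu>_def field_simps)
    have chain': "filter_chain g n \<theta> (\<tau>0 / 2) t"
      using filter_chain_subinterval[OF chain] \<tau>0 by auto
    have \<theta>Q': "\<forall>k\<le>n. \<forall>\<tau>\<in>{\<tau>0 / 2..t}. \<bar>\<theta> k \<tau>\<bar> \<le> Q" using \<theta>Q \<tau>0(1) by auto
    have \<theta>\<nu>: "\<bar>\<theta> k \<tau>\<bar> \<le> \<nu>" if "k \<le> n" "\<tau> \<in> {\<tau>0..t}" for k \<tau>
    proof -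
      have "\<forall>\<tau>\<in>{\<tau>0 / 2..t}. \<bar>\<theta> n \<tau>\<bar> \<le> \<nu> / 2 ^ n" using late \<mu>0(3) by (meson order_trans)
      then have "\<forall>k\<le>n. \<forall>\<tau>\<in>{\<tau>0 / 2..t}. \<tau>0 / 2 + L / g \<le> \<tau> \<longrightarrow> \<bar>\<theta> k \<tau>\<bar> \<le> \<nu>"
        using L(2) g(2) chain' \<theta>Q' by blast
      moreover have "\<tau>0 / 2 + L / g \<le> \<tau>" using that(2) Lg unfolding atLeastAtMost_iff by linarith
      moreover have "\<tau> \<in> {\<tau>0 / 2..t}" using that(2) \<tau>0(1) by auto
      ultimately show ?thesis using that(1) by blast
    qed
    have \<theta>\<nu>1: "\<bar>\<theta> k t\<bar> \<le> \<nu>1" if "k \<le> n" "T \<le> t" for k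
    proof -
      have "\<forall>\<tau>\<in>{\<tau>0 / 2..t}. \<bar>\<theta> n \<tau>\<bar> \<le> \<nu>1 / 2 ^ n" using late \<mu>0(4) by (meson order_trans)
      then have "\<forall>k\<le>n. \<forall>\<tau>\<in>{\<tau>0 / 2..t}. \<tau>0 / 2 + L1 / g \<le> \<tau> \<longrightarrow> \<bar>\<theta> k \<tau>\<bar> \<le> \<nu>1"
        using L1(2) g(2) chain' \<theta>Q' by blast
      moreover have "\<tau>0 / 2 + L1 / g \<le> t" "t \<in> {\<tau>0 / 2..t}" using that(2) T by auto
      ultimately show ?thesis using that(1) by blast
    qed
    have X_le: "\<bar>X (x t) i\<bar> \<le> G * C" if C: "0 \<le> C" "\<And>k. k \<le> n \<Longrightarrow> \<bar>\<theta> k t\<bar> \<le> C" and "i \<le> n" for C i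
    proof -
      have "\<bar>filt g k (X (x t)) 0\<bar> \<le> g ^ n * C" if "k \<le> n" for k
      proof -
        have "\<bar>filt g k (X (x t)) 0\<bar> = g ^ k * \<bar>\<theta> k t\<bar>" using g by (simp add: \<theta>_def abs_divide)
        also have "\<dots> \<le> g ^ n * C" using g C that by (intro mult_mono power_increasing) auto
        finally show ?thesis .
      qed
      then have "\<bar>filt g 0 (X (x t)) i\<bar> \<le> (1 + g) ^ i * (g ^ n * C)"
        using g \<open>i \<le> n\<close> by (intro filt_inverse_bound[where n = n]) auto
      also have "\<dots> \<le> (1 + g) ^ n * (g ^ n * C)"
        using g C(1) \<open>i \<le> n\<close> by (intro mult_right_mono power_increasing) auto
      finally show ?thesis by (simp add: G_def mult.assoc)
    qed
    define z where "z \<tau> = fst (x \<tau>)" for \<tau>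
    define w where "w \<tau> = X (x \<tau>) 0" for \<tau>
    have w: "w \<tau> = \<theta> 0 \<tau>" for \<tau> by (simp add: w_def \<theta>_def)
    have driven: "driven_solution f w z 0 t"
      unfolding driven_solution_def z_def w_def X_def
      by (intro ballI regulated_component_derivative[OF reg bounded_linear_fst _ _ t])
        (simp add: plant_def, intro continuous_on_compose2[OF smooth_continuous_on[OF f, of UNIV] continuous_coordinates] subset_UNIV)
    have z_early: "norm (z \<tau>) \<le> R1 + 1" if \<tau>: "\<tau> \<in> {0..t}" "\<tau> \<le> \<tau>0" for \<tau>
    proof (cases "0 < \<tau>")
      case True
      have "\<exists>\<sigma>\<in>{0<..<\<tau>}. norm (z \<tau> - z 0) \<le> norm ((\<tau> - 0) *\<^sub>R f (z \<sigma>, w \<sigma>))"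
      proof (rule mvt_general[OF True])
        show "continuous_on {0..\<tau>} z"
          unfolding z_def by (intro continuous_intros regulated_continuous_on[OF reg])
        fix \<sigma> assume \<sigma>: "0 < \<sigma>" "\<sigma> < \<tau>"
        then have "(z has_vector_derivative f (z \<sigma>, w \<sigma>)) (at \<sigma> within {0..t})"
          using driven \<tau> by (auto simp: driven_solution_def)
        moreover have "at \<sigma> within {0..t} = at \<sigma>" using \<sigma> \<tau> by (intro at_within_Icc_at) auto
        ultimately show "(z has_derivative (\<lambda>h. h *\<^sub>R f (z \<sigma>, w \<sigma>))) (at \<sigma>)"
          by (simp add: has_vector_derivative_def)
      qed
      then obtain \<sigma> where \<sigma>: "\<sigma> \<in> {0<..<\<tau>}" "norm (z \<tau> - z 0) \<le> \<tau> * norm (f (z \<sigma>, w \<sigma>))"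
        using True by auto
      have "x \<sigma> \<in> \<Omega>" "\<bar>w \<sigma>\<bar> \<le> Q" using inside[of \<sigma>] \<theta>Q[of 0 \<sigma>] \<sigma> \<tau> by (auto simp: w)
      then have "norm (z \<sigma>, w \<sigma>) \<le> Bz + Q"
        using norm_Pair_le[of "z \<sigma>" "w \<sigma>"] by (simp add: \<Omega>_def z_def)
      then have "\<tau> * norm (f (z \<sigma>, w \<sigma>)) \<le> \<tau>0 * F"
        using F \<tau> \<tau>0 True by (intro mult_mono) auto
      then have "norm (z \<tau> - z 0) \<le> 1 / 2" using \<sigma>(2) \<tau>0(2) by (simp add: mult.commute)
      moreover have "norm (z 0) \<le> R1" using norm_fst_cube_le[OF E x0] by (simp add: z_def R1_def)
      ultimately show ?thesis using norm_triangle_sub[of "z \<tau>" "z 0"] by linarith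
    next
      case False
      then show ?thesis using \<tau> norm_fst_cube_le[OF E x0] by (simp add: z_def R1_def)
    qed
    have z_late: "norm (z t) \<le> B \<and> (\<tau>0 + Tz \<le> t \<longrightarrow> norm (z t) \<le> \<epsilon>)" if "\<tau>0 \<le> t"
    proof -
      have "driven_solution f w z \<tau>0 t" using driven_solution_subinterval[OF driven] \<tau>0 by auto
      moreover have "norm (z \<tau>0) \<le> R1 + 1" using z_early that \<tau>0 by auto
      moreover have "\<forall>\<tau>\<in>{\<tau>0..t}. \<bar>w \<tau>\<bar> \<le> \<nu>" using \<theta>\<nu>[of 0] by (simp add: w)
      moreover have "t \<in> {\<tau>0..t}" using that by simp
      ultimately show ?thesis using zstable by blast
    qed
    have "norm (z t) \<le> max B (R1 + 1)"
      using z_early[of t] z_late t by (cases "t \<le> \<tau>0") auto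
    then have "norm (fst (x t)) < Bz" by (simp add: z_def Bz_def)
    moreover have "\<bar>snd (x t) $ k\<bar> < G * Q + 1" for k
      using X_le[of Q] \<theta>Q[of _ t] index[of k] Q t by (fastforce simp: X_def)
    moreover have "\<bar>zeta ix a (x t)\<bar> < W" using zeta_le[of t] t by (simp add: W_def)
    moreover have "x t \<in> cube E \<epsilon>" if "T \<le> t"
    proof -
      have "\<bar>snd (x t) $ k\<bar> \<le> \<epsilon>" for k
        using X_le[of \<nu>1] \<theta>\<nu>1[OF _ that] index[of k] \<nu>1 by (fastforce simp: X_def)
      moreover have "norm (fst (x t)) \<le> \<epsilon>" using z_late that T Tz by (simp add: z_def)
      then have "\<bar>fst (x t) \<bullet> e\<bar> \<le> \<epsilon>" if "e \<in> E" for e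
        using Cauchy_Schwarz_ineq2[of "fst (x t)" e] E that by (simp add: orthonormal_basis_def)
      ultimately show ?thesis by (simp add: cube_def)
    qed
    ultimately show ?thesis by (simp add: \<Omega>_def)
  qed
  have stays: "x t \<in> \<Omega>" if "regulated ix f q b a \<mu> U W x" "x 0 \<in> cube E R" "0 \<le> t" for x t
  proof (rule stays_in_open[where s = 0 and d = t])
    show "continuous_on {0..t} x" by (rule regulated_continuous_on[OF that(1)])
    show "x 0 \<in> \<Omega>" using init_\<Omega> that(2) by blast
    show "x s \<in> \<Omega>" if "0 < s" "\<And>\<tau>. \<tau> \<in> {0..<s} \<Longrightarrow> x \<tau> \<in> \<Omega>" for s
      using main[OF \<open>regulated ix f q b a \<mu> U W x\<close> \<open>x 0 \<in> cube E R\<close> _ that(2)] that(1) by simp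
  qed (use \<open>open \<Omega>\<close> \<open>0 \<le> t\<close> in auto)
  have "\<forall>y\<in>cube E R. \<bar>zeta ix a y\<bar> < W"
    using zeta_init unfolding W_def by (meson le_less_trans less_add_one)
  moreover have "\<forall>x. regulated ix f q b a \<mu> U W x \<and> x 0 \<in> cube E R \<longrightarrow>
       (\<forall>t\<ge>0. \<bar>zeta ix a (x t)\<bar> < W) \<and> (\<forall>t\<ge>T. x t \<in> cube E \<epsilon>)"
  proof (intro allI impI conjI)
    fix x t
    assume x: "regulated ix f q b a \<mu> U W x \<and> x 0 \<in> cube E R"
    show "\<bar>zeta ix a (x t)\<bar> < W" if "0 \<le> t" using stays[of x t] x that by (simp add: \<Omega>_def)
    show "x t \<in> cube E \<epsilon>" if "T \<le> t"
    proof -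
      have "0 \<le> t" using that T(1) by simp
      then show ?thesis using main[of x t] stays[of x] x that by simp
    qed
  qed
  moreover have "\<mu> < W" using \<mu>(2) by (simp add: W_def)
  ultimately show ?thesis using \<mu>(1) U(1) T(1) by blast
qed

section \<open>The one-level logarithmic quantizer\<close>

text \<open>A component of the right-hand side that is continuous at \<open>y\<close> is not affected by the Krasowskii
regularization at \<open>y\<close>.\<close>

lemma krasowskii_hull_continuous_component:
  assumes h: "bounded_linear h" and cont: "isCont (\<lambda>y. h (H y)) y" and v: "v \<in> krasowskii_hull H y"
  shows "h v = h (H y)"
proof -
  have "dist (h v) (h (H y)) \<le> e" if "e > 0" for e
  proof -
    obtain d where d: "d > 0" "\<And>y'. dist y' y < d \<Longrightarrow> dist (h (H y')) (h (H y)) < e"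
      using cont \<open>e > 0\<close> unfolding continuous_at_eps_delta by blast
    define C where "C = h -` cball (h (H y)) e"
    have "closed C"
      unfolding C_def using linear_continuous_on[OF h]
      by (intro closed_vimage) (auto intro: continuous_on_subset)
    have "convex C"
      unfolding C_def by (intro convex_linear_vimage bounded_linear.linear[OF h] convex_cball)
    have "H ` ball y d \<subseteq> C"
      using d(2) by (force simp: C_def dist_commute)
    then have "closure (convex hull (H ` ball y d)) \<subseteq> C"
      using \<open>closed C\<close> \<open>convex C\<close> by (intro closure_minimal hull_minimal) auto
    moreover have "v \<in> closure (convex hull (H ` ball y d))"
      using v d(1) by (auto simp: krasowskii_hull_def)
    ultimately have "v \<in> C" by blast
    then show ?thesis by (simp add: C_def dist_commute)
  qed
  then have "dist (h v) (h (H y)) \<le> 0" by (rule field_le_epsilon[where y = 0, simplified])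
  then show ?thesis by simp
qed

lemma level_0: "level u0 \<delta> 0 = u0"
  by (simp add: level_def)

lemma quantizer_outer:
  assumes "0 < u0" "0 < \<delta>" "\<delta> < 1" "u0 / (1 + \<delta>) < \<bar>s\<bar>" "\<bar>s\<bar> \<le> u0 / (1 - \<delta>)"
  shows "quantizer u0 0 \<delta> s = u0 * sgn s"
proof -
  have "quantizer_nonneg u0 0 \<delta> \<bar>s\<bar> = u0"
    using assms by (auto simp: quantizer_nonneg_def in_band_def level_0 cong: conj_cong)
  moreover have "s \<noteq> 0" using assms by (auto dest: less_le_trans simp: field_simps)
  ultimately show ?thesis by (auto simp: quantizer_def sgn_real_def)
qed

lemma quantizer_inner:
  assumes "\<bar>s\<bar> \<le> u0 / (1 + \<delta>)"
  shows "quantizer u0 0 \<delta> s = 0"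
  using assms by (auto simp: quantizer_def quantizer_nonneg_def in_band_def level_0)

lemma abs_cont_curve_zeta_continuous:
  assumes "abs_cont_curve x"
  shows "continuous_on {0..d} (\<lambda>t. k * zeta ix a (x t))"
proof (cases "0 \<le> d")
  case True
  then have "continuous_on {0..d} x"
    using assms abs_cont_continuous_on by (auto simp: abs_cont_curve_def)
  from bounded_linear.continuous_on[OF bounded_linear_zeta this]
  show ?thesis by (intro continuous_intros)
qed simp

lemma one_sided_limits:
  fixes s :: "real \<Rightarrow> 'a::topological_space"
  assumes "\<And>d. continuous_on {0..d} s"
  shows "0 \<le> t \<Longrightarrow> (s \<longlongrightarrow> s t) (at_right t)" "0 < t \<Longrightarrow> (s \<longlongrightarrow> s t) (at_left t)"
proof -
  assume "0 \<le> t"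
  then have "continuous_on {t..t + 1} s" by (intro continuous_on_subset[OF assms[of "t + 1"]]) auto
  then show "(s \<longlongrightarrow> s t) (at_right t)"
    by (auto simp: continuous_on_def at_within_Icc_at_right[symmetric, of t "t + 1"])
next
  assume "0 < t"
  then show "(s \<longlongrightarrow> s t) (at_left t)"
    using assms[of t] by (auto simp: continuous_on_def at_within_Icc_at_left[symmetric, of 0 t])
qed

text \<open>In the Krasowskii hull only the component containing the input is uncertain, and solving that component
for the input shows every vector in the hull to be a value of the plant. In the open band
\<open>\<mu> < \<bar>\<zeta>\<bar> < W\<close> the quantizer is locally constant, so there \<open>\<zeta>'\<close> is not uncertain either; this determines
the input.\<close>

lemma quantized_regulated:
  fixes ix :: "nat \<Rightarrow> 'r::finite"
    and f :: "'z::real_inner \<times> real \<Rightarrow> 'z" and q b :: "'z \<times> (real ^ 'r) \<Rightarrow> real"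
  assumes ix: "bij_betw ix {1..CARD('r)} UNIV"
    and f: "continuous_on UNIV f" and q: "continuous_on UNIV q" and b: "continuous_on UNIV b" "\<And>y. b y > 0"
    and "0 < u0" "0 < \<mu>" "0 < \<delta>" "\<delta> < 1" and W: "(u0 / \<mu>) * W \<le> u0 / (1 - \<delta>)"
    and x: "quantized_trajectory ix f q b a (u0 / \<mu>) u0 0 \<delta> x"
  shows "regulated ix f q b a \<mu> u0 W x"
proof -
  define H where "H y = plant ix f q b (- quantizer u0 0 \<delta> (u0 / \<mu> * zeta ix a y)) y" for y
  have admissible: "\<exists>u. v = plant ix f q b u y \<and>
      (\<mu> < \<bar>zeta ix a y\<bar> \<and> \<bar>zeta ix a y\<bar> < W \<longrightarrow> u * sgn (zeta ix a y) \<le> - u0)"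
    if v: "v \<in> krasowskii_hull H y" for v y
  proof -
    have isCont: "isCont h y" if "continuous_on UNIV h" for h :: "'z \<times> (real ^ 'r) \<Rightarrow> 'c::topological_space"
      using that continuous_on_eq_continuous_at[OF open_UNIV] by blast
    define u where "u = (snd v $ ix CARD('r) - q y) / b y"
    have "fst v = fst (H y)"
    proof (rule krasowskii_hull_continuous_component[OF bounded_linear_fst _ v])
      have "continuous_on UNIV (\<lambda>y. f (fst y, snd y $ ix 1))"
        by (rule continuous_on_compose2[OF f continuous_coordinates]) simp
      then show "isCont (\<lambda>y. fst (H y)) y" unfolding H_def fst_plant by (rule isCont)
    qed
    then have "fst v = fst (plant ix f q b u y)" by (simp add: H_def fst_plant)
    moreover have "snd v $ k = snd (plant ix f q b u y) $ k" for k
    proof -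
      have "k \<in> ix ` {1..CARD('r)}" using ix by (simp add: bij_betw_def)
      then obtain j where j: "j \<in> {1..CARD('r)}" "k = ix j" by auto
      define i where "i = j - 1"
      have i: "k = ix (Suc i)" "i < CARD('r)" using j by (auto simp: i_def)
      show ?thesis
      proof (cases "Suc i < CARD('r)")
        case True
        then have H_i: "snd (H y) $ ix (Suc i) = snd y $ ix (Suc (Suc i))" for y
          by (simp add: H_def plant_coordinate[OF ix i(2)])
        have "snd v $ ix (Suc i) = snd (H y) $ ix (Suc i)"
        proof (rule krasowskii_hull_continuous_component[OF bounded_linear_coordinate _ v])
          show "isCont (\<lambda>y. snd (H y) $ ix (Suc i)) y"
            unfolding H_i by (intro isCont linear_continuous_on bounded_linear_coordinate)
        qed
        then show ?thesis unfolding H_i i(1) using True by (simp add: plant_coordinate[OF ix i(2)])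
      next
        case False
        then have "Suc i = CARD('r)" using i(2) by simp
        have "snd (plant ix f q b u y) $ ix (Suc i) = q y + b y * u"
          using plant_coordinate[OF ix i(2), of f q b u y] False by simp
        also have "\<dots> = snd v $ ix (Suc i)"
          using b(2)[of y] \<open>Suc i = CARD('r)\<close> by (simp add: u_def)
        finally show ?thesis by (simp add: i(1))
      qed
    qed
    ultimately have v_eq: "v = plant ix f q b u y" by (simp add: prod_eq_iff vec_eq_iff)
    moreover have "u * sgn (zeta ix a y) \<le> - u0" if band: "\<mu> < \<bar>zeta ix a y\<bar>" "\<bar>zeta ix a y\<bar> < W"
    proof -
      have saturated: "quantizer u0 0 \<delta> (u0 / \<mu> * zeta ix a y') = u0 * sgn (zeta ix a y')"
        if "\<mu> < \<bar>zeta ix a y'\<bar>" "\<bar>zeta ix a y'\<bar> < W" for y' :: "'z \<times> (real ^ 'r)"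
      proof -
        have k: "0 < u0 / \<mu>" using \<open>0 < u0\<close> \<open>0 < \<mu>\<close> by simp
        have abs: "\<bar>u0 / \<mu> * zeta ix a y'\<bar> = u0 / \<mu> * \<bar>zeta ix a y'\<bar>" by (simp only: abs_mult abs_of_pos[OF k])
        have "u0 / (1 + \<delta>) < u0 / \<mu> * \<mu>" using \<open>0 < u0\<close> \<open>0 < \<mu>\<close> \<open>0 < \<delta>\<close> by (simp add: field_simps)
        also have "\<dots> < u0 / \<mu> * \<bar>zeta ix a y'\<bar>" using that(1) k by (intro mult_strict_left_mono)
        finally have lower: "u0 / (1 + \<delta>) < \<bar>u0 / \<mu> * zeta ix a y'\<bar>" by (simp only: abs)
        have "u0 / \<mu> * \<bar>zeta ix a y'\<bar> \<le> u0 / \<mu> * W" using that(2) k by (intro mult_left_mono) auto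
        then have "\<bar>u0 / \<mu> * zeta ix a y'\<bar> \<le> u0 / (1 - \<delta>)" unfolding abs using W by (rule order_trans)
        from quantizer_outer[OF \<open>0 < u0\<close> \<open>0 < \<delta>\<close> \<open>\<delta> < 1\<close> lower this]
        have "quantizer u0 0 \<delta> (u0 / \<mu> * zeta ix a y') = u0 * sgn (u0 / \<mu> * zeta ix a y')" .
        then show ?thesis by (simp only: sgn_mult sgn_pos[OF k] mult_1_left)
      qed
      define s where "s = sgn (zeta ix a y)"
      have s: "s * s = 1" "s * zeta ix a y > \<mu>" "s * zeta ix a y < W"
        using band \<open>0 < \<mu>\<close> by (auto simp: s_def sgn_real_def)
      have cz: "continuous_on UNIV (zeta ix a :: 'z \<times> (real ^ 'r) \<Rightarrow> real)"
        by (rule linear_continuous_on[OF bounded_linear_zeta])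
      have "continuous_on UNIV (\<lambda>y :: 'z \<times> (real ^ 'r). s * zeta ix a y)" by (rule continuous_on_mult_left[OF cz])
      then have lim: "((\<lambda>y. s * zeta ix a y) \<longlongrightarrow> s * zeta ix a y) (nhds y)"
        using isCont[of "\<lambda>y. s * zeta ix a y"] unfolding isCont_def
        by (simp only: tendsto_at_iff_tendsto_nhds[where g = "\<lambda>y. s * zeta ix a y"])
      have "\<forall>\<^sub>F y' in nhds y. zeta ix a (H y') = zeta_drift ix a q y' + b y' * (- (u0 * s))"
        using order_tendstoD(1)[OF lim s(2)] order_tendstoD(2)[OF lim s(3)]
      proof eventually_elim
        case (elim y')
        have "s = 1 \<or> s = -1" using s(1) by (simp add: square_eq_1_iff)
        then have "\<mu> < \<bar>zeta ix a y'\<bar>" "\<bar>zeta ix a y'\<bar> < W" "sgn (zeta ix a y') = s"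
          using elim \<open>0 < \<mu>\<close> by auto
        then show ?case using saturated[of y'] by (simp add: H_def zeta_plant[OF ix])
      qed
      moreover have "isCont (\<lambda>y'. zeta_drift ix a q y' + b y' * (- (u0 * s))) y"
        unfolding zeta_drift_def
        by (intro isCont continuous_intros q b linear_continuous_on bounded_linear_coordinate)
      ultimately have "isCont (\<lambda>y'. zeta ix a (H y')) y" by (simp add: isCont_cong)
      from krasowskii_hull_continuous_component[OF bounded_linear_zeta this v]
      have "zeta_drift ix a q y + b y * u = zeta_drift ix a q y + b y * (- (u0 * s))"
        using saturated[OF band] by (simp add: v_eq zeta_plant[OF ix] H_def s_def)
      then have "b y * u = b y * (- (u0 * s))" by simp
      then have "u = - (u0 * s)" using b(2)[of y] by (metis mult_cancel_left less_irrefl)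
      then show ?thesis using s(1) by (simp add: s_def[symmetric] mult.assoc)
    qed
    ultimately show ?thesis by blast
  qed
  have "krasowskii_solution (\<lambda>t. H) x"
    using x by (simp add: quantized_trajectory_def H_def[abs_def])
  then have ac: "abs_cont_curve x" and ae: "AE t in lebesgue. 0 \<le> t \<longrightarrow>
        (\<exists>v. (x has_vector_derivative v) (at t) \<and> v \<in> krasowskii_hull H (x t))"
    by (auto simp: krasowskii_solution_def)
  show ?thesis
    unfolding regulated_def
  proof (intro conjI ac)
    show "AE t in lebesgue. 0 \<le> t \<longrightarrow>
        (\<exists>u. (x has_vector_derivative plant ix f q b u (x t)) (at t) \<and>
           (\<mu> < \<bar>zeta ix a (x t)\<bar> \<and> \<bar>zeta ix a (x t)\<bar> < W \<longrightarrow> u * sgn (zeta ix a (x t)) \<le> - u0))"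
      using ae by (rule eventually_mono) (use admissible in blast)
  qed
qed

section \<open>The one-level quantizer with hysteresis\<close>

text \<open>The open interval of signal values in which the hysteretic quantizer keeps a positive value \<open>v\<close>: its end points are
the guards of the transitions that leave \<open>v\<close>. The highest level \<open>u0\<close> is never left upwards.\<close>

definition positive_region :: "real \<Rightarrow> real \<Rightarrow> real \<Rightarrow> real \<Rightarrow> bool" where
  "positive_region u0 \<delta> v s \<longleftrightarrow>
     v = u0 \<and> u0 / (1 + \<delta>) < s \<or>
     v = u0 / (1 + \<delta>) \<and> u0 / (1 + \<delta>)\<^sup>2 < s \<and> s < u0 / (1 - \<delta>\<^sup>2)"

definition positive_region_closure :: "real \<Rightarrow> real \<Rightarrow> real \<Rightarrow> real \<Rightarrow> bool" where
  "positive_region_closure u0 \<delta> v s \<longleftrightarrow>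
     v = u0 \<and> u0 / (1 + \<delta>) \<le> s \<or>
     v = u0 / (1 + \<delta>) \<and> u0 / (1 + \<delta>)\<^sup>2 \<le> s \<and> s \<le> u0 / (1 - \<delta>\<^sup>2)"

definition region :: "real \<Rightarrow> real \<Rightarrow> real \<Rightarrow> real \<Rightarrow> bool" where
  "region u0 \<delta> v s \<longleftrightarrow> positive_region u0 \<delta> v s \<or> positive_region u0 \<delta> (- v) (- s) \<or>
     v = 0 \<and> \<bar>s\<bar> < u0 / (1 + \<delta>)"

definition region_closure :: "real \<Rightarrow> real \<Rightarrow> real \<Rightarrow> real \<Rightarrow> bool" where
  "region_closure u0 \<delta> v s \<longleftrightarrow>
     positive_region_closure u0 \<delta> v s \<or> positive_region_closure u0 \<delta> (- v) (- s) \<or>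
     v = 0 \<and> \<bar>s\<bar> \<le> u0 / (1 + \<delta>)"

lemma open_region: "open {s. region u0 \<delta> v s}"
  unfolding region_def positive_region_def
  by (intro open_Collect_disj open_Collect_conj open_Collect_const open_Collect_less continuous_intros)

lemma closed_region_closure: "closed {s. region_closure u0 \<delta> v s}"
  unfolding region_closure_def positive_region_closure_def
  by (intro closed_Collect_disj closed_Collect_conj closed_Collect_const closed_Collect_le continuous_intros)

lemma region_imp_closure: "region u0 \<delta> v s \<Longrightarrow> region_closure u0 \<delta> v s"
  by (auto simp: region_def positive_region_def region_closure_def positive_region_closure_def)

lemma guard_order:
  fixes u0 \<delta> :: real
  assumes "0 < u0" "0 < \<delta>" "\<delta> < 1"
  shows "0 < u0 / (1 + \<delta>)\<^sup>2" "u0 / (1 + \<delta>)\<^sup>2 < u0 / (1 + \<delta>)" "u0 / (1 + \<delta>) < u0 / (1 - \<delta>\<^sup>2)"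
proof -
  have "1 - \<delta>\<^sup>2 = (1 + \<delta>) * (1 - \<delta>)" by (simp add: power2_eq_square algebra_simps)
  moreover have "(1 + \<delta>) * (1 - \<delta>) < (1 + \<delta>) * 1" "0 < (1 + \<delta>) * (1 - \<delta>)"
    using assms by (auto intro!: mult_strict_left_mono)
  ultimately show "u0 / (1 + \<delta>) < u0 / (1 - \<delta>\<^sup>2)"
    using assms by (intro divide_strict_left_mono) auto
  have "(1 + \<delta>) * 1 < (1 + \<delta>) * (1 + \<delta>)" using assms by (intro mult_strict_left_mono) auto
  then show "u0 / (1 + \<delta>)\<^sup>2 < u0 / (1 + \<delta>)"
    using assms by (intro divide_strict_left_mono) (auto simp: power2_eq_square)
  show "0 < u0 / (1 + \<delta>)\<^sup>2" using assms by simp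
qed

lemma half_transition_region:
  assumes "0 < u0" "0 < \<delta>" "\<delta> < 1" "half_transition u0 0 \<delta> v s w"
  shows "positive_region u0 \<delta> w s \<or> w = 0 \<and> \<bar>s\<bar> < u0 / (1 + \<delta>)"
  using assms(4)
proof cases
  case 1
  then show ?thesis using guard_order[OF assms(1-3)] by (simp add: positive_region_def level_0)
next
  case 2
  then show ?thesis using guard_order[OF assms(1-3)] by (simp add: positive_region_def level_0)
next
  case 5
  then show ?thesis using guard_order[OF assms(1-3)] assms(1) by (simp add: level_0)
next
  case 6
  then show ?thesis using guard_order[OF assms(1-3)] by (simp add: positive_region_def level_0)
qed auto

text \<open>No boundary point is without a guard, so a value cannot persist when the signal reaches the end of its interval.\<close>

lemma boundary_half_transition:
  assumes "positive_region_closure u0 \<delta> v s" "\<not> positive_region u0 \<delta> v s"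
  shows "\<exists>w. half_transition u0 0 \<delta> v s w"
proof -
  consider "v = u0" "s = u0 / (1 + \<delta>)" | "v = u0 / (1 + \<delta>)" "s = u0 / (1 + \<delta>)\<^sup>2"
    | "v = u0 / (1 + \<delta>)" "s = u0 / (1 - \<delta>\<^sup>2)"
    using assms by (fastforce simp: positive_region_def positive_region_closure_def)
  then show ?thesis
    using half_transition.intros(1)[of 0 0 u0 \<delta>] half_transition.intros(2)[of 0 0 u0 \<delta>]
      half_transition.intros(5)[of u0 0 \<delta>]
    by cases (auto simp: level_0)
qed

lemma hysteresis_step_region:
  assumes pos: "0 < u0" "0 < \<delta>" "\<delta> < 1" and v: "region_closure u0 \<delta> v s"
    and step: "hysteresis_step u0 0 \<delta> v s w"
  shows "region u0 \<delta> w s"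
proof (cases "transition u0 0 \<delta> v s w")
  case True
  then show ?thesis
    using half_transition_region[OF pos, of v s w] half_transition_region[OF pos, of "- v" "- s" "- w"]
    by (auto simp: transition_def region_def)
next
  case False
  then have w: "w = v" and none: "\<And>w. \<not> half_transition u0 0 \<delta> v s w"
    "\<And>w. \<not> half_transition u0 0 \<delta> (- v) (- s) w"
    using step unfolding hysteresis_step_def transition_def by (blast, blast, metis minus_minus)
  have "\<bar>s\<bar> \<noteq> u0 / (1 + \<delta>)" if "v = 0"
    using none half_transition.intros(6)[of u0 0 \<delta>] that by (auto simp: level_0 abs_if split: if_splits)
  then show ?thesis
    using v none boundary_half_transition unfolding w region_def region_closure_def
    by (metis less_le)
qed

text \<open>By real induction: just before a switching time the signal is in the interval of the old value, in
the limit in its closure, and there either a transition occurs or the value is kept with the signal still inside.\<close>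

lemma hysteretic_output_region:
  assumes pos: "0 < u0" "0 < \<delta>" "\<delta> < 1" and s: "\<And>d. continuous_on {0..d} s"
    and s0: "\<bar>s 0\<bar> \<le> u0 / (1 - \<delta>)" and m: "hysteretic_output u0 0 \<delta> s m" and "0 \<le> t"
  shows "region u0 \<delta> (m t) (s t)"
proof (rule real_induction[OF _ _ \<open>0 \<le> t\<close>])
  fix t :: real assume t: "0 \<le> t" and IH: "\<And>\<tau>. 0 \<le> \<tau> \<Longrightarrow> \<tau> < t \<Longrightarrow> region u0 \<delta> (m \<tau>) (s \<tau>)"
  show "region u0 \<delta> (m t) (s t)"
  proof (cases "t = 0")
    case True
    have "region_closure u0 \<delta> (quantizer u0 0 \<delta> (s 0)) (s 0)"
    proof (cases "\<bar>s 0\<bar> \<le> u0 / (1 + \<delta>)")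
      case True
      then show ?thesis by (simp add: quantizer_inner region_closure_def)
    next
      case False
      moreover have "0 < u0 / (1 + \<delta>)" using pos by simp
      ultimately show ?thesis
        using quantizer_outer[OF pos, of "s 0"] s0
        by (auto simp: region_closure_def positive_region_closure_def sgn_real_def abs_if split: if_splits)
    qed
    then show ?thesis
      using hysteresis_step_region[OF pos] m True unfolding hysteretic_output_def by blast
  next
    case False
    then have "0 < t" using t by simp
    then obtain v where v: "\<forall>\<^sub>F \<tau> in at_left t. m \<tau> = v" "hysteresis_step u0 0 \<delta> v (s t) (m t)"
      using m unfolding hysteretic_output_def by blast
    have "\<forall>\<^sub>F \<tau> in at_left t. 0 < \<tau>" "\<forall>\<^sub>F \<tau> in at_left t. \<tau> < t"
      using \<open>0 < t\<close> by (auto simp: eventually_at_left_field)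
    with v(1) have "\<forall>\<^sub>F \<tau> in at_left t. s \<tau> \<in> {s. region_closure u0 \<delta> v s}"
      by eventually_elim (use IH region_imp_closure in force)
    then have "region_closure u0 \<delta> v (s t)"
      using Lim_in_closed_set[OF closed_region_closure _ _ one_sided_limits(2)[OF s \<open>0 < t\<close>]] by force
    then show ?thesis using hysteresis_step_region[OF pos] v(2) by blast
  qed
next
  fix t :: real assume t: "0 \<le> t" "region u0 \<delta> (m t) (s t)"
  have "\<forall>\<^sub>F \<tau> in at_right t. s \<tau> \<in> {s. region u0 \<delta> (m t) s}"
    using topological_tendstoD[OF one_sided_limits(1)[OF s t(1)] open_region] t(2) by simp
  moreover have "\<forall>\<^sub>F \<tau> in at_right t. m \<tau> = m t" using m t(1) by (simp add: hysteretic_output_def)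
  ultimately show "\<forall>\<^sub>F \<tau> in at_right t. region u0 \<delta> (m \<tau>) (s \<tau>)"
    by eventually_elim simp
qed

lemma region_outer_value:
  assumes "0 < u0" "0 < \<delta>" "\<delta> < 1" "region u0 \<delta> v s" "u0 / (1 + \<delta>) < \<bar>s\<bar>"
  shows "u0 / 2 \<le> v * sgn s"
proof -
  have *: "u0 / 2 \<le> u0 / (1 + \<delta>)" "u0 / 2 \<le> u0"
    by (intro divide_left_mono; use assms in simp) (use assms in simp)
  have "0 < s \<and> u0 / 2 \<le> v" if "positive_region u0 \<delta> v s" for v s
  proof -
    have "0 < u0 / (1 + \<delta>)" using assms by simp
    then show ?thesis
      using that * guard_order(1)[OF assms(1-3)] unfolding positive_region_def
      by (elim disjE conjE; intro conjI; linarith)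
  qed
  from this[of v s] this[of "- v" "- s"] show ?thesis
    using assms(4,5) by (auto simp: region_def)
qed

lemma hysteretic_regulated:
  fixes x :: "real \<Rightarrow> 'z::real_normed_vector \<times> (real ^ 'r::finite)"
  assumes pos: "0 < u0" "0 < \<delta>" "\<delta> < 1" and "0 < \<mu>"
    and x0: "\<bar>u0 / \<mu> * zeta ix a (x 0)\<bar> \<le> u0 / (1 - \<delta>)"
    and x: "hysteretic_trajectory ix f q b a (u0 / \<mu>) u0 0 \<delta> x"
  shows "regulated ix f q b a \<mu> (u0 / 2) W x"
proof -
  obtain m where m: "hysteretic_output u0 0 \<delta> (\<lambda>t. u0 / \<mu> * zeta ix a (x t)) m"
    and ac: "abs_cont_curve x"
    and ae: "AE t in lebesgue. 0 \<le> t \<longrightarrow> (x has_vector_derivative plant ix f q b (- m t) (x t)) (at t)"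
    using x unfolding hysteretic_trajectory_def caratheodory_solution_def by blast
  have k: "0 < u0 / \<mu>" using pos \<open>0 < \<mu>\<close> by simp
  have "- m t * sgn (zeta ix a (x t)) \<le> - (u0 / 2)" if "0 \<le> t" "\<mu> < \<bar>zeta ix a (x t)\<bar>" for t
  proof -
    have "region u0 \<delta> (m t) (u0 / \<mu> * zeta ix a (x t))"
      by (rule hysteretic_output_region[OF pos abs_cont_curve_zeta_continuous[OF ac] x0 m that(1)])
    moreover have "u0 / (1 + \<delta>) < \<bar>u0 / \<mu> * zeta ix a (x t)\<bar>"
    proof -
      have "u0 / (1 + \<delta>) < u0 / \<mu> * \<mu>" using pos \<open>0 < \<mu>\<close> by (simp add: field_simps)
      also have "\<dots> < u0 / \<mu> * \<bar>zeta ix a (x t)\<bar>" using that(2) k by (intro mult_strict_left_mono)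
      also have "\<dots> = \<bar>u0 / \<mu> * zeta ix a (x t)\<bar>" by (simp only: abs_mult abs_of_pos[OF k])
      finally show ?thesis .
    qed
    ultimately have "u0 / 2 \<le> m t * sgn (u0 / \<mu> * zeta ix a (x t))"
      by (rule region_outer_value[OF pos])
    then show ?thesis using pos \<open>0 < \<mu>\<close> by (simp add: sgn_mult)
  qed
  then show ?thesis
    unfolding regulated_def using ac ae by (auto elim!: eventually_mono)
qed

section \<open>The ternary switched controller\<close>

text \<open>The input is constant shortly before \<open>t\<close>, where \<open>\<bar>s\<bar> > \<eta>\<close> holds as well; hence its value is a fixed point
of the update rule for such signal values, and the only fixed point is the one opposing \<open>s\<close>.\<close>

lemma ternary_input_outer:
  assumes "0 < kbar" "0 < \<eta>" and s: "\<And>d. continuous_on {0..d} s"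
    and u: "ternary_input kbar \<eta> s u" and "0 \<le> t" "\<eta> < \<bar>s t\<bar>"
  shows "u t = - kbar * sgn (s t)"
proof (cases "t = 0")
  case True
  then show ?thesis using u assms by (auto simp: ternary_input_def ternary_init_def sgn_real_def abs_if split: if_splits)
next
  case False
  then have "0 < t" using \<open>0 \<le> t\<close> by simp
  have "\<forall>\<^sub>F \<tau> in at_left t. u \<tau> = u t" using u \<open>0 < t\<close> by (simp add: ternary_input_def)
  moreover have "\<forall>\<^sub>F \<tau> in at_left t. \<eta> < s \<tau> * sgn (s t)"
    using \<open>\<eta> < \<bar>s t\<bar>\<close> \<open>0 < \<eta>\<close>
    by (intro order_tendstoD(1)[OF tendsto_mult_right[OF one_sided_limits(2)[OF s \<open>0 < t\<close>]]])
      (auto simp: abs_sgn)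
  moreover have "\<forall>\<^sub>F \<tau> in at_left t. 0 < \<tau>"
    using \<open>0 < t\<close> by (auto simp: eventually_at_left_field)
  ultimately have "\<forall>\<^sub>F \<tau> in at_left t. u \<tau> = u t \<and> \<eta> < s \<tau> * sgn (s t) \<and> 0 < \<tau>"
    by eventually_elim simp
  then obtain c where c: "c < t" "\<And>\<tau>. c < \<tau> \<Longrightarrow> \<tau> < t \<Longrightarrow> u \<tau> = u t \<and> \<eta> < s \<tau> * sgn (s t) \<and> 0 < \<tau>"
    by (auto simp: eventually_at_left_field)
  define \<sigma> where "\<sigma> = (c + t) / 2"
  have \<sigma>: "c < \<sigma>" "\<sigma> < t" using c(1) by (auto simp: \<sigma>_def)
  have "\<forall>\<^sub>F \<tau> in at_right \<sigma>. u \<tau> = ternary_next kbar \<eta> (u \<sigma>) (s \<sigma>)"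
    using u less_imp_le[of 0 \<sigma>] c(2)[OF \<sigma>] unfolding ternary_input_def by blast
  moreover have "\<forall>\<^sub>F \<tau> in at_right \<sigma>. u \<tau> = u t"
    using \<sigma> c(2) by (auto simp: eventually_at_right_field intro!: exI[of _ t])
  ultimately have "\<exists>\<tau>. u \<tau> = ternary_next kbar \<eta> (u \<sigma>) (s \<sigma>) \<and> u \<tau> = u t"
    by (intro eventually_happens'[OF trivial_limit_at_right_real] eventually_conj)
  then have "u t = ternary_next kbar \<eta> (u t) (s \<sigma>)" using c(2)[OF \<sigma>] by metis
  moreover have "\<eta> < s \<sigma> * sgn (s t)" using c(2)[OF \<sigma>] by simp
  ultimately show ?thesis
    using assms by (auto simp: ternary_next_def sgn_real_def abs_if split: if_splits)
qed

lemma ternary_regulated: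
  fixes x :: "real \<Rightarrow> 'z::real_normed_vector \<times> (real ^ 'r::finite)"
  assumes "0 < kbar" "0 < \<eta>" and x: "ternary_trajectory ix f q b a kbar \<eta> x"
  shows "regulated ix f q b a \<eta> kbar W x"
proof -
  obtain u where u: "ternary_input kbar \<eta> (\<lambda>t. zeta ix a (x t)) u"
    and ac: "abs_cont_curve x"
    and ae: "AE t in lebesgue. 0 \<le> t \<longrightarrow> (x has_vector_derivative plant ix f q b (u t) (x t)) (at t)"
    using x unfolding ternary_trajectory_def caratheodory_solution_def by blast
  have "continuous_on {0..d} (\<lambda>t. zeta ix a (x t))" for d
    using abs_cont_curve_zeta_continuous[OF ac, of d 1] by simp
  then have "u t * sgn (zeta ix a (x t)) \<le> - kbar" if "0 \<le> t" "\<eta> < \<bar>zeta ix a (x t)\<bar>" for t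
    using ternary_input_outer[OF assms(1,2) _ u that] that(2) \<open>0 < \<eta>\<close> by (auto simp: sgn_real_def)
  then show ?thesis
    unfolding regulated_def using ac ae by (auto elim!: eventually_mono)
qed

section \<open>The three feedback laws\<close>

theorem proposition4:
  fixes E :: "'z::{real_inner, heine_borel} set"
    and ix :: "nat \<Rightarrow> 'r::finite"
    and f :: "'z \<times> real \<Rightarrow> 'z"
    and q b :: "'z \<times> (real ^ 'r) \<Rightarrow> real"
    and b0 R \<epsilon> :: real
  assumes "orthonormal_basis E"
    and "bij_betw ix {1..CARD('r)} UNIV"
    and "smooth f" and "smooth q" and "smooth b"
    and "minimum_phase f"
    and "b0 > 0" and "\<And>y. b y \<ge> b0"
    and "R > 0" and "\<epsilon> > 0"
  shows "\<exists>a :: nat \<Rightarrow> real.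
      (\<exists>kbar>0. \<exists>u0>0. \<exists>j. \<exists>\<delta>\<in>{0<..<1}. \<exists>T>0. \<forall>x.
         quantized_trajectory ix f q b a kbar u0 j \<delta> x \<and> x 0 \<in> cube E R \<longrightarrow>
           (\<forall>t\<ge>0. \<bar>kbar * zeta ix a (x t)\<bar> \<le> u0 / (1 - \<delta>)) \<and> (\<forall>t\<ge>T. x t \<in> cube E \<epsilon>)) \<and>
      (\<exists>kbar>0. \<exists>u0>0. \<exists>j. \<exists>\<delta>\<in>{0<..<1}. \<exists>T>0. \<forall>x.
         hysteretic_trajectory ix f q b a kbar u0 j \<delta> x \<and> x 0 \<in> cube E R \<longrightarrow>
           (\<forall>t\<ge>0. \<bar>kbar * zeta ix a (x t)\<bar> \<le> u0 / (1 - \<delta>)) \<and> (\<forall>t\<ge>T. x t \<in> cube E \<epsilon>)) \<and>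
      (\<exists>kbar>0. \<exists>\<eta>>0. \<exists>T>0. \<forall>x.
         ternary_trajectory ix f q b a kbar \<eta> x \<and> x 0 \<in> cube E R \<longrightarrow>
           (\<forall>t\<ge>T. x t \<in> cube E \<epsilon>))"
proof -
  have b_pos: "b y > 0" for y using assms(7) assms(8)[of y] by linarith
  obtain a \<mu> U W T where \<mu>: "0 < \<mu>" "\<mu> < W" and U: "0 < U" and T: "0 < T"
    and init: "\<forall>y\<in>cube E R. \<bar>zeta ix a y\<bar> < W"
    and regulation: "\<forall>x. regulated ix f q b a \<mu> U W x \<and> x 0 \<in> cube E R \<longrightarrow>
       (\<forall>t\<ge>0. \<bar>zeta ix a (x t)\<bar> < W) \<and> (\<forall>t\<ge>T. x t \<in> cube E \<epsilon>)"
    using practical_regulation[where b = b, OF assms(1-3) smooth_continuous_on[OF assms(4)] assms(6-10)] by blast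
  \<comment> \<open>With \<open>kbar = u0 / \<mu>\<close> this makes \<open>\<bar>\<zeta>\<bar> = W\<close> correspond exactly to the saturation bound.\<close>
  define \<delta> where "\<delta> = 1 - \<mu> / W"
  have \<delta>: "0 < \<delta>" "\<delta> < 1" using \<mu> by (auto simp: \<delta>_def)
  have range: "u0 / \<mu> * W = u0 / (1 - \<delta>)" for u0
    using \<mu> by (simp add: \<delta>_def)
  have within: "\<bar>u0 / \<mu> * z\<bar> \<le> u0 / (1 - \<delta>)" if "0 < u0" "\<bar>z\<bar> < W" for u0 z
  proof -
    have "\<bar>u0 / \<mu> * z\<bar> = u0 / \<mu> * \<bar>z\<bar>" using that(1) \<mu>(1) by (simp add: abs_mult)
    also have "\<dots> \<le> u0 / \<mu> * W" using that \<mu>(1) by (intro mult_left_mono) auto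
    finally show ?thesis by (simp only: range)
  qed
  have quantized: "regulated ix f q b a \<mu> U W x"
    if "quantized_trajectory ix f q b a (U / \<mu>) U 0 \<delta> x" for x
    by (rule quantized_regulated[OF assms(2) smooth_continuous_on[OF assms(3)]
          smooth_continuous_on[OF assms(4)] smooth_continuous_on[OF assms(5)] b_pos U \<mu>(1) \<delta> _ that])
      (simp only: range)
  \<comment> \<open>The lower positive value \<open>u0 / (1 + \<delta>)\<close> exceeds only half of \<open>u0\<close>, so \<open>u0\<close> is doubled.\<close>
  have hysteretic: "regulated ix f q b a \<mu> U W x"
    if "hysteretic_trajectory ix f q b a (2 * U / \<mu>) (2 * U) 0 \<delta> x" "x 0 \<in> cube E R" for x
    using hysteretic_regulated[of "2 * U" \<delta> \<mu> ix a x f q b W] U \<delta> \<mu>(1) within[of "2 * U" "zeta ix a (x 0)"]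
      init that by simp
  have ternary: "regulated ix f q b a \<mu> U W x" if "ternary_trajectory ix f q b a U \<mu> x" for x
    by (rule ternary_regulated[OF U \<mu>(1) that])
  have "\<forall>x. quantized_trajectory ix f q b a (U / \<mu>) U 0 \<delta> x \<and> x 0 \<in> cube E R \<longrightarrow>
      (\<forall>t\<ge>0. \<bar>U / \<mu> * zeta ix a (x t)\<bar> \<le> U / (1 - \<delta>)) \<and> (\<forall>t\<ge>T. x t \<in> cube E \<epsilon>)"
    using quantized regulation within U by blast
  moreover have "\<forall>x. hysteretic_trajectory ix f q b a (2 * U / \<mu>) (2 * U) 0 \<delta> x \<and> x 0 \<in> cube E R \<longrightarrow>
      (\<forall>t\<ge>0. \<bar>2 * U / \<mu> * zeta ix a (x t)\<bar> \<le> 2 * U / (1 - \<delta>)) \<and> (\<forall>t\<ge>T. x t \<in> cube E \<epsilon>)"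
    using hysteretic regulation within[of "2 * U"] U by simp
  moreover have "\<forall>x. ternary_trajectory ix f q b a U \<mu> x \<and> x 0 \<in> cube E R \<longrightarrow> (\<forall>t\<ge>T. x t \<in> cube E \<epsilon>)"
    using ternary regulation by blast
  moreover have "0 < U / \<mu>" "0 < 2 * U / \<mu>" "0 < 2 * U" "\<delta> \<in> {0<..<1}" using U \<mu> \<delta> by auto
  ultimately show ?thesis using U T \<mu>(1) by blast
qed

end
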